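(* Let $d\ge1$, let $\|\cdot\|$ be a norm on $\mathbb{R}^d$, and let $(X_t)_{t\in\mathbb{Z}}$ be a stationary regularly varying time series with values in $\mathbb{R}^d$, with index of regular variation $\alpha>0$ and spectral tail process $(\Theta_t)_{t\in\mathbb{Z}}$ with values in $[0,\infty)^d$ that satisfies $0<\sum_{t\in\mathbb{Z}}\|\Theta_t\|^\alpha<\infty$ almost surely. Let $$(Z_t)_{t\in\mathbb{Z}}=\left(\bigvee_{i\in\mathbb{N}}U_i\,\frac{\Theta^{(i)}_{t+T_i}}{\|(\Theta^{(i)}_l)_{l\in\mathbb{Z}}\|_\alpha}\right)_{t\in\mathbb{Z}},$$ where $(U_i,T_i,(\Theta_t^{(i)})_{t\in\mathbb{Z}})_{i\in\mathbb{N}}$ is an enumeration of the points of a Poisson point process on $(0,\infty)\times\mathbb{Z}\times([0,\infty)^d)^{\mathbb{Z}}$ with intensity $\alpha u^{-\alpha-1}\,du\otimes\lambda(dt)\otimes P^{(\Theta_t)_{t\in\mathbb{Z}}}(d\theta)$, $\lambda$ is the counting measure on $\mathbb{Z}$ and $P^{(\Theta_t)_{t\in\mathbb{Z}}}$ is the law of $(\Theta_t)_{t\in\mathbb{Z}}$. Then for each $t\in\mathbb{N}_0$ there exists a sequence $b_n>0$, $n\in\mathbb{N}$, of normalizing constants such that $$\bigvee_{i=1}^n\frac{(X_0,\dots,X_t)^i}{b_n}\ \overset{w}{\Rightarrow}\ (Z_0,\dots,Z_t),\qquad n\to\infty,$$ where $(X_0,\dots,X_t)^i$, $i\in\mathbb{N}$,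 are i.i.d. copies of $(X_0,\dots,X_t)$. All maxima are taken componentwise and $\overset{w}{\Rightarrow}$ denotes weak convergence.
   Context: Notation: $\|(\theta_t)_{t\in\mathbb{Z}}\|_\alpha:=\left(\sum_{t\in\mathbb{Z}}\|\theta_t\|^\alpha\right)^{1/\alpha}$ (also for $\alpha<1$). Regularly varying time series with index $\alpha$: all finite-dimensional distributions are multivariate regularly varying, with index $\alpha$. Spectral tail process: for a stationary $\mathbb{R}^d$-valued time series $(X_t)_{t\in\mathbb{Z}}$, a time series $(\Theta_t)_{t\in\mathbb{Z}}$ such that for all integers $s\le t$, the conditional law of $(X_s/\|X_0\|,\dots,X_t/\|X_0\|)$ given $\|X_0\|>x$ converges weakly to the law of $(\Theta_s,\dots,\Theta_t)$ as $x\to\infty$. *)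

theory Defs
  imports "HOL-Probability.Probability"
begin

definition is_norm :: "('a::real_vector \<Rightarrow> real) \<Rightarrow> bool" where
  "is_norm N \<longleftrightarrow>
     (\<forall>x. 0 \<le> N x) \<and> (\<forall>x. N x = 0 \<longleftrightarrow> x = 0) \<and>
     (\<forall>c x. N (c *\<^sub>R x) = \<bar>c\<bar> * N x) \<and> (\<forall>x y. N (x + y) \<le> N x + N y)"

text \<open>
  Weak convergence of finite measures on a topological space. For convergence in \<open>(\<real>\<^sup>d)\<^sup>J\<close> the
  topology is the product topology on the functions that are undefined outside \<open>J\<close>, which is
  the space underlying \<open>Pi\<^sub>M J (\<lambda>_. borel)\<close>; there, for finite \<open>J\<close>, continuous functions are
  Borel measurable.
\<close>
definition weakly_converges ::
  "'a topology \<Rightarrow> ('i \<Rightarrow> 'a measure) \<Rightarrow> 'a measure \<Rightarrow> 'i filter \<Rightarrow> bool" where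
  "weakly_converges T \<mu> \<nu> F \<longleftrightarrow>
     (\<forall>f::'a \<Rightarrow> real. continuous_map T euclidean f \<and> bounded (f ` topspace T) \<longrightarrow>
        ((\<lambda>i. \<integral>x. f x \<partial>\<mu> i) \<longlongrightarrow> (\<integral>x. f x \<partial>\<nu>)) F)"

abbreviation vecs :: "int set \<Rightarrow> (int \<Rightarrow> 'v::topological_space) measure" where
  "vecs J \<equiv> Pi\<^sub>M J (\<lambda>_. borel)"

abbreviation vecs_top :: "int set \<Rightarrow> (int \<Rightarrow> 'v::topological_space) topology" where
  "vecs_top J \<equiv> product_topology (\<lambda>_. euclidean) J"

definition stationary :: "'a measure \<Rightarrow> (int \<Rightarrow> 'a \<Rightarrow> 'v::topological_space) \<Rightarrow> bool" where
  "stationary M X \<longleftrightarrow>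
     (\<forall>h. distr M (vecs UNIV) (\<lambda>\<omega> t. X (t + h) \<omega>) = distr M (vecs UNIV) (\<lambda>\<omega> t. X t \<omega>))"

text \<open>Regular variation does not depend on the norm chosen on \<open>(\<real>\<^sup>d)\<^sup>J\<close>; we use the maximum of
  the given norm \<open>N\<close> over the coordinate blocks.\<close>
definition block_norm :: "('v \<Rightarrow> real) \<Rightarrow> int set \<Rightarrow> (int \<Rightarrow> 'v) \<Rightarrow> real" where
  "block_norm N J x = (MAX k\<in>J. N (x k))"

text \<open>
  Multivariate regular variation with index \<open>\<alpha>\<close> of a random vector \<open>Y\<close> in \<open>(\<real>\<^sup>d)\<^sup>J\<close>: for some
  probability law \<open>S\<close> on the unit sphere and every \<open>u > 0\<close>, the measures
  \<open>P(\<parallel>Y\<parallel> > u x, Y/\<parallel>Y\<parallel> \<in> \<cdot>) / P(\<parallel>Y\<parallel> > x)\<close> converge weakly to \<open>u\<^sup>-\<^sup>\<alpha> S(\<cdot>)\<close> as \<open>x \<rightarrow> \<infinity>\<close>.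
  The case \<open>u = 1\<close> and \<open>f = 1\<close> rules out bounded \<open>Y\<close>, since \<open>0 / 0 = 0\<close>.
\<close>
definition regularly_varying_vector ::
  "('v::real_normed_vector \<Rightarrow> real) \<Rightarrow> real \<Rightarrow> int set \<Rightarrow> 'a measure \<Rightarrow> ('a \<Rightarrow> int \<Rightarrow> 'v) \<Rightarrow> bool"
  where
  "regularly_varying_vector N \<alpha> J M Y \<longleftrightarrow>
     (\<exists>S. prob_space S \<and> sets S = sets (vecs J) \<and> (AE \<theta> in S. block_norm N J \<theta> = 1) \<and>
        (\<forall>u>0. weakly_converges (vecs_top J)
           (\<lambda>x. distr
              (density M (\<lambda>\<omega>. indicator {\<omega>\<in>space M. block_norm N J (Y \<omega>) > u * x} \<omega>
                              / emeasure M {\<omega>\<in>space M. block_norm N J (Y \<omega>) > x}))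
              (vecs J) (\<lambda>\<omega>. \<lambda>k\<in>J. Y \<omega> k /\<^sub>R block_norm N J (Y \<omega>)))
           (scale_measure (ennreal (u powr (- \<alpha>))) S) at_top))"

definition regularly_varying ::
  "('v::real_normed_vector \<Rightarrow> real) \<Rightarrow> real \<Rightarrow> 'a measure \<Rightarrow> (int \<Rightarrow> 'a \<Rightarrow> 'v) \<Rightarrow> bool" where
  "regularly_varying N \<alpha> M X \<longleftrightarrow>
     (\<forall>J. finite J \<and> J \<noteq> {} \<longrightarrow> regularly_varying_vector N \<alpha> J M (\<lambda>\<omega>. \<lambda>k\<in>J. X k \<omega>))"

text \<open>\<open>\<Theta>\<close> may live on a probability space of its own.\<close>
definition spectral_tail_process ::
  "('v::real_normed_vector \<Rightarrow> real) \<Rightarrow> 'a measure \<Rightarrow> (int \<Rightarrow> 'a \<Rightarrow> 'v) \<Rightarrow>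
     'b measure \<Rightarrow> (int \<Rightarrow> 'b \<Rightarrow> 'v) \<Rightarrow> bool" where
  "spectral_tail_process N M X Q \<Theta> \<longleftrightarrow>
     (\<forall>s t. s \<le> t \<longrightarrow>
        weakly_converges (vecs_top {s..t})
          (\<lambda>x. distr (uniform_measure M {\<omega>\<in>space M. N (X 0 \<omega>) > x})
                 (vecs {s..t}) (\<lambda>\<omega>. \<lambda>k\<in>{s..t}. X k \<omega> /\<^sub>R N (X 0 \<omega>)))
          (distr Q (vecs {s..t}) (\<lambda>\<omega>. \<lambda>k\<in>{s..t}. \<Theta> k \<omega>)) at_top)"

definition alpha_norm :: "('v \<Rightarrow> real) \<Rightarrow> real \<Rightarrow> (int \<Rightarrow> 'v) \<Rightarrow> real" where
  "alpha_norm N \<alpha> \<theta> = (\<Sum>\<^sub>\<infinity>t. N (\<theta> t) powr \<alpha>) powr (1 / \<alpha>)"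

definition count_points :: "(nat \<Rightarrow> 'c \<Rightarrow> 'e) \<Rightarrow> 'e set \<Rightarrow> 'c \<Rightarrow> ennreal" where
  "count_points V A \<omega> = emeasure (count_space UNIV) {i. V i \<omega> \<in> A}"

text \<open>
  \<open>V\<close> enumerates the points of a Poisson point process on \<open>space \<mu>\<close> with intensity \<open>\<mu>\<close>, in the
  sense that the counting measure of the points is a Poisson random measure. The Poisson
  probabilities are spelled out because \<open>poisson_pmf\<close> requires a positive rate, whereas
  \<open>\<mu> A = 0\<close> has to be included.
\<close>
definition poisson_points :: "'c measure \<Rightarrow> 'e measure \<Rightarrow> (nat \<Rightarrow> 'c \<Rightarrow> 'e) \<Rightarrow> bool" where
  "poisson_points P \<mu> V \<longleftrightarrow>
     prob_space P \<and> (\<forall>i. V i \<in> measurable P \<mu>) \<and>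
     (\<forall>A\<in>sets \<mu>. emeasure \<mu> A < \<infinity> \<longrightarrow>
        (\<forall>k::nat. measure P {\<omega>\<in>space P. count_points V A \<omega> = of_nat k}
                  = measure \<mu> A ^ k / fact k * exp (- measure \<mu> A))) \<and>
     (\<forall>A\<in>sets \<mu>. emeasure \<mu> A = \<infinity> \<longrightarrow> (AE \<omega> in P. count_points V A \<omega> = \<infinity>)) \<and>
     (\<forall>(n::nat) A. (\<forall>j<n. A j \<in> sets \<mu>) \<and> disjoint_family_on A {..<n} \<longrightarrow>
        prob_space.indep_vars P (\<lambda>_. borel) (\<lambda>j. count_points V (A j)) {..<n})"

text \<open>The intensity \<open>\<alpha> u\<^sup>-\<^sup>\<alpha>\<^sup>-\<^sup>1 du \<otimes> \<lambda>(dt) \<otimes> P\<^sup>\<Theta>(d\<theta>)\<close> on \<open>(0,\<infinity>) \<times> \<int> \<times> ([0,\<infinity>)\<^sup>d)\<^sup>\<int>\<close>.\<close>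
definition intensity ::
  "real \<Rightarrow> 'b measure \<Rightarrow> (int \<Rightarrow> 'b \<Rightarrow> real^'d) \<Rightarrow> (real \<times> int \<times> (int \<Rightarrow> real^'d)) measure" where
  "intensity \<alpha> Q \<Theta> =
     density (restrict_space lborel {0<..}) (\<lambda>u. ennreal (\<alpha> * u powr (- \<alpha> - 1)))
     \<Otimes>\<^sub>M (count_space UNIV
     \<Otimes>\<^sub>M distr Q (Pi\<^sub>M UNIV (\<lambda>_. restrict_space borel {v. \<forall>j. 0 \<le> v $ j})) (\<lambda>\<omega> t. \<Theta> t \<omega>))"

text \<open>The supremum is that of the reals, hence unspecified when the set is unbounded; under the
  assumptions on \<open>U\<close>, \<open>T\<close>, \<open>\<Xi>\<close> this happens with probability \<open>0\<close> only. Likewise \<open>alpha_norm\<close> is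
  almost surely finite and positive at the points.\<close>
definition max_stable_limit ::
  "(real^'d \<Rightarrow> real) \<Rightarrow> real \<Rightarrow> (nat \<Rightarrow> 'c \<Rightarrow> real) \<Rightarrow> (nat \<Rightarrow> 'c \<Rightarrow> int) \<Rightarrow>
     (nat \<Rightarrow> 'c \<Rightarrow> int \<Rightarrow> real^'d) \<Rightarrow> int \<Rightarrow> 'c \<Rightarrow> real^'d" where
  "max_stable_limit N \<alpha> U T \<Xi> t \<omega> =
     (\<chi> j. SUP i. U i \<omega> * (\<Xi> i \<omega> (t + T i \<omega>) $ j / alpha_norm N \<alpha> (\<Xi> i \<omega>)))"

text \<open>\<open>Y 1, Y 2, \<dots>\<close> are i.i.d. copies, on a probability space \<open>P\<close>, of the random vector
  \<open>(X k)\<close>, \<open>k \<in> J\<close>, on \<open>M\<close>.\<close>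
definition iid_copies ::
  "'e measure \<Rightarrow> (nat \<Rightarrow> 'e \<Rightarrow> int \<Rightarrow> 'v::topological_space) \<Rightarrow> int set \<Rightarrow>
     'a measure \<Rightarrow> (int \<Rightarrow> 'a \<Rightarrow> 'v) \<Rightarrow> bool" where
  "iid_copies P Y J M X \<longleftrightarrow>
     prob_space P \<and> prob_space.indep_vars P (\<lambda>_. vecs J) Y {1..} \<and>
     (\<forall>i\<ge>1. distr P (vecs J) (Y i) = distr M (vecs J) (\<lambda>\<omega>. \<lambda>k\<in>J. X k \<omega>))"

end

theory Submission
  imports Defs
begin

text \<open>
  Write \<open>F x = P(N X\<^sub>0 > x)\<close>. Regular variation makes
  \<open>\<lambda>(H) = lim P(H(X\<^sub>0, \<dots>, X\<^sub>t) > x) / F x\<close> exist for continuous homogeneous \<open>H \<ge> 0\<close> and gives it as the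
  integral of \<open>H\<^sup>\<alpha>\<close> against a fixed measure, so \<open>\<lambda>\<close> is additive in \<open>H\<^sup>\<alpha>\<close>; it is shift invariant by
  stationarity, and \<open>\<lambda>(H) = E H(\<Theta>)\<^sup>\<alpha>\<close> when \<open>H\<close> is bounded by a multiple of the norm at time \<open>0\<close>. Splitting
  \<open>H\<^sup>\<alpha>\<close> over the times \<open>l\<close> of a window \<open>L\<close> with weights \<open>N(x\<^sub>l)\<^sup>\<alpha> / \<Sum>\<^sub>k\<^sub>\<in>\<^sub>L N(x\<^sub>k)\<^sup>\<alpha>\<close> and shifting every part to the
  origin gives \<open>\<lambda>(H) = \<Sum>\<^sub>l\<^sub>\<in>\<^sub>L E (H(\<Theta>\<^sub>\<cdot>\<^sub>-\<^sub>l)\<^sup>\<alpha> / \<Sum>\<^sub>k\<^sub>\<in>\<^sub>L N(\<Theta>\<^sub>k\<^sub>-\<^sub>l)\<^sup>\<alpha>)\<close>. Letting \<open>L\<close> grow to \<open>\<int>\<close>, this becomes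
  \<open>\<Sum>\<^sub>l E (H(\<Theta>\<^sub>\<cdot>\<^sub>-\<^sub>l)\<^sup>\<alpha> / \<Sum>\<^sub>k N(\<Theta>\<^sub>k)\<^sup>\<alpha>)\<close>: the lower bound is termwise, and it is an equality for the norms of the
  single components, hence for every \<open>H\<close>. The right-hand side is the intensity of the points that
  exceed a level, so \<open>exp(- \<lambda>(H))\<close> is a void probability of the Poisson process, and it is also the
  limit of \<open>(1 - P(H(X) > b\<^sub>n))\<^sup>n\<close> when \<open>n F(b\<^sub>n) \<rightarrow> 1\<close>.
\<close>

section \<open>Tails of products and normalizing sequences\<close>

text \<open>Three obstacles shape the argument. The hypotheses are weak limits tested on bounded
  continuous functions, while maxima ask about events \<open>x < H\<close>. Continuous homogeneous
  \<open>H\<close> reconcile the two: \<open>H\<close> of the series is a radius times a bounded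
  angular factor, and \<open>tail_product_limit\<close> serves both regular variation and the
  spectral tail process. The series itself may have negative components; the functionals used are
  cut at 0 and do not see them, and they vanish only after division by \<open>b n\<close>. Next,
  \<open>\<Theta>\<close> describes the series only given a large value at time 0. The weights are
  chosen so that the part belonging to time \<open>l\<close> is at most a multiple of the norm at
  \<open>l\<close>, and hence comes within reach of \<open>\<Theta>\<close> after a shift. Finally,
  when the window grows, each term decreases while new terms appear, and nothing dominates them, so
  mass might be lost. A conservation law excludes this: summed over all shifts, the powers of the
  norms in the numerator rebuild the whole denominator, so a single component has mass exactly 1. A
  functional and its complement in a multiple of the sum of such components cannot lose mass without
  the sum losing it.\<close>

definition hat :: "real \<Rightarrow> nat \<Rightarrow> real \<Rightarrow> real" where
  "hat h i s = max 0 (min 1 (s / h - real i + 1)) - max 0 (min 1 (s / h - real i))"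

lemma hat_bounds: "0 \<le> hat h i s" "hat h i s \<le> 1"
  by (auto simp: hat_def)

lemma continuous_on_hat: "continuous_on UNIV (hat h i)"
  unfolding hat_def divide_inverse by (intro continuous_intros)

lemma borel_measurable_hat [measurable]: "hat h i \<in> borel_measurable borel"
  by (rule borel_measurable_continuous_onI[OF continuous_on_hat])

lemma hat_support:
  assumes "hat h i s \<noteq> 0" "h > 0"
  shows "(real i - 1) * h < s" "s < (real i + 1) * h"
proof -
  have "real i - 1 < s / h" "s / h < real i + 1"
    using assms(1) by (auto simp: hat_def max_def min_def split: if_splits)
  then show "(real i - 1) * h < s" "s < (real i + 1) * h"
    using assms(2) by (auto simp: field_simps)
qed

text \<open>Each hat is the difference of two consecutive ramps, so the sum telescopes to the first
  ramp minus the last. On \<open>[0, m h]\<close> these are 1 and 0.\<close>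

lemma sum_hat:
  assumes "h > 0" "0 \<le> s" "s \<le> real m * h"
  shows "(\<Sum>i\<le>m. hat h i s) = 1"
proof -
  let ?g = "\<lambda>i. max 0 (min 1 (s / h - real i + 1))"
  have "(\<Sum>i\<le>m. hat h i s) = (\<Sum>i\<le>m. ?g i - ?g (Suc i))"
    by (intro sum.cong) (auto simp: hat_def)
  also have "\<dots> = ?g 0 - ?g (Suc m)"
    by (rule sum_telescope)
  also have "\<dots> = 1"
    using assms by (auto simp: field_simps min_def max_def)
  finally show ?thesis .
qed

text \<open>The values of \<open>\<zeta>\<close> are localised by a partition of unity into hats of width \<open>2 h\<close>; on the
  support of each hat, \<open>x < R \<zeta>\<close> is squeezed between two conditions on \<open>R\<close> alone.\<close>
lemma tail_product_limit:
  fixes R \<zeta> :: "'a \<Rightarrow> real" and \<zeta>' :: "'b \<Rightarrow> real" and D :: "real \<Rightarrow> real"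
  assumes "prob_space M" "finite_measure K" and \<alpha>: "\<alpha> > 0"
    and [measurable]: "R \<in> borel_measurable M" "\<zeta> \<in> borel_measurable M" "\<zeta>' \<in> borel_measurable K"
    and \<zeta>: "\<And>\<omega>. \<omega> \<in> space M \<Longrightarrow> 0 \<le> \<zeta> \<omega> \<and> \<zeta> \<omega> \<le> C"
    and \<zeta>': "AE \<omega> in K. 0 \<le> \<zeta>' \<omega> \<and> \<zeta>' \<omega> \<le> C"
    and D: "\<And>x. D x > 0"
    and lim: "\<And>u \<phi>. u > 0 \<Longrightarrow> continuous_on UNIV \<phi> \<Longrightarrow> (\<And>s. 0 \<le> \<phi> s \<and> \<phi> s \<le> (1::real)) \<Longrightarrow>
      ((\<lambda>x. (\<integral>\<omega>. \<phi> (\<zeta> \<omega>) * indicator {\<omega>\<in>space M. u * x < R \<omega>} \<omega> \<partial>M) / D x)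
        \<longlongrightarrow> u powr (- \<alpha>) * (\<integral>\<omega>. \<phi> (\<zeta>' \<omega>) \<partial>K)) at_top"
  shows "((\<lambda>x. measure M {\<omega>\<in>space M. x < R \<omega> * \<zeta> \<omega>} / D x)
    \<longlongrightarrow> (\<integral>\<omega>. \<zeta>' \<omega> powr \<alpha> \<partial>K)) at_top"
proof -
  interpret M: prob_space M by fact
  interpret K: finite_measure K by fact
  have C: "0 \<le> C"
  proof -
    obtain \<omega> where "\<omega> \<in> space M" using M.not_empty by blast
    then show ?thesis using \<zeta>[of \<omega>] by linarith
  qed
  \<comment> \<open>\<open>a\<close> will be an endpoint of the support of the \<open>i\<close>-th
    hat; the level \<open>x / a\<close> for \<open>R\<close> turns into the factor
    \<open>a powr \<alpha>\<close> in the limit.\<close>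
  define q where "q a i h x = (\<integral>\<omega>. hat h i (\<zeta> \<omega>) * indicator {\<omega>\<in>space M. inverse a * x < R \<omega>} \<omega> \<partial>M)"
    for a i h x
  have q_lim: "((\<lambda>x. q a i h x / D x) \<longlongrightarrow> (\<integral>\<omega>. a powr \<alpha> * hat h i (\<zeta>' \<omega>) \<partial>K)) at_top" if "a > 0" for a i h
  proof -
    have "inverse a powr (-\<alpha>) = a powr \<alpha>"
      using that by (simp add: powr_minus powr_divide inverse_eq_divide)
    then show ?thesis
      using lim[of "inverse a" "hat h i"] that by (simp add: q_def hat_bounds continuous_on_hat)
  qed
  have int_hat: "integrable M (\<lambda>\<omega>. hat h i (\<zeta> \<omega>) * indicator {\<omega>\<in>space M. v < R \<omega>} \<omega>)" for h i v
    by (intro M.integrable_const_bound[where B=1])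
       (auto simp: hat_bounds indicator_def intro!: AE_I2)
  have int_ind: "integrable M (\<lambda>\<omega>. indicator {\<omega>\<in>space M. x < R \<omega> * \<zeta> \<omega>} \<omega> :: real)" for x
    by (rule M.integrable_const_bound[where B=1]) (auto simp: indicator_def intro!: AE_I2)
  have int_hat': "integrable K (\<lambda>\<omega>. c * hat h i (\<zeta>' \<omega>))" for h i c
    by (intro integrable_mult_right K.integrable_const_bound[where B=1])
       (auto simp: hat_bounds intro!: AE_I2)
  have meas: "measure M {\<omega>\<in>space M. x < R \<omega> * \<zeta> \<omega>}
      = (\<integral>\<omega>. indicator {\<omega>\<in>space M. x < R \<omega> * \<zeta> \<omega>} \<omega> \<partial>M)" for x
    by simp
  have int_pow: "integrable K (\<lambda>\<omega>. (max 0 (\<zeta>' \<omega> + c)) powr \<alpha>)" for c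
  proof (rule K.integrable_const_bound[where B="(C + \<bar>c\<bar>) powr \<alpha>"])
    show "AE \<omega> in K. norm ((max 0 (\<zeta>' \<omega> + c)) powr \<alpha>) \<le> (C + \<bar>c\<bar>) powr \<alpha>"
      using \<zeta>' by eventually_elim (use C \<alpha> in \<open>auto intro!: powr_mono2\<close>)
  qed simp
  \<comment> \<open>Where the \<open>i\<close>-th hat is nonzero,
    \<open>\<zeta> < (i + 1) h\<close>, so \<open>x < R \<zeta>\<close> forces \<open>R\<close>
    above \<open>x / ((i + 1) h)\<close>. In the limit, \<open>(i + 1) h\<close> overshoots
    \<open>\<zeta>'\<close> by less than \<open>2 h\<close>.\<close>
  have upper: "\<exists>U l. (\<forall>x>0. measure M {\<omega>\<in>space M. x < R \<omega> * \<zeta> \<omega>} / D x \<le> U x) \<and>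
      (U \<longlongrightarrow> l) at_top \<and> l \<le> (\<integral>\<omega>. (max 0 (\<zeta>' \<omega> + 2 * h)) powr \<alpha> \<partial>K)" if h: "h > 0" for h
  proof -
    obtain m :: nat where m: "C / h \<le> real m" using real_arch_simple by blast
    then have m: "C \<le> real m * h" using h by (simp add: field_simps)
    let ?U = "\<lambda>x. \<Sum>i\<le>m. q ((real i + 1) * h) i h x / D x"
    let ?l = "\<Sum>i\<le>m. \<integral>\<omega>. ((real i + 1) * h) powr \<alpha> * hat h i (\<zeta>' \<omega>) \<partial>K"
    have 1: "measure M {\<omega>\<in>space M. x < R \<omega> * \<zeta> \<omega>} / D x \<le> ?U x" if x: "x > 0" for x
    proof -
      have "measure M {\<omega>\<in>space M. x < R \<omega> * \<zeta> \<omega>} \<le> (\<integral>\<omega>. (\<Sum>i\<le>m. hat h i (\<zeta> \<omega>) *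
          indicator {\<omega>\<in>space M. inverse ((real i + 1) * h) * x < R \<omega>} \<omega>) \<partial>M)"
        unfolding meas
      proof (rule integral_mono)
        fix \<omega> assume \<omega>: "\<omega> \<in> space M"
        have one: "(\<Sum>i\<le>m. hat h i (\<zeta> \<omega>)) = 1"
          using \<zeta>[OF \<omega>] m h by (intro sum_hat) auto
        show "indicator {\<omega>\<in>space M. x < R \<omega> * \<zeta> \<omega>} \<omega> \<le> (\<Sum>i\<le>m. hat h i (\<zeta> \<omega>) *
          indicator {\<omega>\<in>space M. inverse ((real i + 1) * h) * x < R \<omega>} \<omega>)"
        proof (cases "x < R \<omega> * \<zeta> \<omega>")
          case True
          have "inverse ((real i + 1) * h) * x < R \<omega>" if "hat h i (\<zeta> \<omega>) \<noteq> 0" for i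
          proof -
            have R: "R \<omega> > 0" using True x \<zeta>[OF \<omega>]
              by (smt (verit) mult_nonpos_nonneg)
            have "x < R \<omega> * ((real i + 1) * h)"
              using True mult_left_mono[OF less_imp_le[OF hat_support(2)[OF that h]] less_imp_le[OF R]] by linarith
            then show ?thesis using h by (simp add: field_simps add_pos_nonneg)
          qed
          then have "(\<Sum>i\<le>m. hat h i (\<zeta> \<omega>) *
              indicator {\<omega>\<in>space M. inverse ((real i + 1) * h) * x < R \<omega>} \<omega>) = (\<Sum>i\<le>m. hat h i (\<zeta> \<omega>))"
            using \<omega> by (intro sum.cong) (auto simp: indicator_def simp del: inverse_mult_distrib)
          then show ?thesis using one by (simp add: indicator_def)
        qed (auto simp: indicator_def hat_bounds intro!: sum_nonneg)
      qed (rule int_ind, rule Bochner_Integration.integrable_sum[OF int_hat])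
      also have "\<dots> = (\<Sum>i\<le>m. q ((real i + 1) * h) i h x)"
        unfolding q_def by (rule Bochner_Integration.integral_sum) (rule int_hat)
      finally show ?thesis
        using D[of x] by (simp add: sum_divide_distrib[symmetric] divide_right_mono)
    qed
    have 2: "(?U \<longlongrightarrow> ?l) at_top"
      using h by (intro tendsto_sum q_lim) (auto intro!: mult_pos_pos)
    have 3: "?l \<le> (\<integral>\<omega>. (max 0 (\<zeta>' \<omega> + 2 * h)) powr \<alpha> \<partial>K)"
    proof -
      have "?l = (\<integral>\<omega>. (\<Sum>i\<le>m. ((real i + 1) * h) powr \<alpha> * hat h i (\<zeta>' \<omega>)) \<partial>K)"
        by (rule Bochner_Integration.integral_sum[symmetric]) (rule int_hat')
      also have "\<dots> \<le> (\<integral>\<omega>. (max 0 (\<zeta>' \<omega> + 2 * h)) powr \<alpha> \<partial>K)"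
      proof (rule integral_mono_AE)
        show "AE \<omega> in K. (\<Sum>i\<le>m. ((real i + 1) * h) powr \<alpha> * hat h i (\<zeta>' \<omega>)) \<le> (max 0 (\<zeta>' \<omega> + 2 * h)) powr \<alpha>"
          using \<zeta>'
        proof eventually_elim
          case (elim \<omega>)
          have "(\<Sum>i\<le>m. ((real i + 1) * h) powr \<alpha> * hat h i (\<zeta>' \<omega>))
              \<le> (\<Sum>i\<le>m. (max 0 (\<zeta>' \<omega> + 2 * h)) powr \<alpha> * hat h i (\<zeta>' \<omega>))"
          proof (rule sum_mono)
            fix i
            show "((real i + 1) * h) powr \<alpha> * hat h i (\<zeta>' \<omega>) \<le> (max 0 (\<zeta>' \<omega> + 2 * h)) powr \<alpha> * hat h i (\<zeta>' \<omega>)"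
            proof (cases "hat h i (\<zeta>' \<omega>) = 0")
              case False
              from hat_support(1)[OF this h] have "(real i + 1) * h \<le> max 0 (\<zeta>' \<omega> + 2 * h)"
                by (simp add: algebra_simps)
              then show ?thesis
                using \<alpha> h by (intro mult_right_mono powr_mono2) (auto simp: hat_bounds)
            qed simp
          qed
          also have "\<dots> = (max 0 (\<zeta>' \<omega> + 2 * h)) powr \<alpha>"
            using elim m h by (subst sum_distrib_left[symmetric], subst sum_hat) auto
          finally show ?case .
        qed
      qed (rule Bochner_Integration.integrable_sum[OF int_hat'], rule int_pow)
      finally show ?thesis .
    qed
    show ?thesis by (intro exI[of _ ?U] exI[of _ ?l] conjI allI impI 1 2 3)
  qed
  \<comment> \<open>Now the left endpoint \<open>(i - 1) h\<close> is used, which is positive only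
    from \<open>i = 2\<close> on. The hats 0 and 1 live where \<open>\<zeta>' < 2 h\<close>, and
    there \<open>max 0 (\<zeta>' - 2 h)\<close> vanishes, so dropping them costs nothing.\<close>
  have lower: "\<exists>U l. (\<forall>x>0. measure M {\<omega>\<in>space M. x < R \<omega> * \<zeta> \<omega>} / D x \<ge> U x) \<and>
      (U \<longlongrightarrow> l) at_top \<and> l \<ge> (\<integral>\<omega>. (max 0 (\<zeta>' \<omega> + (- 2 * h))) powr \<alpha> \<partial>K)" if h: "h > 0" for h
  proof -
    obtain m :: nat where m: "C / h \<le> real m" using real_arch_simple by blast
    then have m: "C \<le> real m * h" using h by (simp add: field_simps)
    let ?U = "\<lambda>x. \<Sum>i=2..m. q ((real i - 1) * h) i h x / D x"
    let ?l = "\<Sum>i=2..m. \<integral>\<omega>. ((real i - 1) * h) powr \<alpha> * hat h i (\<zeta>' \<omega>) \<partial>K"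
    have 1: "measure M {\<omega>\<in>space M. x < R \<omega> * \<zeta> \<omega>} / D x \<ge> ?U x" if x: "x > 0" for x
    proof -
      have "measure M {\<omega>\<in>space M. x < R \<omega> * \<zeta> \<omega>} \<ge> (\<integral>\<omega>. (\<Sum>i=2..m. hat h i (\<zeta> \<omega>) *
          indicator {\<omega>\<in>space M. inverse ((real i - 1) * h) * x < R \<omega>} \<omega>) \<partial>M)"
        unfolding meas
      proof (rule integral_mono)
        fix \<omega> assume \<omega>: "\<omega> \<in> space M"
        have one: "(\<Sum>i\<le>m. hat h i (\<zeta> \<omega>)) = 1"
          using \<zeta>[OF \<omega>] m h by (intro sum_hat) auto
        have "(\<Sum>i=2..m. hat h i (\<zeta> \<omega>) *
          indicator {\<omega>\<in>space M. inverse ((real i - 1) * h) * x < R \<omega>} \<omega>)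
          \<le> (\<Sum>i=2..m. hat h i (\<zeta> \<omega>) * indicator {\<omega>\<in>space M. x < R \<omega> * \<zeta> \<omega>} \<omega>)"
        proof (rule sum_mono)
          fix i assume i: "i \<in> {2..m}"
          have "x < R \<omega> * \<zeta> \<omega>" if hn: "hat h i (\<zeta> \<omega>) \<noteq> 0" and R: "inverse ((real i - 1) * h) * x < R \<omega>"
          proof -
            have p: "(real i - 1) * h > 0" using i h by auto
            then have "x < R \<omega> * ((real i - 1) * h)" using R by (simp add: field_simps)
            moreover have "R \<omega> > 0" using R p x by (smt (verit) inverse_positive_iff_positive mult_pos_pos)
            ultimately show ?thesis
              using mult_left_mono[OF less_imp_le[OF hat_support(1)[OF hn h]], of "R \<omega>"] by linarith
          qed
          then show "hat h i (\<zeta> \<omega>) * indicator {\<omega>\<in>space M. inverse ((real i - 1) * h) * x < R \<omega>} \<omega>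
            \<le> hat h i (\<zeta> \<omega>) * indicator {\<omega>\<in>space M. x < R \<omega> * \<zeta> \<omega>} \<omega>"
            using hat_bounds(1)[of h i "\<zeta> \<omega>"] by (auto simp: indicator_def)
        qed
        also have "\<dots> \<le> (\<Sum>i\<le>m. hat h i (\<zeta> \<omega>) * indicator {\<omega>\<in>space M. x < R \<omega> * \<zeta> \<omega>} \<omega>)"
          by (intro sum_mono2) (auto simp: hat_bounds)
        also have "\<dots> = indicator {\<omega>\<in>space M. x < R \<omega> * \<zeta> \<omega>} \<omega>"
          by (simp add: sum_distrib_right[symmetric] one)
        finally show "(\<Sum>i=2..m. hat h i (\<zeta> \<omega>) *
          indicator {\<omega>\<in>space M. inverse ((real i - 1) * h) * x < R \<omega>} \<omega>)
          \<le> indicator {\<omega>\<in>space M. x < R \<omega> * \<zeta> \<omega>} \<omega>" .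
      qed (rule Bochner_Integration.integrable_sum[OF int_hat], rule int_ind)
      moreover have "(\<integral>\<omega>. (\<Sum>i=2..m. hat h i (\<zeta> \<omega>) *
          indicator {\<omega>\<in>space M. inverse ((real i - 1) * h) * x < R \<omega>} \<omega>) \<partial>M)
          = (\<Sum>i=2..m. q ((real i - 1) * h) i h x)"
        unfolding q_def by (rule Bochner_Integration.integral_sum) (rule int_hat)
      ultimately show ?thesis
        using D[of x] by (simp add: sum_divide_distrib[symmetric] divide_right_mono)
    qed
    have 2: "(?U \<longlongrightarrow> ?l) at_top"
      using h by (intro tendsto_sum q_lim) (auto intro!: mult_pos_pos)
    have 3: "?l \<ge> (\<integral>\<omega>. (max 0 (\<zeta>' \<omega> + (- 2 * h))) powr \<alpha> \<partial>K)"
    proof -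
      have "(\<integral>\<omega>. (max 0 (\<zeta>' \<omega> + (- 2 * h))) powr \<alpha> \<partial>K) \<le>
         (\<integral>\<omega>. (\<Sum>i=2..m. ((real i - 1) * h) powr \<alpha> * hat h i (\<zeta>' \<omega>)) \<partial>K)"
      proof (rule integral_mono_AE)
        show "AE \<omega> in K. (max 0 (\<zeta>' \<omega> + (- 2 * h))) powr \<alpha> \<le> (\<Sum>i=2..m. ((real i - 1) * h) powr \<alpha> * hat h i (\<zeta>' \<omega>))"
          using \<zeta>'
        proof eventually_elim
          case (elim \<omega>)
          let ?p = "(max 0 (\<zeta>' \<omega> + (- 2 * h))) powr \<alpha>"
          have "?p = (\<Sum>i\<le>m. ?p * hat h i (\<zeta>' \<omega>))"
            using elim m h by (subst sum_distrib_left[symmetric], subst sum_hat) auto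
          also have "\<dots> = (\<Sum>i=2..m. ?p * hat h i (\<zeta>' \<omega>))"
          proof (rule sum.mono_neutral_right)
            show "\<forall>i\<in>{..m} - {2..m}. ?p * hat h i (\<zeta>' \<omega>) = 0"
            proof (intro ballI)
              fix i assume "i \<in> {..m} - {2..m}"
              then have i: "real i + 1 \<le> 2" by auto
              show "?p * hat h i (\<zeta>' \<omega>) = 0"
              proof (cases "hat h i (\<zeta>' \<omega>) = 0")
                case False
                have "\<zeta>' \<omega> < 2 * h"
                  using hat_support(2)[OF False h] mult_right_mono[OF i, of h] h by linarith
                then show ?thesis using \<alpha> by simp
              qed simp
            qed
          qed auto
          also have "\<dots> \<le> (\<Sum>i=2..m. ((real i - 1) * h) powr \<alpha> * hat h i (\<zeta>' \<omega>))"
          proof (rule sum_mono)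
            fix i assume i: "i \<in> {2..m}"
            show "?p * hat h i (\<zeta>' \<omega>) \<le> ((real i - 1) * h) powr \<alpha> * hat h i (\<zeta>' \<omega>)"
            proof (cases "hat h i (\<zeta>' \<omega>) = 0")
              case False
              have "0 \<le> (real i - 1) * h" using i h by simp
              with hat_support(2)[OF False h] have "max 0 (\<zeta>' \<omega> + (- 2 * h)) \<le> (real i - 1) * h"
                by (simp add: algebra_simps)
              then show ?thesis
                using \<alpha> h by (intro mult_right_mono powr_mono2) (auto simp: hat_bounds)
            qed simp
          qed
          finally show ?case .
        qed
      qed (rule int_pow, rule Bochner_Integration.integrable_sum[OF int_hat'])
      also have "\<dots> = ?l"
        by (rule Bochner_Integration.integral_sum) (rule int_hat')
      finally show ?thesis .
    qed
    show ?thesis by (intro exI[of _ ?U] exI[of _ ?l] conjI allI impI 1 2 3)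
  qed
  \<comment> \<open>With \<open>h = 1 / (n + 1)\<close> and \<open>c = 2\<close> or
    \<open>c = - 2\<close> this closes the gap between the two bounds.\<close>
  have conv: "(\<lambda>n. \<integral>\<omega>. (max 0 (\<zeta>' \<omega> + c * (1 / real (Suc n)))) powr \<alpha> \<partial>K)
      \<longlonglongrightarrow> (\<integral>\<omega>. \<zeta>' \<omega> powr \<alpha> \<partial>K)" for c
  proof (rule integral_dominated_convergence[where w="\<lambda>_. (C + \<bar>c\<bar>) powr \<alpha>"])
    show "AE \<omega> in K. (\<lambda>n. (max 0 (\<zeta>' \<omega> + c * (1 / real (Suc n)))) powr \<alpha>) \<longlonglongrightarrow> \<zeta>' \<omega> powr \<alpha>"
      using \<zeta>'
    proof eventually_elim
      case (elim \<omega>)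
      have "(\<lambda>n. max 0 (\<zeta>' \<omega> + c * (1 / real (Suc n)))) \<longlonglongrightarrow> max 0 (\<zeta>' \<omega> + c * 0)"
        by (intro tendsto_intros LIMSEQ_Suc[OF lim_1_over_n])
      then show ?case
        using elim \<alpha> by (intro tendsto_powr') auto
    qed
    show "AE \<omega> in K. norm ((max 0 (\<zeta>' \<omega> + c * (1 / real (Suc n)))) powr \<alpha>) \<le> (C + \<bar>c\<bar>) powr \<alpha>" for n
      using \<zeta>'
    proof eventually_elim
      case (elim \<omega>)
      have "c * (1 / real (Suc n)) \<le> \<bar>c\<bar> * 1"
        by (intro mult_mono) auto
      then show ?case
        using elim C \<alpha> by (auto intro!: powr_mono2)
    qed
  qed auto
  show ?thesis
  proof (rule order_tendstoI)
    fix a assume a: "a < (\<integral>\<omega>. \<zeta>' \<omega> powr \<alpha> \<partial>K)"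
    obtain n where n: "a < (\<integral>\<omega>. (max 0 (\<zeta>' \<omega> + - 2 * (1 / real (Suc n)))) powr \<alpha> \<partial>K)"
      using eventually_happens'[OF sequentially_bot order_tendstoD(1)[OF conv[of "-2"] a]] by blast
    obtain U l where U: "\<forall>x>0. measure M {\<omega>\<in>space M. x < R \<omega> * \<zeta> \<omega>} / D x \<ge> U x" "(U \<longlongrightarrow> l) at_top"
       "l \<ge> (\<integral>\<omega>. (max 0 (\<zeta>' \<omega> + - 2 * (1 / real (Suc n)))) powr \<alpha> \<partial>K)"
      using lower[of "1 / real (Suc n)"] by auto
    have "eventually (\<lambda>x. a < U x) at_top"
      using U n by (intro order_tendstoD(1)[OF U(2)]) simp
    with eventually_gt_at_top[of 0]
    show "eventually (\<lambda>x. a < measure M {\<omega>\<in>space M. x < R \<omega> * \<zeta> \<omega>} / D x) at_top"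
      by eventually_elim (use U(1) in fastforce)
  next
    fix a assume a: "a > (\<integral>\<omega>. \<zeta>' \<omega> powr \<alpha> \<partial>K)"
    obtain n where n: "a > (\<integral>\<omega>. (max 0 (\<zeta>' \<omega> + 2 * (1 / real (Suc n)))) powr \<alpha> \<partial>K)"
      using eventually_happens'[OF sequentially_bot order_tendstoD(2)[OF conv[of "2"] a]] by blast
    obtain U l where U: "\<forall>x>0. measure M {\<omega>\<in>space M. x < R \<omega> * \<zeta> \<omega>} / D x \<le> U x" "(U \<longlongrightarrow> l) at_top"
       "l \<le> (\<integral>\<omega>. (max 0 (\<zeta>' \<omega> + 2 * (1 / real (Suc n)))) powr \<alpha> \<partial>K)"
      using upper[of "1 / real (Suc n)"] by auto
    have "eventually (\<lambda>x. a > U x) at_top"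
      using U n by (intro order_tendstoD(2)[OF U(2)]) simp
    with eventually_gt_at_top[of 0]
    show "eventually (\<lambda>x. a > measure M {\<omega>\<in>space M. x < R \<omega> * \<zeta> \<omega>} / D x) at_top"
      by eventually_elim (use U(1) in fastforce)
  qed
qed

text \<open>For numbers of modulus at most 1, \<open>n\<close>-th powers differ by at most
  \<open>n\<close> times the difference. This reduces the claim to the classical limit of
  \<open>(1 - l / n) ^ n\<close>, whose base lies in \<open>[0, 1]\<close> once
  \<open>n \<ge> l\<close>.\<close>

lemma power_one_minus_limit:
  fixes p :: "nat \<Rightarrow> real"
  assumes p: "\<And>n. 0 \<le> p n \<and> p n \<le> 1" and lim: "(\<lambda>n. real n * p n) \<longlonglongrightarrow> l"
  shows "(\<lambda>n. (1 - p n) ^ n) \<longlonglongrightarrow> exp (- l)"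
proof -
  have l: "l \<ge> 0"
    using p by (intro LIMSEQ_le_const[OF lim]) auto
  obtain n0 :: nat where n0: "l \<le> real n0" using real_arch_simple by blast
  have "(\<lambda>n. (1 - p n) ^ n - (1 + (- l) / real n) ^ n) \<longlonglongrightarrow> 0"
  proof (rule Lim_null_comparison)
    have "(\<lambda>n. \<bar>real n * p n - l\<bar>) \<longlonglongrightarrow> \<bar>l - l\<bar>"
      by (intro tendsto_intros lim)
    then show "(\<lambda>n. \<bar>real n * p n - l\<bar>) \<longlonglongrightarrow> 0" by simp
    show "\<forall>\<^sub>F n in sequentially. norm ((1 - p n) ^ n - (1 + (- l) / real n) ^ n) \<le> \<bar>real n * p n - l\<bar>"
      using eventually_ge_at_top[of "Suc n0"]
    proof eventually_elim
      case (elim n)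
      then have n: "real n > 0" "l \<le> real n" using n0 by linarith+
      have "norm ((1 - p n) ^ n - (1 + (- l) / real n) ^ n) \<le> real n * norm ((1 - p n) - (1 + (- l) / real n))"
        using p[of n] l n by (intro norm_power_diff) (auto simp: abs_le_iff field_simps)
      also have "\<dots> = \<bar>real n * ((1 - p n) - (1 + (- l) / real n))\<bar>"
        by (simp add: abs_mult)
      also have "real n * ((1 - p n) - (1 + (- l) / real n)) = - (real n * p n - l)"
        using n by (simp add: field_simps)
      finally show ?case by simp
    qed
  qed
  from tendsto_add[OF this tendsto_exp_limit_sequentially[of "-l"]] show ?thesis by simp
qed

text \<open>\<open>F\<close> may jump, so \<open>F b = 1 / n\<close> need not be solvable. Instead
  \<open>b n\<close> is the first power of \<open>q = 1 + 1 / n\<close> at which \<open>F\<close>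
  has dropped to \<open>1 / n\<close>; one step earlier, at \<open>b n / q\<close>, \<open>F\<close>
  is still larger. Since \<open>q\<close> tends to 1, regular variation makes the two values
  asymptotically equal.\<close>

lemma normalizing_sequence:
  fixes F :: "real \<Rightarrow> real"
  assumes pos: "\<And>x. F x > 0" and anti: "\<And>x y. x \<le> y \<Longrightarrow> F y \<le> F x"
    and zero: "(F \<longlongrightarrow> 0) at_top"
    and rv: "\<And>u. u > 0 \<Longrightarrow> ((\<lambda>x. F (u * x) / F x) \<longlongrightarrow> u powr (- \<alpha>)) at_top"
  shows "\<exists>b. (\<forall>n. b n > 0) \<and> filterlim b at_top sequentially \<and> (\<lambda>n. real n * F (b n)) \<longlonglongrightarrow> 1"
proof -
  \<comment> \<open>The search starts at \<open>q ^ 0 = 1\<close> and therefore needs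
    \<open>F 1 > 1 / n\<close>. The finitely many other \<open>n\<close> receive the value
    1.\<close>
  have ex: "\<exists>b. b > 0 \<and> (n \<ge> 1 \<longrightarrow> F 1 > 1 / real n \<longrightarrow> F b \<le> 1 / real n \<and> F (b / (1 + 1 / real n)) > 1 / real n)" for n :: nat
  proof (cases "n \<ge> 1 \<and> F 1 > 1 / real n")
    case True
    define q where "q = 1 + 1 / real n"
    have q: "q > 1" using True by (simp add: q_def)
    have "filterlim (\<lambda>k. q ^ k) at_top sequentially"
      using q by (intro filterlim_at_infinity_imp_filterlim_at_top filterlim_realpow_sequentially_gt1) auto
    from filterlim_compose[OF zero this] have "(\<lambda>k. F (q ^ k)) \<longlonglongrightarrow> 0" .
    then have "eventually (\<lambda>k. F (q ^ k) < 1 / real n) sequentially"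
      using True by (intro order_tendstoD) auto
    then obtain k0 where "F (q ^ k0) < 1 / real n" by (auto dest!: eventually_happens)
    then have k0: "F (q ^ k0) \<le> 1 / real n" by simp
    define k where "k = (LEAST k. F (q ^ k) \<le> 1 / real n)"
    have k: "F (q ^ k) \<le> 1 / real n" unfolding k_def by (rule LeastI[of _ k0]) (rule k0)
    have "k \<noteq> 0" using k True by (metis linorder_not_le power_0)
    then obtain j where j: "k = Suc j" by (cases k) auto
    have "\<not> F (q ^ j) \<le> 1 / real n" using not_less_Least[of j "\<lambda>k. F (q ^ k) \<le> 1 / real n"] j
      unfolding k_def by simp
    moreover have "q ^ k / q = q ^ j" using j q by simp
    ultimately show ?thesis using k q unfolding q_def[symmetric]
      by (intro exI[of _ "q ^ k"]) (auto)
  next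
    case False then show ?thesis by (intro exI[of _ 1]) auto
  qed
  then obtain b where b: "\<And>n. b n > 0"
    "\<And>n::nat. n \<ge> 1 \<Longrightarrow> F 1 > 1 / real n \<Longrightarrow> F (b n) \<le> 1 / real n \<and> F (b n / (1 + 1 / real n)) > 1 / real n"
    by metis
  have small: "eventually (\<lambda>n. 1 / real n < c) sequentially" if "c > 0" for c
    using order_tendstoD(2)[OF lim_1_over_n that] .
  have ev: "eventually (\<lambda>n. n \<ge> 1 \<and> F (b n) \<le> 1 / real n \<and> F (b n / (1 + 1 / real n)) > 1 / real n) sequentially"
    using small[OF pos[of 1]] eventually_ge_at_top[of 1] by eventually_elim (use b(2) in auto)
  have binf: "filterlim b at_top sequentially"
    unfolding filterlim_at_top_gt[where c=0]
  proof (intro allI impI)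
    fix K :: real
    show "eventually (\<lambda>n. K \<le> b n) sequentially"
      using small[OF pos[of K]] ev
    proof eventually_elim
      case (elim n)
      then have "F (b n) < F K" by linarith
      then show ?case using anti[of "b n" K] by linarith
    qed
  qed
  have "(\<lambda>n. real n * F (b n)) \<longlonglongrightarrow> 1"
  proof (rule order_tendstoI)
    fix a :: real assume "1 < a"
    show "eventually (\<lambda>n. real n * F (b n) < a) sequentially"
      using ev
    proof eventually_elim
      case (elim n)
      then have "real n * F (b n) \<le> real n * (1 / real n)"
        by (intro mult_left_mono) auto
      with elim have "real n * F (b n) \<le> 1" by simp
      then show ?case using \<open>1 < a\<close> by linarith
    qed
  next
    fix a :: real assume a: "a < 1"
    \<comment> \<open>Take \<open>u > 1\<close> with \<open>u powr (- \<alpha>) > a\<close>. Once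
      \<open>1 + 1 / n \<le> u\<close>, monotonicity gives \<open>F (b n / u) > 1 / n\<close>, so
      \<open>n * F (b n)\<close> is at least \<open>F (b n) / F (b n / u)\<close>, which tends to
      \<open>u powr (- \<alpha>)\<close>.\<close>
    have "((\<lambda>u::real. u powr (- \<alpha>)) \<longlongrightarrow> 1 powr (-\<alpha>)) (at_right 1)"
      by (intro tendsto_intros) auto
    then have "eventually (\<lambda>u::real. a < u powr (-\<alpha>)) (at_right 1)"
      using a by (intro order_tendstoD) auto
    then have "eventually (\<lambda>u::real. a < u powr (-\<alpha>) \<and> u > 1) (at_right 1)"
      using eventually_at_right_less[of "1::real"] by eventually_elim auto
    then obtain u :: real where u: "a < u powr (-\<alpha>)" "u > 1"
      using trivial_limit_at_right_real[of "1::real"] by (auto dest!: eventually_happens)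
    have "filterlim (\<lambda>n. inverse u * b n) at_top sequentially"
      using u by (intro filterlim_tendsto_pos_mult_at_top[OF tendsto_const _ binf]) auto
    from filterlim_compose[OF rv[of u] this] u
    have "(\<lambda>n. F (b n) / F (inverse u * b n)) \<longlonglongrightarrow> u powr (- \<alpha>)"
      by (simp add: mult.assoc[symmetric])
    note 1 = order_tendstoD(1)[OF this u(1)]
    have "0 < u - 1" using u by simp
    note 2 = small[OF this]
    from ev 1 2 show "eventually (\<lambda>n. a < real n * F (b n)) sequentially"
    proof eventually_elim
      case (elim n)
      have n: "real n \<ge> 1" using elim by auto
      have "1 + 1 / real n \<le> u" using elim u by simp
      then have "b n / u \<le> b n / (1 + 1 / real n)"
        using u b(1)[of n] n by (intro divide_left_mono) (auto simp: add_pos_pos)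
      from anti[OF this] elim have "1 / real n < F (b n / u)"
        by linarith
      then have "1 / real n < F (inverse u * b n)"
        by (simp add: divide_inverse mult.commute)
      then have "F (b n) / F (inverse u * b n) \<le> F (b n) / (1 / real n)"
        using pos[of "b n"] pos[of "inverse u * b n"] n by (intro divide_left_mono) auto
      then show ?case using elim by (simp add: mult.commute)
    qed
  qed
  with b(1) binf show ?thesis by blast
qed

section \<open>Weak convergence from orthant probabilities\<close>

lemma tendsto_fun_iff:
  fixes f :: "'i \<Rightarrow> 'a \<Rightarrow> 'b::topological_space"
  shows "(f \<longlongrightarrow> l) F \<longleftrightarrow> (\<forall>k. ((\<lambda>n. f n k) \<longlongrightarrow> l k) F)"
  unfolding limitin_canonical_iff[symmetric] euclidean_product_topology[symmetric]
  by (simp add: limitin_componentwise)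

text \<open>Functionals are defined on full sequences throughout; this inclusion carries them over
  to \<open>vecs J\<close>, where every coordinate outside \<open>J\<close> is the constant
  \<open>undefined\<close>.\<close>

lemma measurable_vecs_embedding:
  "(\<lambda>x. x) \<in> measurable (vecs J) (borel :: (int \<Rightarrow> 'v::second_countable_topology) measure)"
proof -
  have "(\<lambda>x. x) \<in> measurable (vecs J) (vecs UNIV :: (int \<Rightarrow> 'v) measure)"
  proof (rule measurable_PiM_single')
    fix k
    show "(\<lambda>x. x k) \<in> measurable (vecs J) (borel :: 'v measure)"
    proof (cases "k \<in> J")
      case False
      have "(\<lambda>x. x k) \<in> measurable (vecs J) (borel :: 'v measure) \<longleftrightarrow>
          (\<lambda>_. undefined) \<in> measurable (vecs J :: (int \<Rightarrow> 'v) measure) (borel :: 'v measure)"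
        by (intro measurable_cong) (use False in \<open>simp add: space_PiM PiE_def extensional_def\<close>)
      then show ?thesis by simp
    qed simp
  qed simp
  then show ?thesis
    by (subst measurable_cong_sets[OF refl sets_PiM_equal_borel[symmetric]])
qed

lemma continuous_map_vecs_top_embedding:
  assumes "continuous_on UNIV (f :: (int \<Rightarrow> 'v::topological_space) \<Rightarrow> 'b::topological_space)"
  shows "continuous_map (vecs_top J) euclidean f"
proof -
  have "continuous_map (vecs_top J) (vecs_top UNIV :: (int \<Rightarrow> 'v) topology) (\<lambda>x. x)"
    unfolding continuous_map_componentwise_UNIV
  proof
    fix k
    show "continuous_map (vecs_top J) (euclidean :: 'v topology) (\<lambda>x. x k)"
    proof (cases "k \<in> J")
      case False
      have "continuous_map (vecs_top J) (euclidean :: 'v topology) (\<lambda>_. undefined)"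
        by (simp only: continuous_map_const) simp
      then show ?thesis
        by (rule continuous_map_eq) (simp add: PiE_arb[OF _ False])
    qed (auto intro: continuous_map_product_projection)
  qed
  moreover have "continuous_map (vecs_top UNIV) euclidean f"
    using assms by (simp add: euclidean_product_topology)
  ultimately show ?thesis
    using continuous_map_compose[of "vecs_top J" "vecs_top UNIV" "\<lambda>x. x" euclidean f] by (simp add: o_def)
qed

lemma continuous_on_vecs_top_restrict:
  assumes "continuous_map (vecs_top J) euclidean (f :: (int \<Rightarrow> 'v::topological_space) \<Rightarrow> 'b::topological_space)"
  shows "continuous_on UNIV (\<lambda>x. f (restrict x J))"
proof -
  have "continuous_map (vecs_top UNIV) (vecs_top J) (\<lambda>x :: int \<Rightarrow> 'v. restrict x J)"
    unfolding continuous_map_componentwise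
    by (auto intro!: continuous_map_product_projection)
  from continuous_map_compose[OF this assms] show ?thesis
    by (simp add: o_def euclidean_product_topology)
qed

lemma borel_measurable_vecs_top:
  assumes "continuous_map (vecs_top J) euclidean (f :: (int \<Rightarrow> 'v::second_countable_topology) \<Rightarrow> real)"
  shows "f \<in> borel_measurable (vecs J)"
proof -
  have "(\<lambda>x. f (restrict x J)) \<in> borel_measurable borel"
    by (intro borel_measurable_continuous_onI continuous_on_vecs_top_restrict assms)
  from measurable_compose[OF measurable_vecs_embedding this, of J]
  have "(\<lambda>x. f (restrict x J)) \<in> borel_measurable (vecs J)" .
  then show ?thesis
    by (rule measurable_cong[THEN iffD1, rotated]) (auto simp: space_PiM PiE_def extensional_restrict)
qed

text \<open>Compactness: extended by the single point \<open>undefined\<close> outside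
  \<open>J\<close>, the balls of radius \<open>K\<close> form a compact product. Two sequences of
  counterexamples with distances tending to 0 would share a limit along a subsequence, contradicting
  continuity there.\<close>

lemma uniformly_continuous_vecs_top:
  fixes f :: "(int \<Rightarrow> 'v::euclidean_space) \<Rightarrow> real"
  assumes f: "continuous_map (vecs_top J) euclidean f" and \<epsilon>: "\<epsilon> > 0"
  shows "\<exists>\<delta>>0. \<forall>x\<in>extensional J. \<forall>y\<in>extensional J.
    (\<forall>k\<in>J. norm (x k) \<le> K \<and> norm (y k) \<le> K \<and> norm (x k - y k) \<le> \<delta>) \<longrightarrow> \<bar>f x - f y\<bar> \<le> \<epsilon>"
proof (rule ccontr)
  assume "\<not> ?thesis"
  then have "\<forall>n::nat. \<exists>x y. x \<in> extensional J \<and> y \<in> extensional J \<and>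
    (\<forall>k\<in>J. norm (x k) \<le> K \<and> norm (y k) \<le> K \<and> norm (x k - y k) \<le> 1 / real (Suc n)) \<and> \<bar>f x - f y\<bar> > \<epsilon>"
    by (smt (verit) zero_less_divide_1_iff of_nat_0_less_iff zero_less_Suc)
  then obtain x y where xy: "\<And>n::nat. x n \<in> extensional J" "\<And>n. y n \<in> extensional J"
    "\<And>n k. k \<in> J \<Longrightarrow> norm (x n k) \<le> K \<and> norm (y n k) \<le> K \<and> norm (x n k - y n k) \<le> 1 / real (Suc n)"
    "\<And>n. \<bar>f (x n) - f (y n)\<bar> > \<epsilon>"
    by metis
  define B where "B = PiE UNIV (\<lambda>k. if k \<in> J then cball (0::'v) K else {undefined})"
  have "compactin (vecs_top UNIV) B"
    unfolding B_def compactin_PiE by auto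
  then have "compact B"
    by (simp add: euclidean_product_topology)
  then have "seq_compact B" by (simp add: compact_eq_seq_compact_metric)
  moreover have "\<And>n. x n \<in> B"
    using xy(1,3) by (auto simp: B_def extensional_def)
  ultimately obtain l r where r: "strict_mono (r :: nat \<Rightarrow> nat)" and l: "(x \<circ> r) \<longlonglongrightarrow> l"
    unfolding seq_compact_def by metis
  have l': "\<And>k. (\<lambda>n. x (r n) k) \<longlonglongrightarrow> l k"
    using l by (simp add: tendsto_fun_iff o_def)
  have "(y \<circ> r) \<longlonglongrightarrow> l"
    unfolding tendsto_fun_iff o_def
  proof
    fix k
    show "(\<lambda>n. y (r n) k) \<longlonglongrightarrow> l k"
    proof (cases "k \<in> J")
      case True
      have "(\<lambda>n. x n k - y n k) \<longlonglongrightarrow> 0"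
        using xy(3)[OF True] by (intro Lim_null_comparison[OF _ LIMSEQ_Suc[OF lim_1_over_n]]) auto
      then have "(\<lambda>n. x (r n) k - y (r n) k) \<longlonglongrightarrow> 0"
        using LIMSEQ_subseq_LIMSEQ[OF _ r] by (fastforce simp: o_def)
      from tendsto_diff[OF l'[of k] this] show ?thesis by simp
    next
      case False
      then have "(\<lambda>n. y (r n) k) = (\<lambda>n. x (r n) k)"
        using xy(1,2) by (auto simp: extensional_def)
      then show ?thesis using l' by simp
    qed
  qed
  moreover have cont: "isCont (\<lambda>x. f (restrict x J)) l"
    using continuous_on_vecs_top_restrict[OF f] by (simp add: continuous_on_eq_continuous_at)
  ultimately have "(\<lambda>n. f (restrict ((x \<circ> r) n) J) - f (restrict ((y \<circ> r) n) J)) \<longlonglongrightarrow>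
      f (restrict l J) - f (restrict l J)"
    using l by (intro tendsto_diff isCont_tendsto_compose[OF cont])
  then have "(\<lambda>n. f (x (r n)) - f (y (r n))) \<longlonglongrightarrow> 0"
    using xy(1,2) by (simp add: extensional_restrict)
  then have "(\<lambda>n. \<bar>f (x (r n)) - f (y (r n))\<bar>) \<longlonglongrightarrow> 0"
    by (simp add: tendsto_rabs_zero)
  from order_tendstoD(2)[OF this \<epsilon>] obtain n where "\<bar>f (x (r n)) - f (y (r n))\<bar> < \<epsilon>"
    by (auto dest!: eventually_happens)
  with xy(4)[of "r n"] show False by simp
qed

text \<open>Inclusion-exclusion, one complement at a time: excluding one more event
  \<open>E g\<close> subtracts the probability of the same set with \<open>g\<close> moved to the
  required events.\<close>

lemma atom_probabilities_tendsto:
  fixes \<mu> :: "nat \<Rightarrow> 'a measure"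
  assumes fin: "\<And>n. finite_measure (\<mu> n)" "finite_measure \<nu>"
    and sets: "\<And>n. sets (\<mu> n) = sets S" "sets \<nu> = sets S"
    and E: "\<And>i. i \<in> I \<Longrightarrow> {x\<in>space S. x \<in> E i} \<in> sets S" and "finite I"
    and lim: "\<And>A. A \<subseteq> I \<Longrightarrow> (\<lambda>n. measure (\<mu> n) {x\<in>space S. \<forall>i\<in>A. x \<in> E i})
      \<longlonglongrightarrow> measure \<nu> {x\<in>space S. \<forall>i\<in>A. x \<in> E i}"
    and "A \<subseteq> I" "G \<subseteq> I"
  shows "(\<lambda>n. measure (\<mu> n) {x\<in>space S. (\<forall>i\<in>A. x \<in> E i) \<and> (\<forall>i\<in>G. x \<notin> E i)})
      \<longlonglongrightarrow> measure \<nu> {x\<in>space S. (\<forall>i\<in>A. x \<in> E i) \<and> (\<forall>i\<in>G. x \<notin> E i)}"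
proof -
  have "finite G" using \<open>G \<subseteq> I\<close> \<open>finite I\<close> by (rule finite_subset)
  then show ?thesis using \<open>A \<subseteq> I\<close> \<open>G \<subseteq> I\<close>
  proof (induction G arbitrary: A)
    case empty
    then show ?case using lim by simp
  next
    case (insert g G)
    let ?S = "\<lambda>A G. {x\<in>space S. (\<forall>i\<in>A. x \<in> E i) \<and> (\<forall>i\<in>G. x \<notin> E i)}"
    have meas: "?S A G \<in> sets S" if "A \<subseteq> I" "G \<subseteq> I" for A G
    proof -
      have "finite A" "finite G" using that \<open>finite I\<close> by (auto intro: finite_subset)
      then show ?thesis
        using that E by (intro sets.sets_Collect_conj sets.sets_Collect_finite_All sets.sets_Collect_neg) auto
    qed
    have eq: "measure m (?S A (insert g G)) = measure m (?S A G) - measure m (?S (insert g A) G)"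
      if "finite_measure m" "sets m = sets S" for m
    proof -
      interpret finite_measure m by fact
      have "?S A (insert g G) = ?S A G - ?S (insert g A) G" by auto
      then show ?thesis
        using meas[of A G] meas[of "insert g A" G] insert.prems
        by (subst finite_measure_Diff[symmetric]) (auto simp: that(2))
    qed
    show ?case
      unfolding eq[OF fin(1) sets(1)] eq[OF fin(2) sets(2)]
      using insert by (intro tendsto_diff insert.IH) auto
  qed
qed

text \<open>Joint laws of the components through finitely many positive thresholds determine the
  limit: up to a small error, a continuous function factors through the comparison of every
  component with a fine grid of positive levels.\<close>
lemma weakly_converges_orthants:
  fixes \<mu> :: "nat \<Rightarrow> (int \<Rightarrow> real^'d) measure"
  assumes J: "finite J"
    and prob: "\<And>n. prob_space (\<mu> n)" "prob_space \<nu>"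
    and sets: "\<And>n. sets (\<mu> n) = sets (vecs J)" "sets \<nu> = sets (vecs J)"
    and orth: "\<And>F. finite F \<Longrightarrow> F \<subseteq> J \<times> UNIV \<times> {0<..} \<Longrightarrow>
      (\<lambda>n. measure (\<mu> n) {x\<in>space (vecs J). \<forall>(k, j, c)\<in>F. x k $ j \<le> c})
      \<longlonglongrightarrow> measure \<nu> {x\<in>space (vecs J). \<forall>(k, j, c)\<in>F. x k $ j \<le> c}"
    and neg: "\<And>k j \<delta>. k \<in> J \<Longrightarrow> \<delta> > 0 \<Longrightarrow>
      (\<lambda>n. measure (\<mu> n) {x\<in>space (vecs J). x k $ j < - \<delta>}) \<longlonglongrightarrow> 0"
    and nonneg: "AE x in \<nu>. \<forall>k\<in>J. \<forall>j. 0 \<le> x k $ j"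
  shows "weakly_converges (vecs_top J) \<mu> \<nu> sequentially"
  unfolding weakly_converges_def
proof (intro allI impI, elim conjE)
  fix f :: "(int \<Rightarrow> real^'d) \<Rightarrow> real"
  assume f: "continuous_map (vecs_top J) euclidean f" and "bounded (f ` topspace (vecs_top J))"
  then obtain B where B: "B > 0" "\<And>x. x \<in> space (vecs J) \<Longrightarrow> \<bar>f x\<bar> \<le> B"
    unfolding bounded_pos by (auto simp: space_PiM)
  have f_meas [measurable]: "f \<in> borel_measurable (vecs J)"
    by (rule borel_measurable_vecs_top[OF f])
  have [measurable]: "(\<lambda>x. x k $ j) \<in> borel_measurable (vecs J)" if "k \<in> J" for k and j :: 'd
    by (rule measurable_compose[OF measurable_component_singleton[OF that]])
       (intro borel_measurable_continuous_onI continuous_intros)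
  let ?S = "space (vecs J :: (int \<Rightarrow> real^'d) measure)"
  have sp: "space (\<mu> n) = ?S" "space \<nu> = ?S" for n
    using sets sets_eq_imp_space_eq by blast+
  have f_int: "integrable m f" if "prob_space m" "sets m = sets (vecs J)" for m
  proof -
    interpret prob_space m by fact
    show ?thesis using sets_eq_imp_space_eq[OF that(2)] B(2)
      by (intro integrable_const_bound[where B=B] AE_I2)
         (auto simp: measurable_cong_sets[OF that(2) refl])
  qed
  \<comment> \<open>Replacing \<open>f\<close> by a step function \<open>s\<close> costs at most
    \<open>\<epsilon> + 2 B \<epsilon>\<close> under each of the two laws, and the integrals of
    \<open>s\<close> differ by at most \<open>\<epsilon>\<close>; the constant leaves room for the
    sum.\<close>
  have main: "eventually (\<lambda>n. \<bar>(\<integral>x. f x \<partial>\<mu> n) - (\<integral>x. f x \<partial>\<nu>)\<bar> \<le> (3 + 6 * B) * \<epsilon>) sequentially"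
    if \<epsilon>: "\<epsilon> > 0" for \<epsilon>
  proof -
    \<comment> \<open>\<open>L K\<close> bounds components from above only, so it is itself an
      orthant as in \<open>orth\<close>. The missing lower bounds come from \<open>neg\<close> and
      \<open>nonneg\<close>.\<close>
    define L where "L K = {x\<in>?S. \<forall>(k, j, c)\<in>J \<times> (UNIV :: 'd set) \<times> {K}. x k $ j \<le> c}" for K :: real
    have L_sets: "L K \<in> sets (vecs J)" for K
      unfolding L_def using J by (intro sets.sets_Collect_finite_All) auto
    obtain K where K: "K > 0" "measure \<nu> (L K) > 1 - \<epsilon>"
    proof -
      interpret prob_space \<nu> by fact
      have inc: "incseq (\<lambda>n. L (real (Suc n)))"
      proof (rule incseq_SucI, rule subsetI)
        fix n x assume x: "x \<in> L (real (Suc n))"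
        have "x k $ j \<le> real (Suc (Suc n))" if "k \<in> J" for k j
        proof -
          have "x k $ j \<le> real (Suc n)" using x that by (auto simp: L_def)
          then show ?thesis by simp
        qed
        then show "x \<in> L (real (Suc (Suc n)))" using x by (auto simp: L_def)
      qed
      have U: "(\<Union>n. L (real (Suc n))) = ?S"
      proof (intro equalityI subsetI)
        fix x assume x: "x \<in> ?S"
        obtain n :: nat where n: "(\<Sum>k\<in>J. \<Sum>j\<in>UNIV. \<bar>x k $ j\<bar>) \<le> real n" using real_arch_simple by blast
        have "x k $ j \<le> real (Suc n)" if "k \<in> J" for k j
        proof -
          have "\<bar>x k $ j\<bar> \<le> (\<Sum>j\<in>UNIV. \<bar>x k $ j\<bar>)"
            by (rule member_le_sum) auto
          also have "\<dots> \<le> (\<Sum>k\<in>J. \<Sum>j\<in>UNIV. \<bar>x k $ j\<bar>)"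
            using that J by (intro member_le_sum) (auto intro: sum_nonneg)
          finally show ?thesis using n by simp
        qed
        then have "x \<in> L (real (Suc n))" using x by (auto simp: L_def)
        then show "x \<in> (\<Union>n. L (real (Suc n)))" by blast
      qed (auto simp: L_def)
      have "(\<lambda>n. measure \<nu> (L (real (Suc n)))) \<longlonglongrightarrow> measure \<nu> (\<Union>n. L (real (Suc n)))"
        using L_sets sets by (intro finite_Lim_measure_incseq inc) auto
      then have "(\<lambda>n. measure \<nu> (L (real (Suc n)))) \<longlonglongrightarrow> 1"
        unfolding U using prob_space sp by simp
      from eventually_happens'[OF sequentially_bot order_tendstoD(1)[OF this, of "1 - \<epsilon>"]] \<epsilon>
      obtain n where "measure \<nu> (L (real (Suc n))) > 1 - \<epsilon>" by auto
      with that[of "real (Suc n)"] show thesis by simp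
    qed
    obtain \<delta>0 where \<delta>0: "\<delta>0 > 0" "\<And>x y. x \<in> extensional J \<Longrightarrow> y \<in> extensional J \<Longrightarrow>
      (\<And>k. k \<in> J \<Longrightarrow> norm (x k) \<le> real CARD('d) * (K + K) \<and> norm (y k) \<le> real CARD('d) * (K + K) \<and> norm (x k - y k) \<le> \<delta>0)
       \<Longrightarrow> \<bar>f x - f y\<bar> \<le> \<epsilon>"
      using uniformly_continuous_vecs_top[OF f \<epsilon>, of "real CARD('d) * (K + K)"] by blast
    \<comment> \<open>The mesh \<open>K / m\<close> becomes so small that two points of one cell are
      within \<open>\<delta>0\<close>: coordinates differ by at most two meshes, and the norm is at
      most the sum over the \<open>CARD('d)\<close> coordinates. The summand 1 keeps
      \<open>m\<close> positive.\<close>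
    obtain m :: nat where m: "real CARD('d) * 2 * K / \<delta>0 + 1 \<le> real m" using real_arch_simple by blast
    define \<delta> where "\<delta> = K / real m"
    have "0 \<le> real CARD('d) * 2 * K / \<delta>0" using K \<delta>0 by simp
    then have m1: "real m \<ge> 1" using m by linarith
    then have \<delta>: "\<delta> > 0" "real m * \<delta> = K" "\<delta> \<le> K"
      using K by (auto simp: \<delta>_def field_simps)
    have \<delta>_le: "real CARD('d) * (2 * \<delta>) \<le> \<delta>0"
    proof -
      have "real CARD('d) * 2 * K / \<delta>0 \<le> real m" using m by linarith
      then have "real CARD('d) * 2 * K \<le> real m * \<delta>0" using \<delta>0 by (simp add: divide_le_eq)
      then show ?thesis using m1 by (simp add: \<delta>_def field_simps)
    qed
    define \<Omega>0 where "\<Omega>0 = {x\<in>?S. \<forall>k\<in>J. \<forall>j. - \<delta> \<le> x k $ j \<and> x k $ j \<le> K}"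
    have \<Omega>0_sets: "\<Omega>0 \<in> sets (vecs J)"
      unfolding \<Omega>0_def using J by measurable
    \<comment> \<open>The levels start at \<open>\<delta>\<close> rather than 0 because
      \<open>orth\<close> only covers positive thresholds. All values in
      \<open>[- \<delta>, \<delta>]\<close> thus share a class, which is why the resolution is
      \<open>2 \<delta>\<close> and not \<open>\<delta>\<close>.\<close>
    define I where "I = J \<times> (UNIV :: 'd set) \<times> (\<lambda>i. real i * \<delta>) ` {1..m}"
    have I: "finite I" "I \<subseteq> J \<times> UNIV \<times> {0<..}"
      using J \<delta> by (auto simp: I_def)
    define E where "E = (\<lambda>(k, j, c). {x :: int \<Rightarrow> real^'d. x k $ j \<le> c})"
    have E_sets: "{x\<in>?S. x \<in> E e} \<in> sets (vecs J)" if "e \<in> I" for e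
      using that by (auto simp: I_def E_def)
    define cell where "cell A = {x\<in>?S. (\<forall>e\<in>A. x \<in> E e) \<and> (\<forall>e\<in>I - A. x \<notin> E e)}" for A
    have cell_sets: "cell A \<in> sets (vecs J)" if "A \<subseteq> I" for A
    proof -
      have "finite A" "finite (I - A)" using that I(1) by (auto intro: finite_subset)
      then show ?thesis unfolding cell_def
        using that E_sets by (intro sets.sets_Collect_conj sets.sets_Collect_finite_All sets.sets_Collect_neg) auto
    qed
    define v where "v A = (if \<exists>r. r \<in> \<Omega>0 \<inter> cell A then f (SOME r. r \<in> \<Omega>0 \<inter> cell A) else 0)" for A
    define s where "s x = (\<Sum>A\<in>Pow I. v A * indicator (cell A) x)" for x
    have v_le: "\<bar>v A\<bar> \<le> B" for A
    proof (cases "\<exists>r. r \<in> \<Omega>0 \<inter> cell A")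
      case True
      then have "(SOME r. r \<in> \<Omega>0 \<inter> cell A) \<in> \<Omega>0" by (metis (mono_tags, lifting) IntD1 someI_ex)
      then show ?thesis using B(2) True by (simp add: v_def \<Omega>0_def)
    next
      case False
      then have "v A = 0" unfolding v_def by (rule if_not_P)
      then show ?thesis using B by simp
    qed
    have s_eq: "s x = v {e\<in>I. x \<in> E e}" if "x \<in> ?S" for x
    proof -
      have "s x = (\<Sum>A\<in>Pow I. if A = {e\<in>I. x \<in> E e} then v A else 0)"
        unfolding s_def using that by (intro sum.cong) (auto simp: cell_def indicator_def)
      then show ?thesis using I by simp
    qed
    have close: "\<bar>f x - s x\<bar> \<le> \<epsilon>" if x: "x \<in> \<Omega>0" for x
    proof -
      define A where "A = {e\<in>I. x \<in> E e}"
      have "x \<in> \<Omega>0 \<inter> cell A" using x by (auto simp: A_def cell_def \<Omega>0_def)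
      define r where "r = (SOME r. r \<in> \<Omega>0 \<inter> cell A)"
      have r: "r \<in> \<Omega>0 \<inter> cell A" unfolding r_def
        using \<open>x \<in> \<Omega>0 \<inter> cell A\<close> by (rule someI[of "\<lambda>r. r \<in> \<Omega>0 \<inter> cell A"])
      have "s x = f r" using s_eq[of x] x r by (auto simp: \<Omega>0_def A_def[symmetric] v_def r_def)
      have le: "x k $ j \<le> y k $ j + 2 * \<delta>" if x: "x \<in> \<Omega>0 \<inter> cell A" and y: "y \<in> \<Omega>0 \<inter> cell A" and k: "k \<in> J"
        for x y k j
      proof -
        \<comment> \<open>The least grid index whose level is not below \<open>y k $ j\<close>. The
          maximum with 1 handles \<open>y k $ j \<le> 0\<close>, where
          \<open>- \<delta> \<le> y k $ j\<close> still gives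
          \<open>i \<le> y k $ j / \<delta> + 2\<close>.\<close>
        define i where "i = max 1 (nat \<lceil>y k $ j / \<delta>\<rceil>)"
        have yb: "- \<delta> \<le> y k $ j" "y k $ j \<le> real m * \<delta>" using y k \<delta> by (auto simp: \<Omega>0_def)
        then have "y k $ j / \<delta> \<le> real m" using \<delta> by (simp add: divide_le_eq)
        then have "\<lceil>y k $ j / \<delta>\<rceil> \<le> int m" by (simp add: ceiling_le_iff)
        then have "i \<le> m" using m1 by (auto simp: i_def nat_le_iff)
        have "y k $ j / \<delta> \<le> real i" unfolding i_def by linarith
        then have "y k $ j \<le> real i * \<delta>" using \<delta> by (simp add: divide_le_eq)
        moreover have e: "(k, j, real i * \<delta>) \<in> I" using k \<open>i \<le> m\<close> by (auto simp: I_def i_def)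
        ultimately have "(k, j, real i * \<delta>) \<in> A" using y by (auto simp: cell_def E_def)
        then have "x k $ j \<le> real i * \<delta>" using x by (auto simp: cell_def E_def)
        also have "real i \<le> y k $ j / \<delta> + 2"
        proof -
          have "- 1 \<le> y k $ j / \<delta>" using yb \<delta> by (simp add: le_divide_eq)
          then show ?thesis unfolding i_def by linarith
        qed
        then have "real i * \<delta> \<le> (y k $ j / \<delta> + 2) * \<delta>" using \<delta> by (intro mult_right_mono) auto
        also have "\<dots> = y k $ j + 2 * \<delta>" using \<delta> by (simp add: field_simps)
        finally show ?thesis .
      qed
      have nrm: "norm w \<le> real CARD('d) * c" if "\<And>j. \<bar>w $ j\<bar> \<le> c" for w :: "real^'d" and c
        by (rule order_trans[OF norm_le_l1_cart]) (use that sum_bounded_above[of UNIV "\<lambda>j. \<bar>w $ j\<bar>" c] in auto)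
      have "\<bar>f x - f r\<bar> \<le> \<epsilon>"
      proof (rule \<delta>0(2))
        show "x \<in> extensional J" "r \<in> extensional J"
          using x r by (auto simp: \<Omega>0_def space_PiM PiE_def)
        fix k assume k: "k \<in> J"
        have "norm (y k) \<le> real CARD('d) * (K + K)" if "y \<in> \<Omega>0" for y
        proof (rule nrm)
          fix j
          have "- \<delta> \<le> y k $ j \<and> y k $ j \<le> K" using that k by (auto simp: \<Omega>0_def)
          then show "\<bar>y k $ j\<bar> \<le> K + K" using \<delta> K by linarith
        qed
        moreover have "norm (x k - r k) \<le> real CARD('d) * (2 * \<delta>)"
        proof (rule nrm)
          fix j
          show "\<bar>(x k - r k) $ j\<bar> \<le> 2 * \<delta>"
            using le[of x r k j] le[of r x k j] r \<open>x \<in> \<Omega>0 \<inter> cell A\<close> k by (simp add: abs_le_iff)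
        qed
        ultimately show "norm (x k) \<le> real CARD('d) * (K + K) \<and> norm (r k) \<le> real CARD('d) * (K + K) \<and> norm (x k - r k) \<le> \<delta>0"
          using x r \<delta>_le by force
      qed
      then show ?thesis using \<open>s x = f r\<close> by simp
    qed
    have s_int: "integrable m s" and s_lint: "(\<integral>x. s x \<partial>m) = (\<Sum>A\<in>Pow I. v A * measure m (cell A))"
      if "prob_space m" "sets m = sets (vecs J)" for m
    proof -
      interpret prob_space m by fact
      have i: "integrable m (\<lambda>x. v A * indicator (cell A) x)" if "A \<in> Pow I" for A
        using that cell_sets[of A] \<open>sets m = _\<close> by (intro integrable_mult_right integrable_real_indicator) (auto simp: emeasure_eq_measure)
      show "integrable m s" unfolding s_def by (rule Bochner_Integration.integrable_sum[OF i])
      show "(\<integral>x. s x \<partial>m) = (\<Sum>A\<in>Pow I. v A * measure m (cell A))"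
        unfolding s_def using cell_sets sets_eq_imp_space_eq[OF that(2)] that(2)
        by (subst Bochner_Integration.integral_sum[OF i]) (auto intro!: sum.cong simp: cell_def Int_def conj_commute conj_left_commute)
    qed
    have approx: "\<bar>(\<integral>x. f x \<partial>m) - (\<integral>x. s x \<partial>m)\<bar> \<le> \<epsilon> + 2 * B * (1 - measure m \<Omega>0)"
      if m: "prob_space m" "sets m = sets (vecs J)" for m
    proof -
      interpret prob_space m by fact
      have spm: "space m = ?S" using sets_eq_imp_space_eq[OF m(2)] .
      have \<Omega>s: "?S - \<Omega>0 \<in> sets m" using \<Omega>0_sets m(2) by auto
      have ii: "integrable m (\<lambda>x. 2 * B * indicator (?S - \<Omega>0) x)"
        using \<Omega>s by (intro integrable_mult_right integrable_real_indicator) (auto simp: emeasure_eq_measure)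
      have "\<bar>(\<integral>x. f x \<partial>m) - (\<integral>x. s x \<partial>m)\<bar> = \<bar>\<integral>x. f x - s x \<partial>m\<bar>"
        using f_int[OF m] s_int[OF m] by simp
      also have "\<dots> \<le> (\<integral>x. \<bar>f x - s x\<bar> \<partial>m)" by (rule integral_abs_bound)
      also have "\<dots> \<le> (\<integral>x. \<epsilon> + 2 * B * indicator (?S - \<Omega>0) x \<partial>m)"
      proof (rule integral_mono)
        fix x assume x: "x \<in> space m"
        show "\<bar>f x - s x\<bar> \<le> \<epsilon> + 2 * B * indicator (?S - \<Omega>0) x"
        proof (cases "x \<in> \<Omega>0")
          case False
          then show ?thesis using B(2)[of x] v_le[of "{e\<in>I. x \<in> E e}"] s_eq[of x] x spm \<epsilon> by simp
        qed (use close in simp)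
      qed (use f_int[OF m] s_int[OF m] ii in auto)
      also have "\<dots> = \<epsilon> + 2 * B * measure m (?S - \<Omega>0)"
        using ii \<Omega>s sets.sets_into_space[OF \<Omega>s] by (subst Bochner_Integration.integral_add) (auto simp: prob_space Int_absorb2)
      also have "measure m (?S - \<Omega>0) = 1 - measure m \<Omega>0"
        using \<Omega>0_sets m(2) spm prob_compl[of \<Omega>0] by simp
      finally show ?thesis .
    qed
    have \<nu>\<Omega>: "measure \<nu> \<Omega>0 \<ge> 1 - \<epsilon>"
    proof -
      interpret prob_space \<nu> by fact
      have "measure \<nu> (L K) \<le> measure \<nu> \<Omega>0"
      proof (rule finite_measure_mono_AE)
        show "AE x in \<nu>. x \<in> L K \<longrightarrow> x \<in> \<Omega>0"
          using nonneg by eventually_elim (use \<delta> in \<open>auto simp: L_def \<Omega>0_def intro: order_trans[of _ 0]\<close>)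
      qed (use \<Omega>0_sets sets in auto)
      then show ?thesis using K by linarith
    qed
    \<comment> \<open>A point of \<open>L K\<close> outside \<open>\<Omega>0\<close> has a component
      below \<open>- \<delta>\<close>, so this difference bounds the probability of
      \<open>\<Omega>0\<close> from below.\<close>
    have "(\<lambda>n. measure (\<mu> n) (L K) - (\<Sum>k\<in>J. \<Sum>j\<in>(UNIV :: 'd set). measure (\<mu> n) {x\<in>?S. x k $ j < - \<delta>}))
      \<longlonglongrightarrow> measure \<nu> (L K) - (\<Sum>k\<in>J. \<Sum>j\<in>(UNIV :: 'd set). 0)"
      unfolding L_def using J K \<delta> by (intro tendsto_diff orth tendsto_sum neg) auto
    then have "eventually (\<lambda>n. measure (\<mu> n) (L K) - (\<Sum>k\<in>J. \<Sum>j\<in>(UNIV :: 'd set). measure (\<mu> n) {x\<in>?S. x k $ j < - \<delta>}) > 1 - \<epsilon>) sequentially"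
      using K by (intro order_tendstoD(1)) auto
    then have \<mu>\<Omega>: "eventually (\<lambda>n. measure (\<mu> n) \<Omega>0 \<ge> 1 - \<epsilon>) sequentially"
    proof eventually_elim
      case (elim n)
      interpret prob_space "\<mu> n" by fact
      let ?N = "\<lambda>k j. {x\<in>?S. x k $ j < - \<delta>}"
      have N: "?N k j \<in> sets (\<mu> n)" if "k \<in> J" for k j using that sets by simp
      have N': "(\<Union>j. ?N k j) \<in> sets (\<mu> n)" if "k \<in> J" for k using N[OF that] by (intro sets.finite_UN) auto
      have "measure (\<mu> n) (L K) \<le> measure (\<mu> n) (\<Omega>0 \<union> (\<Union>k\<in>J. \<Union>j. ?N k j))"
        using \<Omega>0_sets sets J N' by (intro finite_measure_mono sets.Un sets.finite_UN) (auto simp: L_def \<Omega>0_def not_less)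
      also have "\<dots> \<le> measure (\<mu> n) \<Omega>0 + measure (\<mu> n) (\<Union>k\<in>J. \<Union>j. ?N k j)"
        using \<Omega>0_sets sets J N' by (intro measure_Un_le sets.finite_UN) auto
      also have "measure (\<mu> n) (\<Union>k\<in>J. \<Union>j. ?N k j) \<le> (\<Sum>k\<in>J. measure (\<mu> n) (\<Union>j. ?N k j))"
        using N' by (intro measure_UNION_le J) auto
      also have "\<dots> \<le> (\<Sum>k\<in>J. \<Sum>j\<in>UNIV. measure (\<mu> n) (?N k j))"
        using N by (intro sum_mono measure_UNION_le) auto
      finally show ?case using elim by linarith
    qed
    have "(\<lambda>n. \<Sum>A\<in>Pow I. v A * measure (\<mu> n) (cell A)) \<longlonglongrightarrow> (\<Sum>A\<in>Pow I. v A * measure \<nu> (cell A))"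
    proof (intro tendsto_sum tendsto_mult tendsto_const)
      fix A assume A: "A \<in> Pow I"
      show "(\<lambda>n. measure (\<mu> n) (cell A)) \<longlonglongrightarrow> measure \<nu> (cell A)"
        unfolding cell_def
      proof (rule atom_probabilities_tendsto[where I=I])
        fix A' assume A': "A' \<subseteq> I"
        have "finite A'" "A' \<subseteq> J \<times> UNIV \<times> {0<..}"
          using A' I by (auto intro: finite_subset)
        note orth[OF this]
        moreover have "{x\<in>?S. \<forall>i\<in>A'. x \<in> E i} = {x\<in>?S. \<forall>(k, j, c)\<in>A'. x k $ j \<le> c}"
          by (auto simp: E_def)
        ultimately show "(\<lambda>n. measure (\<mu> n) {x\<in>?S. \<forall>i\<in>A'. x \<in> E i}) \<longlonglongrightarrow> measure \<nu> {x\<in>?S. \<forall>i\<in>A'. x \<in> E i}"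
          by simp
      qed (use A I sets E_sets prob in \<open>auto intro: prob_space.finite_measure\<close>)
    qed
    then have "(\<lambda>n. (\<integral>x. s x \<partial>\<mu> n)) \<longlonglongrightarrow> (\<integral>x. s x \<partial>\<nu>)"
      by (simp add: s_lint prob sets)
    from tendstoD[OF this \<epsilon>] have "eventually (\<lambda>n. \<bar>(\<integral>x. s x \<partial>\<mu> n) - (\<integral>x. s x \<partial>\<nu>)\<bar> < \<epsilon>) sequentially"
      by (simp add: dist_real_def)
    with \<mu>\<Omega> show ?thesis
    proof eventually_elim
      case (elim n)
      have "2 * B * (1 - measure (\<mu> n) \<Omega>0) \<le> 2 * B * \<epsilon>" "2 * B * (1 - measure \<nu> \<Omega>0) \<le> 2 * B * \<epsilon>"
        using elim \<nu>\<Omega> B by (auto intro!: mult_left_mono)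
      then have "\<bar>(\<integral>x. f x \<partial>\<mu> n) - (\<integral>x. f x \<partial>\<nu>)\<bar> \<le> (\<epsilon> + 2 * B * \<epsilon>) + \<epsilon> + (\<epsilon> + 2 * B * \<epsilon>)"
        using approx[OF prob(1) sets(1), of n] approx[OF prob(2) sets(2)] elim by linarith
      also have "\<dots> \<le> (3 + 6 * B) * \<epsilon>" using B \<epsilon> by (simp add: algebra_simps)
      finally show ?case .
    qed
  qed
  show "(\<lambda>n. \<integral>x. f x \<partial>\<mu> n) \<longlonglongrightarrow> (\<integral>x. f x \<partial>\<nu>)"
  proof (rule tendstoI)
    fix e :: real assume e: "e > 0"
    define \<epsilon> where "\<epsilon> = (e / 2) / (3 + 6 * B)"
    have B': "3 + 6 * B > 0" using B by simp
    then have "\<epsilon> > 0" using e by (simp add: \<epsilon>_def)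
    have "(3 + 6 * B) * \<epsilon> = e / 2" unfolding \<epsilon>_def using B' by (subst times_divide_eq_right, intro nonzero_mult_div_cancel_left) simp
    then have "(3 + 6 * B) * \<epsilon> < e" using e by simp
    with main[OF \<open>\<epsilon> > 0\<close>] show "eventually (\<lambda>n. dist (\<integral>x. f x \<partial>\<mu> n) (\<integral>x. f x \<partial>\<nu>) < e) sequentially"
      by (auto simp: dist_real_def elim!: eventually_mono)
  qed
qed

section \<open>Homogeneous functionals of regularly varying series\<close>

lemma is_norm_le_norm:
  fixes N :: "'v::euclidean_space \<Rightarrow> real"
  assumes "is_norm N"
  shows "\<exists>c>0. \<forall>x. N x \<le> c * norm x"
proof (intro exI[of _ "1 + (\<Sum>b\<in>Basis. N b)"] conjI allI)
  have N: "\<And>x. 0 \<le> N x" "\<And>c x. N (c *\<^sub>R x) = \<bar>c\<bar> * N x" "\<And>x y. N (x + y) \<le> N x + N y" "N 0 = 0"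
    using assms by (auto simp: is_norm_def)
  then show "0 < 1 + (\<Sum>b\<in>Basis. N b)" by (smt (verit) sum_nonneg)
  fix x :: 'v
  have sum: "N (sum f A) \<le> (\<Sum>a\<in>A. N (f a))" if "finite A" for f :: "'v \<Rightarrow> 'v" and A
    using that by (induction A) (use N(4) in \<open>auto intro!: order_trans[OF N(3)] add_left_mono\<close>)
  have "N x = N (\<Sum>b\<in>Basis. (x \<bullet> b) *\<^sub>R b)" by (simp add: euclidean_representation)
  also have "\<dots> \<le> (\<Sum>b\<in>Basis. N ((x \<bullet> b) *\<^sub>R b))" by (rule sum) simp
  also have "\<dots> \<le> (\<Sum>b\<in>Basis. norm x * N b)"
    using N by (auto intro!: sum_mono mult_right_mono Basis_le_norm)
  also have "\<dots> \<le> (1 + (\<Sum>b\<in>Basis. N b)) * norm x"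
    unfolding sum_distrib_left[symmetric] by (simp add: algebra_simps)
  finally show "N x \<le> (1 + (\<Sum>b\<in>Basis. N b)) * norm x" .
qed

lemma continuous_on_is_norm:
  fixes N :: "'v::euclidean_space \<Rightarrow> real"
  assumes "is_norm N"
  shows "continuous_on UNIV N"
proof -
  obtain c where c: "c > 0" "\<And>x. N x \<le> c * norm x" using is_norm_le_norm[OF assms] by blast
  have tri: "N x \<le> N (x - y) + N y" for x y
    using assms unfolding is_norm_def by (metis diff_add_cancel)
  have sym: "N (x - y) = N (y - x)" for x y
  proof -
    have "N ((-1) *\<^sub>R (y - x)) = \<bar>-1\<bar> * N (y - x)" using assms unfolding is_norm_def by blast
    then show ?thesis by simp
  qed
  have "c-lipschitz_on UNIV N"
  proof (rule lipschitz_onI)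
    fix x y
    show "dist (N x) (N y) \<le> c * dist x y"
      using tri[of x y] tri[of y x] sym[of x y] c(2)[of "x - y"] by (simp add: dist_norm)
  qed (use c in simp)
  then show ?thesis by (rule lipschitz_on_continuous_on)
qed

lemma norm_le_is_norm:
  fixes N :: "'v::euclidean_space \<Rightarrow> real"
  assumes "is_norm N"
  shows "\<exists>c>0. \<forall>x. norm x \<le> c * N x"
proof -
  have "sphere (0::'v) 1 \<noteq> {}"
    using nonempty_Basis norm_Basis by (metis all_not_in_conv mem_sphere_0)
  moreover have "continuous_on (sphere 0 1) N"
    using continuous_on_is_norm[OF assms] by (rule continuous_on_subset) simp
  ultimately obtain x0 where x0: "x0 \<in> sphere 0 1" "\<And>y. y \<in> sphere 0 1 \<Longrightarrow> N x0 \<le> N y"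
    using continuous_attains_inf[of "sphere 0 1" N] by auto
  have "x0 \<noteq> 0" using x0(1) by auto
  then have pos: "N x0 > 0" using assms unfolding is_norm_def by (metis less_eq_real_def)
  have "norm x \<le> inverse (N x0) * N x" for x
  proof (cases "x = 0")
    case False
    have "N x0 \<le> N (inverse (norm x) *\<^sub>R x)" using x0(2) False by simp
    also have "\<dots> = inverse (norm x) * N x" using assms unfolding is_norm_def by simp
    finally have "N x0 \<le> N x / norm x" by (simp add: field_simps)
    then show ?thesis using False pos by (simp add: field_simps)
  qed (use assms pos in \<open>simp add: is_norm_def\<close>)
  then show ?thesis using pos by (intro exI[of _ "inverse (N x0)"]) simp
qed

lemma integral_scale_measure:
  fixes f :: "'a \<Rightarrow> real"
  assumes c: "c \<ge> 0" and [measurable]: "f \<in> borel_measurable S"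
  shows "(\<integral>x. f x \<partial>scale_measure (ennreal c) S) = c * (\<integral>x. f x \<partial>S)"
proof -
  have "scale_measure (ennreal c) S = density S (\<lambda>_. ennreal c)"
    by (rule measure_eqI) (auto simp: emeasure_density nn_integral_cmult)
  then show ?thesis using c by (simp add: integral_density)
qed

text \<open>Both normalizations in the hypotheses have this shape: regular variation with the levels
  \<open>u * x\<close> and \<open>x\<close> in \<open>A\<close> and \<open>B\<close>, and the
  conditional law given a large norm at time 0 with \<open>A = B\<close>.\<close>

lemma integral_normalized_density:
  fixes f :: "'a \<Rightarrow> real"
  assumes "finite_measure M" and [measurable]: "A \<in> sets M" "f \<in> borel_measurable M" and B: "measure M B > 0"
  shows "(\<integral>\<omega>. f \<omega> \<partial>density M (\<lambda>\<omega>. indicator A \<omega> / emeasure M B)) = (\<integral>\<omega>. f \<omega> * indicator A \<omega> \<partial>M) / measure M B"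
proof -
  interpret finite_measure M by fact
  have "(\<lambda>\<omega>. indicator A \<omega> / emeasure M B) = (\<lambda>\<omega>. ennreal (indicator A \<omega> / measure M B))"
    using B by (auto simp: emeasure_eq_measure indicator_def divide_ennreal ennreal_1[symmetric] simp del: ennreal_1)
  then have "(\<integral>\<omega>. f \<omega> \<partial>density M (\<lambda>\<omega>. indicator A \<omega> / emeasure M B))
      = (\<integral>\<omega>. (indicator A \<omega> / measure M B) * f \<omega> \<partial>M)"
    using B by (simp add: integral_density)
  also have "\<dots> = (\<integral>\<omega>. f \<omega> * indicator A \<omega> / measure M B \<partial>M)"
    by (simp add: mult.commute)
  finally show ?thesis by simp
qed

text \<open>The argument is a full sequence and dependence on \<open>J\<close> alone is a condition,
  so that passing to a larger window or shifting time does not change the underlying space.\<close>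

definition homogeneous_on ::
  "('v::euclidean_space \<Rightarrow> real) \<Rightarrow> int set \<Rightarrow> ((int \<Rightarrow> 'v) \<Rightarrow> real) \<Rightarrow> bool" where
  "homogeneous_on N J H \<longleftrightarrow> continuous_on UNIV H \<and> (\<forall>x. 0 \<le> H x) \<and>
     (\<forall>x y. (\<forall>k\<in>J. x k = y k) \<longrightarrow> H x = H y) \<and> (\<forall>r>0. \<forall>x. H (\<lambda>k. r *\<^sub>R x k) = r * H x) \<and>
     (\<exists>C\<ge>0. \<forall>x. H x \<le> C * (\<Sum>k\<in>J. N (x k)))"

lemma homogeneous_onD:
  assumes "homogeneous_on N J H"
  shows "continuous_on UNIV H" "0 \<le> H x" "\<And>x y. (\<And>k. k \<in> J \<Longrightarrow> x k = y k) \<Longrightarrow> H x = H y"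
    "r > 0 \<Longrightarrow> H (\<lambda>k. r *\<^sub>R x k) = r * H x" "\<exists>C\<ge>0. \<forall>x. H x \<le> C * (\<Sum>k\<in>J. N (x k))"
  using assms unfolding homogeneous_on_def by blast+

lemma borel_measurable_homogeneous:
  "homogeneous_on N J H \<Longrightarrow> H \<in> borel_measurable borel"
  by (rule borel_measurable_continuous_onI) (rule homogeneous_onD)

lemma measurable_seq:
  fixes X :: "int \<Rightarrow> 'a \<Rightarrow> 'v::second_countable_topology"
  assumes "\<And>k. X k \<in> borel_measurable M"
  shows "(\<lambda>\<omega> k. X k \<omega>) \<in> measurable M borel"
proof -
  have "(\<lambda>\<omega> k. X k \<omega>) \<in> measurable M (vecs UNIV)"
    by (rule measurable_PiM_single') (use assms in auto)
  then show ?thesis by (subst measurable_cong_sets[OF refl sets_PiM_equal_borel[symmetric]])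
qed

section \<open>Tails of homogeneous functionals of a stationary regularly varying series\<close>

locale regularly_varying_series = prob_space M
  for M :: "'a measure" +
  fixes N :: "'v::euclidean_space \<Rightarrow> real" and \<alpha> :: real and X :: "int \<Rightarrow> 'a \<Rightarrow> 'v"
  assumes norm_N: "is_norm N" and \<alpha>_pos: "\<alpha> > 0"
    and X_measurable [measurable]: "\<And>t. X t \<in> borel_measurable M"
    and stationary: "stationary M X" and regularly_varying: "regularly_varying N \<alpha> M X"
begin

lemma N_nonneg: "0 \<le> N x" and N_eq_0: "N x = 0 \<longleftrightarrow> x = 0" and N_scale: "N (c *\<^sub>R x) = \<bar>c\<bar> * N x"
  using norm_N unfolding is_norm_def by blast+

lemma N_0 [simp]: "N 0 = 0"
  by (simp add: N_eq_0)

lemma N_measurable [measurable]: "N \<in> borel_measurable borel"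
  by (intro borel_measurable_continuous_onI continuous_on_is_norm norm_N)

lemma continuous_on_N_component [continuous_intros]:
  "continuous_on UNIV (\<lambda>x :: int \<Rightarrow> 'v. N (x k))"
  by (rule continuous_on_compose2[OF continuous_on_is_norm[OF norm_N]]) auto

lemma homogeneous_component:
  assumes "k \<in> J" "finite J" "c \<ge> 0"
  shows "homogeneous_on N J (\<lambda>x. c * N (x k))"
  unfolding homogeneous_on_def
  using assms by (auto intro!: continuous_intros exI[of _ c] mult_left_mono member_le_sum simp: N_nonneg N_scale)

lemma homogeneous_zero:
  assumes "homogeneous_on N J H" "\<And>k. k \<in> J \<Longrightarrow> x k = 0"
  shows "H x = 0"
proof -
  from homogeneous_onD(5)[OF assms(1)] obtain C where C: "\<And>x. H x \<le> C * (\<Sum>k\<in>J. N (x k))" by blast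
  have "(\<Sum>k\<in>J. N (x k)) = 0" using assms(2) by (simp add: sum.neutral)
  with C[of x] homogeneous_onD(2)[OF assms(1), of x] show ?thesis by simp
qed

lemma homogeneous_on_mono:
  assumes "homogeneous_on N J H" "J \<subseteq> J'" "finite J'"
  shows "homogeneous_on N J' H"
proof -
  note H = homogeneous_onD[OF assms(1)]
  obtain C where C: "C \<ge> 0" "\<And>x. H x \<le> C * (\<Sum>k\<in>J. N (x k))" using H(5) by blast
  have "H x \<le> C * (\<Sum>k\<in>J'. N (x k))" for x
    by (rule order_trans[OF C(2)]) (use assms C N_nonneg in \<open>auto intro!: mult_left_mono sum_mono2\<close>)
  then show ?thesis
    unfolding homogeneous_on_def using H(1,2,4) C(1) assms(2) H(3) by (meson subsetD)
qed

lemma homogeneous_measurable [measurable]: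
  assumes "homogeneous_on N J H"
  shows "(\<lambda>\<omega>. H (\<lambda>k. X k \<omega>)) \<in> borel_measurable M"
  by (rule measurable_compose[OF measurable_seq borel_measurable_homogeneous[OF assms]]) measurable

definition tail :: "real \<Rightarrow> real" where
  "tail x = prob {\<omega>\<in>space M. x < N (X 0 \<omega>)}"

lemma prob_shift:
  assumes "homogeneous_on N J H"
  shows "prob {\<omega>\<in>space M. x < H (\<lambda>k. X (k + h) \<omega>)} = prob {\<omega>\<in>space M. x < H (\<lambda>k. X k \<omega>)}"
proof -
  have H: "H \<in> borel_measurable (vecs UNIV)"
    using borel_measurable_homogeneous[OF assms] by (simp add: measurable_cong_sets[OF sets_PiM_equal_borel refl])
  have m: "(\<lambda>\<omega> k. X (k + h) \<omega>) \<in> measurable M (vecs UNIV)" for h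
    by (rule measurable_PiM_single') auto
  have S: "{y \<in> space (vecs UNIV). x < H y} \<in> sets (vecs UNIV)"
    using H by measurable
  have "measure (distr M (vecs UNIV) (\<lambda>\<omega> k. X (k + h) \<omega>)) {y \<in> space (vecs UNIV). x < H y} =
      measure (distr M (vecs UNIV) (\<lambda>\<omega> k. X k \<omega>)) {y \<in> space (vecs UNIV). x < H y}"
    using stationary unfolding stationary_def by simp
  then show ?thesis
    using m[of h] m[of 0] S
    by (subst (asm) measure_distr, simp, simp, subst (asm) measure_distr)
       (auto simp: vimage_def Int_def conj_commute space_PiM)
qed

lemma block_norm_measurable [measurable]:
  assumes "finite J" "J \<noteq> {}"
  shows "(\<lambda>\<omega>. block_norm N J (\<lambda>k\<in>J. X k \<omega>)) \<in> borel_measurable M"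
  unfolding block_norm_def
proof (rule borel_measurable_Max)
  fix k assume "k \<in> J"
  then show "(\<lambda>\<omega>. N ((\<lambda>k\<in>J. X k \<omega>) k)) \<in> borel_measurable M"
    by (simp add: restrict_apply')
qed (use assms in auto)

text \<open>\<open>H\<close> of the series is the block norm times the value of \<open>H\<close> at
  the normalized block, and \<open>H\<close> is bounded on the unit sphere. So
  \<open>tail_product_limit\<close> applies, and regular variation is exactly its last hypothesis
  for test functions of the form \<open>\<phi> (H x)\<close>.\<close>

lemma spectral_measure_exists:
  assumes J: "finite J" "J \<noteq> {}"
  shows "\<exists>S. prob_space S \<and> sets S = sets (vecs J) \<and> (AE \<theta> in S. block_norm N J \<theta> = 1) \<and>
    (\<forall>x. prob {\<omega>\<in>space M. x < block_norm N J (\<lambda>k\<in>J. X k \<omega>)} > 0) \<and>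
    (\<forall>H. homogeneous_on N J H \<longrightarrow> integrable S (\<lambda>\<theta>. H \<theta> powr \<alpha>) \<and>
      ((\<lambda>x. prob {\<omega>\<in>space M. x < H (\<lambda>k. X k \<omega>)} / prob {\<omega>\<in>space M. x < block_norm N J (\<lambda>k\<in>J. X k \<omega>)})
        \<longlongrightarrow> (\<integral>\<theta>. H \<theta> powr \<alpha> \<partial>S)) at_top)"
proof -
  define R where "R \<omega> = block_norm N J (\<lambda>k\<in>J. X k \<omega>)" for \<omega>
  define \<xi> where "\<xi> \<omega> = (\<lambda>k\<in>J. (\<lambda>k\<in>J. X k \<omega>) k /\<^sub>R R \<omega>)" for \<omega>
  have R [measurable]: "R \<in> borel_measurable M" unfolding R_def using J by measurable
  have \<xi> [measurable]: "\<xi> \<in> measurable M (vecs J)" unfolding \<xi>_def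
    by (rule measurable_restrict) (simp add: restrict_apply')
  have R_nonneg: "R \<omega> \<ge> 0" for \<omega>
  proof -
    obtain k where "k \<in> J" using J by blast
    then have "N (X k \<omega>) \<le> R \<omega>" using J by (auto simp: R_def block_norm_def intro!: Max_ge)
    then show ?thesis using N_nonneg[of "X k \<omega>"] by linarith
  qed
  have le_R: "N (X k \<omega>) \<le> R \<omega>" if "k \<in> J" for k \<omega>
    using J that by (auto simp: R_def block_norm_def intro!: Max_ge)
  let ?B = "\<lambda>x. {\<omega>\<in>space M. x < R \<omega>}"
  have B [measurable]: "?B x \<in> sets M" for x by measurable
  obtain S where S: "prob_space S" "sets S = sets (vecs J)" "AE \<theta> in S. block_norm N J \<theta> = 1"
    and lim: "\<And>u. u > 0 \<Longrightarrow> weakly_converges (vecs_top J)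
       (\<lambda>x. distr (density M (\<lambda>\<omega>. indicator (?B (u * x)) \<omega> / emeasure M (?B x))) (vecs J) \<xi>)
           (scale_measure (ennreal (u powr (- \<alpha>))) S) at_top"
    using regularly_varying J unfolding regularly_varying_def regularly_varying_vector_def R_def \<xi>_def by blast
  interpret S: prob_space S by fact
  \<comment> \<open>Were this probability 0 for some \<open>x\<close>, the normalized measures would
    be null from \<open>x\<close> on because of \<open>0 / 0 = 0\<close>, whereas
    \<open>u = 1\<close> and the test function 1 give the limit 1.\<close>
  have pos: "prob (?B x) > 0" for x
  proof (rule ccontr)
    assume "\<not> prob (?B x) > 0"
    then have 0: "prob (?B x) = 0" by (simp add: zero_less_measure_iff)
    have z: "emeasure M (?B y) = 0" if "y \<ge> x" for y
    proof -
      have "prob (?B y) \<le> prob (?B x)" by (rule finite_measure_mono) (use that in auto)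
      then show ?thesis using 0 by (simp add: emeasure_eq_measure measure_le_0_iff)
    qed
    have ev: "eventually (\<lambda>y. (\<integral>\<theta>. 1 \<partial>distr (density M (\<lambda>\<omega>. indicator (?B (1 * y)) \<omega> / emeasure M (?B y))) (vecs J) \<xi>) = (0::real)) at_top"
    proof (intro eventually_mono[OF eventually_ge_at_top[of x]])
      fix y assume "x \<le> y"
      then have e: "emeasure M (?B y) = 0" by (rule z)
      then have "AE \<omega> in M. \<omega> \<notin> ?B y" by (intro AE_not_in null_setsI) auto
      then have "AE \<omega> in M. indicator (?B (1 * y)) \<omega> / emeasure M (?B y) = 0"
        by eventually_elim auto
      then have "emeasure (density M (\<lambda>\<omega>. indicator (?B (1 * y)) \<omega> / emeasure M (?B y))) (space M) = 0"
        by (subst emeasure_density) (auto simp: nn_integral_0_iff_AE elim!: eventually_mono)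
      then have "emeasure (distr (density M (\<lambda>\<omega>. indicator (?B (1 * y)) \<omega> / emeasure M (?B y))) (vecs J) \<xi>) (space (vecs J)) = 0"
        by (subst emeasure_distr) (auto simp: vimage_def measurable_space[OF \<xi>] Int_def conj_commute cong: conj_cong)
      then show "(\<integral>\<theta>. 1 \<partial>distr (density M (\<lambda>\<omega>. indicator (?B (1 * y)) \<omega> / emeasure M (?B y))) (vecs J) \<xi>) = (0::real)"
        by (simp add: measure_def)
    qed
    have "((\<lambda>y. \<integral>\<theta>. (1::real) \<partial>distr (density M (\<lambda>\<omega>. indicator (?B (1 * y)) \<omega> / emeasure M (?B y))) (vecs J) \<xi>)
        \<longlongrightarrow> (\<integral>\<theta>. 1 \<partial>scale_measure (ennreal (1 powr (- \<alpha>))) S)) at_top"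
    proof -
      have "continuous_map (vecs_top J) euclidean (\<lambda>_ :: int \<Rightarrow> 'v. 1 :: real) \<and>
          bounded ((\<lambda>_ :: int \<Rightarrow> 'v. 1 :: real) ` topspace (vecs_top J))"
        by (auto intro!: boundedI[of _ 1])
      then show ?thesis
        by (rule lim[OF zero_less_one, unfolded weakly_converges_def, THEN spec[of _ "\<lambda>_. 1"], THEN mp])
    qed
    moreover have "(\<integral>\<theta>. 1 \<partial>scale_measure (ennreal (1 powr (- \<alpha>))) S) = (1::real)"
      using S.prob_space by (subst integral_scale_measure) auto
    ultimately have "((\<lambda>_. 0::real) \<longlongrightarrow> 1) (at_top :: real filter)"
      using tendsto_cong[OF ev] by simp
    then show False by (simp add: tendsto_const_iff)
  qed
  have key: "integrable S (\<lambda>\<theta>. H \<theta> powr \<alpha>) \<and>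
      ((\<lambda>x. prob {\<omega>\<in>space M. x < H (\<lambda>k. X k \<omega>)} / prob (?B x)) \<longlongrightarrow> (\<integral>\<theta>. H \<theta> powr \<alpha> \<partial>S)) at_top"
    if H: "homogeneous_on N J H" for H
  proof -
    note HD = homogeneous_onD[OF H]
    obtain C0 where C0: "C0 \<ge> 0" "\<And>x. H x \<le> C0 * (\<Sum>k\<in>J. N (x k))" using HD(5) by blast
    define C where "C = C0 * real (card J)"
    have HC: "H x \<le> C" if "\<And>k. k \<in> J \<Longrightarrow> N (x k) \<le> 1" for x
    proof -
      have "(\<Sum>k\<in>J. N (x k)) \<le> real (card J)" using sum_bounded_above[of J "\<lambda>k. N (x k)" 1] that by simp
      then show ?thesis using C0(1) C0(2)[of x] unfolding C_def by (meson mult_left_mono order_trans)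
    qed
    have H_vecs: "H \<in> borel_measurable (vecs J)"
      by (rule measurable_compose[OF measurable_vecs_embedding borel_measurable_homogeneous[OF H]])
    then have H_S [measurable]: "H \<in> borel_measurable S" by (simp add: measurable_cong_sets[OF S(2) refl])
    have H\<xi> [measurable]: "(\<lambda>\<omega>. H (\<xi> \<omega>)) \<in> borel_measurable M"
      by (rule measurable_compose[OF \<xi> H_vecs])
    have AEC: "AE \<theta> in S. 0 \<le> H \<theta> \<and> H \<theta> \<le> C"
      using S(3)
    proof eventually_elim
      case (elim \<theta>)
      have "N (\<theta> k) \<le> 1" if "k \<in> J" for k
        using J that elim unfolding block_norm_def by (metis Max_ge finite_imageI imageI)
      then show ?case using HD(2) HC by simp
    qed
    have N\<xi>: "N (\<xi> \<omega> k) \<le> 1" if "k \<in> J" for \<omega> k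
    proof -
      have "N (\<xi> \<omega> k) = inverse (R \<omega>) * N (X k \<omega>)" using that R_nonneg by (simp add: \<xi>_def N_scale)
      also have "\<dots> \<le> inverse (R \<omega>) * R \<omega>" using le_R[OF that] R_nonneg by (intro mult_left_mono) auto
      also have "\<dots> \<le> 1" by (cases "R \<omega> = 0") auto
      finally show ?thesis .
    qed
    have prod: "R \<omega> * H (\<xi> \<omega>) = H (\<lambda>k. X k \<omega>)" for \<omega>
    proof (cases "R \<omega> = 0")
      case True
      then have "X k \<omega> = 0" if "k \<in> J" for k
        using le_R[OF that, of \<omega>] N_nonneg[of "X k \<omega>"] N_eq_0 by (metis order_antisym)
      then show ?thesis using True homogeneous_zero[OF H] by simp
    next
      case False
      then have "R \<omega> > 0" using R_nonneg[of \<omega>] by simp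
      then have "R \<omega> * H (\<xi> \<omega>) = H (\<lambda>k. R \<omega> *\<^sub>R \<xi> \<omega> k)" by (simp add: HD(4))
      also have "\<dots> = H (\<lambda>k. X k \<omega>)" using False by (intro HD(3)) (simp add: \<xi>_def)
      finally show ?thesis .
    qed
    have "((\<lambda>x. prob {\<omega>\<in>space M. x < R \<omega> * H (\<xi> \<omega>)} / prob (?B x)) \<longlongrightarrow> (\<integral>\<theta>. H \<theta> powr \<alpha> \<partial>S)) at_top"
    proof (rule tail_product_limit[where C=C])
      show "prob_space M" by unfold_locales
      show "finite_measure S" by unfold_locales
      show "0 \<le> H (\<xi> \<omega>) \<and> H (\<xi> \<omega>) \<le> C" for \<omega> using HD(2) HC N\<xi> by blast
      fix u :: real and \<phi> :: "real \<Rightarrow> real"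
      assume u: "u > 0" and \<phi>: "continuous_on UNIV \<phi>" "\<And>s. 0 \<le> \<phi> s \<and> \<phi> s \<le> 1"
      have [measurable]: "\<phi> \<in> borel_measurable borel" by (rule borel_measurable_continuous_onI[OF \<phi>(1)])
      have c: "continuous_map (vecs_top J) euclidean (\<lambda>x. \<phi> (H x))"
        by (rule continuous_map_vecs_top_embedding) (rule continuous_on_compose2[OF \<phi>(1) HD(1)], simp)
      have "bounded ((\<lambda>x. \<phi> (H x)) ` topspace (vecs_top J))"
        using \<phi>(2) by (intro boundedI[of _ 1]) (auto simp: abs_le_iff intro: order_trans[of _ 0])
      with c have *: "((\<lambda>x. \<integral>\<theta>. \<phi> (H \<theta>) \<partial>distr (density M (\<lambda>\<omega>. indicator (?B (u * x)) \<omega> / emeasure M (?B x))) (vecs J) \<xi>)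
         \<longlongrightarrow> (\<integral>\<theta>. \<phi> (H \<theta>) \<partial>scale_measure (ennreal (u powr (- \<alpha>))) S)) at_top"
        by (intro lim[OF u, unfolded weakly_converges_def, THEN spec[of _ "\<lambda>x. \<phi> (H x)"], THEN mp] conjI)
      have 1: "(\<integral>\<theta>. \<phi> (H \<theta>) \<partial>distr (density M (\<lambda>\<omega>. indicator (?B (u * x)) \<omega> / emeasure M (?B x))) (vecs J) \<xi>)
         = (\<integral>\<omega>. \<phi> (H (\<xi> \<omega>)) * indicator (?B (u * x)) \<omega> \<partial>M) / prob (?B x)" for x
        using H_vecs pos[of x] finite_measure_axioms by (subst integral_distr) (auto intro!: integral_normalized_density)
      have 2: "(\<integral>\<theta>. \<phi> (H \<theta>) \<partial>scale_measure (ennreal (u powr (- \<alpha>))) S) = u powr (-\<alpha>) * (\<integral>\<theta>. \<phi> (H \<theta>) \<partial>S)"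
        by (rule integral_scale_measure) auto
      show "((\<lambda>x. (\<integral>\<omega>. \<phi> (H (\<xi> \<omega>)) * indicator {\<omega> \<in> space M. u * x < R \<omega>} \<omega> \<partial>M) / prob (?B x))
        \<longlongrightarrow> u powr - \<alpha> * (\<integral>\<omega>. \<phi> (H \<omega>) \<partial>S)) at_top"
        using * unfolding 1 2 .
    qed (use AEC pos \<alpha>_pos in auto)
    moreover have "integrable S (\<lambda>\<theta>. H \<theta> powr \<alpha>)"
    proof (rule S.integrable_const_bound[where B="C powr \<alpha>"])
      show "AE \<theta> in S. norm (H \<theta> powr \<alpha>) \<le> C powr \<alpha>"
        using AEC by eventually_elim (use \<alpha>_pos in \<open>auto intro: powr_mono2\<close>)
    qed measurable
    ultimately show ?thesis unfolding prod by blast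
  qed
  show ?thesis
    using S pos key unfolding R_def by (intro exI[of _ S]) blast
qed

text \<open>The case \<open>J = {0}\<close>, where the block norm is the norm at time 0. The
  functional \<open>N (x 0) / u\<close> is the constant \<open>1 / u\<close> on the unit sphere, and
  it exceeds \<open>x\<close> exactly when the norm exceeds \<open>u * x\<close>.\<close>

lemma tail_pos: "tail x > 0" and tail_ratio: "u > 0 \<Longrightarrow> ((\<lambda>x. tail (u * x) / tail x) \<longlongrightarrow> u powr (- \<alpha>)) at_top"
proof -
  have b: "block_norm N {0} y = N (y 0)" for y by (simp add: block_norm_def)
  obtain S where S: "prob_space S" "AE \<theta> in S. N (\<theta> 0) = 1" "\<And>x. tail x > 0" "sets S = sets (vecs {0})"
    and lim: "\<And>H. homogeneous_on N {0} H \<Longrightarrow>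
      ((\<lambda>x. prob {\<omega>\<in>space M. x < H (\<lambda>k. X k \<omega>)} / tail x) \<longlongrightarrow> (\<integral>\<theta>. H \<theta> powr \<alpha> \<partial>S)) at_top"
    using spectral_measure_exists[of "{0}"] by (auto simp: b tail_def)
  interpret S: prob_space S by fact
  show "tail x > 0" by fact
  assume u: "u > 0"
  have "((\<lambda>x. prob {\<omega>\<in>space M. x < inverse u * N (X 0 \<omega>)} / tail x) \<longlongrightarrow> (\<integral>\<theta>. (inverse u * N (\<theta> 0)) powr \<alpha> \<partial>S)) at_top"
    using u by (intro lim[of "\<lambda>x. inverse u * N (x 0)"] homogeneous_component) auto
  moreover have "(\<integral>\<theta>. (inverse u * N (\<theta> 0)) powr \<alpha> \<partial>S) = (\<integral>\<theta>. inverse u powr \<alpha> \<partial>S)"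
  proof (rule integral_cong_AE)
    have "(\<lambda>\<theta>. N (\<theta> 0)) \<in> borel_measurable (vecs {0})" by measurable
    then have [measurable]: "(\<lambda>\<theta>. N (\<theta> 0)) \<in> borel_measurable S"
      by (simp add: measurable_cong_sets[OF S(4) refl])
    show "(\<lambda>\<theta>. (inverse u * N (\<theta> 0)) powr \<alpha>) \<in> borel_measurable S" by measurable
    show "AE \<theta> in S. (inverse u * N (\<theta> 0)) powr \<alpha> = inverse u powr \<alpha>"
      using S(2) by eventually_elim simp
  qed simp
  moreover have "inverse u powr \<alpha> = u powr (-\<alpha>)" using u by (simp add: powr_minus inverse_powr)
  moreover have "(x < inverse u * N y) = (u * x < N y)" for x y using u by (simp add: field_simps)
  ultimately show "((\<lambda>x. tail (u * x) / tail x) \<longlongrightarrow> u powr (- \<alpha>)) at_top"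
    using S.prob_space by (simp add: tail_def)
qed

end

section \<open>The limit in terms of the spectral tail process\<close>

lemma ennreal_divide_le_divide:
  assumes "0 \<le> q" "0 < w" "ennreal w \<le> T"
  shows "ennreal q / T \<le> ennreal (q / w)"
proof (cases T)
  case (real r)
  then have "w \<le> r" using assms by simp
  then show ?thesis using assms real by (simp add: divide_ennreal divide_left_mono)
qed (simp add: ennreal_divide_top)

context regularly_varying_series
begin

text \<open>This replaces the block norm by the norm at time 0 in the denominator. Here
  \<open>\<kappa>\<close> is the limit of the quotient of the two tails; by stationarity every time
  in \<open>J\<close> gives the same value. It is positive since on the unit sphere the powers
  \<open>N (\<theta> k) powr \<alpha>\<close> sum to at least 1. The point is that \<open>S\<close>
  and \<open>\<kappa>\<close> do not depend on \<open>H\<close>, so the limit is additive in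
  \<open>H powr \<alpha>\<close>.\<close>

lemma tail_limit_linear:
  assumes J: "finite J" "J \<noteq> {}"
  shows "\<exists>S \<kappa>. prob_space S \<and> sets S = sets (vecs J) \<and> \<kappa> > (0::real) \<and>
    (\<forall>H. homogeneous_on N J H \<longrightarrow> integrable S (\<lambda>\<theta>. H \<theta> powr \<alpha>) \<and>
      ((\<lambda>x. prob {\<omega>\<in>space M. x < H (\<lambda>k. X k \<omega>)} / tail x) \<longlongrightarrow> (\<integral>\<theta>. H \<theta> powr \<alpha> \<partial>S) / \<kappa>) at_top)"
proof -
  define B where "B x = prob {\<omega>\<in>space M. x < block_norm N J (\<lambda>k\<in>J. X k \<omega>)}" for x
  obtain S where S: "prob_space S" "sets S = sets (vecs J)" "AE \<theta> in S. block_norm N J \<theta> = 1"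
    and B: "\<And>x. B x > 0"
    and int: "\<And>H. homogeneous_on N J H \<Longrightarrow> integrable S (\<lambda>\<theta>. H \<theta> powr \<alpha>)"
    and lim: "\<And>H. homogeneous_on N J H \<Longrightarrow>
      ((\<lambda>x. prob {\<omega>\<in>space M. x < H (\<lambda>k. X k \<omega>)} / B x) \<longlongrightarrow> (\<integral>\<theta>. H \<theta> powr \<alpha> \<partial>S)) at_top"
    using spectral_measure_exists[OF J] unfolding B_def by blast
  interpret S: prob_space S by fact
  obtain k0 where k0: "k0 \<in> J" using J by blast
  have hom: "homogeneous_on N J (\<lambda>x. N (x k))" if "k \<in> J" for k
    using homogeneous_component[OF that J(1), of 1] by simp
  have same: "prob {\<omega>\<in>space M. x < N (X k \<omega>)} = tail x" for k x
    using prob_shift[OF homogeneous_component[of 0 "{0}" 1], of x k] by (simp add: tail_def)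
  have limk: "((\<lambda>x. tail x / B x) \<longlongrightarrow> (\<integral>\<theta>. N (\<theta> k) powr \<alpha> \<partial>S)) at_top" if "k \<in> J" for k
    using lim[OF hom[OF that]] by (simp add: same)
  define \<kappa> where "\<kappa> = (\<integral>\<theta>. N (\<theta> k0) powr \<alpha> \<partial>S)"
  have eq: "(\<integral>\<theta>. N (\<theta> k) powr \<alpha> \<partial>S) = \<kappa>" if "k \<in> J" for k
    unfolding \<kappa>_def by (rule tendsto_unique[OF _ limk[OF that] limk[OF k0]]) simp
  have "1 = (\<integral>\<theta>. (1::real) \<partial>S)" using S.prob_space by simp
  also have "\<dots> \<le> (\<integral>\<theta>. (\<Sum>k\<in>J. N (\<theta> k) powr \<alpha>) \<partial>S)"
  proof (rule integral_mono_AE)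
    show "AE \<theta> in S. 1 \<le> (\<Sum>k\<in>J. N (\<theta> k) powr \<alpha>)"
      using S(3)
    proof eventually_elim
      case (elim \<theta>)
      then obtain k where "k \<in> J" "N (\<theta> k) = 1"
        using J Max_in[of "(\<lambda>k. N (\<theta> k)) ` J"] unfolding block_norm_def by auto
      then show ?case
        using member_le_sum[of k J "\<lambda>k. N (\<theta> k) powr \<alpha>"] J by simp
    qed
  qed (use int hom in auto)
  also have "\<dots> = real (card J) * \<kappa>"
    using int hom eq by (subst Bochner_Integration.integral_sum) auto
  finally have \<kappa>: "\<kappa> > 0"
    by (metis linorder_not_le mult_nonneg_nonpos not_one_le_zero of_nat_0_le_iff order_trans)
  have "((\<lambda>x. prob {\<omega>\<in>space M. x < H (\<lambda>k. X k \<omega>)} / tail x) \<longlongrightarrow> (\<integral>\<theta>. H \<theta> powr \<alpha> \<partial>S) / \<kappa>) at_top"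
    if H: "homogeneous_on N J H" for H
  proof -
    have "((\<lambda>x. (prob {\<omega>\<in>space M. x < H (\<lambda>k. X k \<omega>)} / B x) / (tail x / B x)) \<longlongrightarrow> (\<integral>\<theta>. H \<theta> powr \<alpha> \<partial>S) / \<kappa>) at_top"
      using \<kappa> limk[OF k0] by (intro tendsto_divide lim H) (auto simp: \<kappa>_def)
    then show ?thesis using B by (simp add: less_imp_neq[symmetric])
  qed
  with S int \<kappa> show ?thesis by (intro exI[of _ S] exI[of _ \<kappa>]) blast
qed

section \<open>Splitting a functional over the times of a window\<close>

definition window_sum :: "int set \<Rightarrow> (int \<Rightarrow> 'v) \<Rightarrow> real" where
  "window_sum L x = (\<Sum>k\<in>L. N (x k) powr \<alpha>)"

lemma window_sum_nonneg: "window_sum L x \<ge> 0"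
  by (simp add: window_sum_def sum_nonneg)

lemma component_le_window_sum:
  assumes "finite L" "k \<in> L"
  shows "N (x k) \<le> window_sum L x powr (1 / \<alpha>)"
proof -
  have "N (x k) powr \<alpha> \<le> window_sum L x"
    unfolding window_sum_def using assms by (intro member_le_sum) auto
  then have "(N (x k) powr \<alpha>) powr (1 / \<alpha>) \<le> window_sum L x powr (1 / \<alpha>)"
    using \<alpha>_pos by (intro powr_mono2) auto
  then show ?thesis using \<alpha>_pos N_nonneg by (simp add: powr_powr)
qed

lemma homogeneous_powr_bound:
  assumes H: "homogeneous_on N J H" and L: "J \<subseteq> L" "finite L"
  shows "\<exists>C\<ge>0. \<forall>x. H x \<le> C * window_sum L x powr (1 / \<alpha>)"
proof -
  obtain C where C: "C \<ge> 0" "\<And>x. H x \<le> C * (\<Sum>k\<in>J. N (x k))" using homogeneous_onD(5)[OF H] by blast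
  have "H x \<le> (C * real (card J)) * window_sum L x powr (1 / \<alpha>)" for x
  proof -
    have "(\<Sum>k\<in>J. N (x k)) \<le> real (card J) * window_sum L x powr (1 / \<alpha>)"
      using L by (intro sum_bounded_above component_le_window_sum) auto
    then show ?thesis using C(1) C(2)[of x] by (smt (verit) mult.assoc mult_left_mono)
  qed
  then show ?thesis using C(1) by (intro exI[of _ "C * real (card J)"]) simp
qed

text \<open>The power \<open>\<alpha>\<close> of this weight is the share of time \<open>l\<close>
  in the window sum. On a vanishing window the quotient is 0.\<close>

definition component_weight :: "int set \<Rightarrow> int \<Rightarrow> (int \<Rightarrow> 'v) \<Rightarrow> real" where
  "component_weight L l x = N (x l) / window_sum L x powr (1 / \<alpha>)"

lemma component_weight_bounds:
  assumes "finite L" "l \<in> L"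
  shows "0 \<le> component_weight L l x" "component_weight L l x \<le> 1"
  unfolding component_weight_def
  using component_le_window_sum[OF assms, of x] N_nonneg by (auto intro!: divide_le_eq_1[THEN iffD2] simp: less_le)

text \<open>The weight is scale invariant, so the product stays homogeneous of degree 1. Since
  \<open>H\<close> is at most a multiple of \<open>window_sum L x powr (1 / \<alpha>)\<close>, the
  denominator of the weight cancels and only the norm at \<open>l\<close> remains; that bound is
  what \<open>spectral_limit\<close> asks for once \<open>l\<close> is shifted to 0.\<close>

lemma homogeneous_weighted:
  assumes H: "homogeneous_on N J H" and L: "J \<subseteq> L" "finite L" "l \<in> L"
  shows "homogeneous_on N L (\<lambda>x. H x * component_weight L l x)"
    and "\<exists>C\<ge>0. \<forall>x. H x * component_weight L l x \<le> C * N (x l)"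
proof -
  note HL = homogeneous_on_mono[OF H L(1,2)]
  note HD = homogeneous_onD[OF HL]
  let ?G = "\<lambda>x. H x * component_weight L l x"
  have G_le: "?G x \<le> H x" for x
    using component_weight_bounds[OF L(2,3), of x] HD(2)[of x] by (intro mult_left_le) auto
  have G_nonneg: "0 \<le> ?G x" for x
    using component_weight_bounds[OF L(2,3), of x] HD(2)[of x] by simp
  have cH: "isCont H x" for x using HD(1) by (simp add: continuous_on_eq_continuous_at)
  have cN: "isCont (\<lambda>x. N (x k)) x" for x :: "int \<Rightarrow> 'v" and k
    using continuous_on_N_component[of k] by (simp add: continuous_on_eq_continuous_at)
  have cW: "isCont (window_sum L) x" for x
    unfolding window_sum_def[abs_def] using \<alpha>_pos N_nonneg
    by (intro continuous_sum) (auto simp: isCont_def intro!: tendsto_powr' cN[unfolded isCont_def])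
  have "isCont ?G x" for x
  proof (cases "window_sum L x = 0")
    case False
    then have "isCont (component_weight L l) x"
      unfolding component_weight_def[abs_def] isCont_def
      by (intro tendsto_divide cN[unfolded isCont_def] tendsto_powr cW[unfolded isCont_def] tendsto_const) auto
    then show ?thesis by (intro continuous_mult cH)
  next
    \<comment> \<open>On a vanishing window the weight itself may be discontinuous. There
      \<open>H\<close> is 0, and \<open>0 \<le> ?G \<le> H\<close> forces continuity of the
      product.\<close>
    case True
    have 0: "x k = 0" if "k \<in> L" for k
      using component_le_window_sum[OF L(2) that, of x] N_nonneg[of "x k"] True N_eq_0 by simp
    then have Hx: "H x = 0" by (rule homogeneous_zero[OF HL])
    then have Gx: "?G x = 0" by simp
    have "(?G \<longlongrightarrow> 0) (at x)"
    proof (rule tendsto_sandwich[of "\<lambda>_. 0" ?G _ H])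
      show "(H \<longlongrightarrow> 0) (at x)" using cH[of x] Hx by (simp add: isCont_def)
    qed (use G_le G_nonneg in auto)
    then show ?thesis unfolding isCont_def Gx .
  qed
  then have cont: "continuous_on UNIV ?G" by (simp add: continuous_on_eq_continuous_at)
  have dep: "?G x = ?G y" if "\<And>k. k \<in> L \<Longrightarrow> x k = y k" for x y
    using HD(3)[of x y] that L(3) by (simp add: component_weight_def window_sum_def)
  have hom: "?G (\<lambda>k. r *\<^sub>R x k) = r * ?G x" if r: "r > 0" for r x
  proof -
    have "window_sum L (\<lambda>k. r *\<^sub>R x k) = r powr \<alpha> * window_sum L x"
      using r N_nonneg by (simp add: window_sum_def N_scale powr_mult sum_distrib_left)
    then have "component_weight L l (\<lambda>k. r *\<^sub>R x k) = component_weight L l x"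
      using r \<alpha>_pos window_sum_nonneg[of L x] by (simp add: component_weight_def N_scale powr_mult powr_powr)
    then show ?thesis using HD(4)[OF r, of x] by simp
  qed
  obtain C where C: "C \<ge> 0" "\<And>x. H x \<le> C * (\<Sum>k\<in>L. N (x k))" using HD(5) by blast
  show "homogeneous_on N L ?G"
    unfolding homogeneous_on_def
  proof (intro conjI allI impI exI[of _ C])
    show "?G x = ?G y" if "\<forall>k\<in>L. x k = y k" for x y by (rule dep) (use that in blast)
    show "?G x \<le> C * (\<Sum>k\<in>L. N (x k))" for x by (rule order_trans[OF G_le C(2)])
  qed (use cont G_nonneg hom C(1) in auto)
  obtain C' where C': "C' \<ge> 0" "\<And>x. H x \<le> C' * window_sum L x powr (1 / \<alpha>)"
    using homogeneous_powr_bound[OF H L(1,2)] by blast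
  have "?G x \<le> C' * N (x l)" for x
  proof (cases "window_sum L x = 0")
    case True
    then show ?thesis using C' N_nonneg by (simp add: component_weight_def)
  next
    case False
    then have p: "window_sum L x powr (1 / \<alpha>) > 0" by simp
    have "?G x \<le> (C' * window_sum L x powr (1 / \<alpha>)) * component_weight L l x"
      using C'(2)[of x] component_weight_bounds[OF L(2,3), of x] by (intro mult_right_mono) auto
    also have "\<dots> = C' * N (x l)" using p by (simp add: component_weight_def)
    finally show ?thesis .
  qed
  then show "\<exists>C\<ge>0. \<forall>x. ?G x \<le> C * N (x l)" using C'(1) by blast
qed

lemma weighted_powr:
  assumes "homogeneous_on N J H"
  shows "(H x * component_weight L l x) powr \<alpha> = H x powr \<alpha> * N (x l) powr \<alpha> / window_sum L x"
  using homogeneous_onD(2)[OF assms, of x] N_nonneg[of "x l"] \<alpha>_pos window_sum_nonneg[of L x]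
  by (simp add: component_weight_def powr_mult powr_divide powr_powr)

text \<open>The shares add up to 1 unless the window vanishes, in which case \<open>H\<close> is 0
  as well.\<close>

lemma sum_weighted_powr:
  assumes H: "homogeneous_on N J H" and L: "J \<subseteq> L" "finite L"
  shows "(\<Sum>l\<in>L. (H x * component_weight L l x) powr \<alpha>) = H x powr \<alpha>"
proof (cases "window_sum L x = 0")
  case True
  have "x k = 0" if "k \<in> L" for k
    using component_le_window_sum[OF L(2) that, of x] N_nonneg[of "x k"] True N_eq_0 by simp
  then have "H x = 0" using homogeneous_zero[OF H] L(1) by blast
  then show ?thesis by simp
next
  case False
  then show ?thesis
    unfolding weighted_powr[OF H] sum_divide_distrib[symmetric] sum_distrib_left[symmetric]
    by (simp add: window_sum_def)
qed

lemma homogeneous_shift: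
  assumes H: "homogeneous_on N {a..b} H"
  shows "homogeneous_on N {a - l..b - l} (\<lambda>x. H (\<lambda>k. x (k - l)))"
proof -
  note HD = homogeneous_onD[OF H]
  obtain C where C: "C \<ge> 0" "\<And>x. H x \<le> C * (\<Sum>k\<in>{a..b}. N (x k))" using HD(5) by blast
  have "continuous_on UNIV (\<lambda>x :: int \<Rightarrow> 'v. H (\<lambda>k. x (k - l)))"
    by (rule continuous_on_compose2[OF HD(1)]) (auto intro!: continuous_on_coordinatewise_then_product)
  moreover have "(\<Sum>k\<in>{a..b}. N (x (k - l))) = (\<Sum>k\<in>{a - l..b - l}. N (x k))" for x :: "int \<Rightarrow> 'v"
    by (rule sum.reindex_bij_witness[of _ "\<lambda>k. k + l" "\<lambda>k. k - l"]) auto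
  ultimately show ?thesis
    unfolding homogeneous_on_def
    using HD(2,4) C by (auto intro!: HD(3) exI[of _ C]) metis
qed

end

section \<open>Evaluating limits through the spectral tail process at time 0\<close>

locale spectral_series = regularly_varying_series M N \<alpha> X
  for M :: "'a measure" and N :: "'v::euclidean_space \<Rightarrow> real" and \<alpha> :: real and X :: "int \<Rightarrow> 'a \<Rightarrow> 'v" +
  fixes Q :: "'b measure" and \<Theta> :: "int \<Rightarrow> 'b \<Rightarrow> 'v"
  assumes prob_Q: "prob_space Q" and \<Theta>_measurable [measurable]: "\<And>t. \<Theta> t \<in> borel_measurable Q"
    and spectral: "spectral_tail_process N M X Q \<Theta>"
begin

interpretation Q: prob_space Q by (rule prob_Q)

lemma spectral_integral_limit:
  assumes st: "s \<le> t" and f: "continuous_on UNIV f" "\<And>x. 0 \<le> f x \<and> f x \<le> 1"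
    and dep: "\<And>x y. (\<And>k. k \<in> {s..t} \<Longrightarrow> x k = y k) \<Longrightarrow> f x = f y"
  shows "((\<lambda>x. (\<integral>\<omega>. f (\<lambda>k. X k \<omega> /\<^sub>R N (X 0 \<omega>)) * indicator {\<omega>\<in>space M. x < N (X 0 \<omega>)} \<omega> \<partial>M) / tail x)
    \<longlongrightarrow> (\<integral>\<omega>. f (\<lambda>k. \<Theta> k \<omega>) \<partial>Q)) at_top"
proof -
  let ?J = "{s..t}"
  have c: "continuous_map (vecs_top ?J) euclidean f"
    by (rule continuous_map_vecs_top_embedding[OF f(1)])
  have fm: "f \<in> borel_measurable (vecs ?J)" by (rule borel_measurable_vecs_top[OF c])
  have fb: "f \<in> borel_measurable borel" by (rule borel_measurable_continuous_onI[OF f(1)])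
  have "bounded (f ` topspace (vecs_top ?J))"
    using f(2) by (intro boundedI[of _ 1]) (auto simp: abs_le_iff intro: order_trans[of _ 0])
  then have lim: "((\<lambda>x. \<integral>y. f y \<partial>distr (uniform_measure M {\<omega>\<in>space M. N (X 0 \<omega>) > x})
                 (vecs ?J) (\<lambda>\<omega>. \<lambda>k\<in>?J. X k \<omega> /\<^sub>R N (X 0 \<omega>)))
     \<longlongrightarrow> (\<integral>y. f y \<partial>distr Q (vecs ?J) (\<lambda>\<omega>. \<lambda>k\<in>?J. \<Theta> k \<omega>))) at_top"
    using spectral[unfolded spectral_tail_process_def, rule_format, OF st,
      unfolded weakly_converges_def, THEN spec[of _ f], THEN mp] c by blast
  have [measurable]: "(\<lambda>\<omega>. \<lambda>k\<in>?J. X k \<omega> /\<^sub>R N (X 0 \<omega>)) \<in> measurable M (vecs ?J)"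
    by (rule measurable_restrict) measurable
  have [measurable]: "(\<lambda>\<omega>. f (\<lambda>k. X k \<omega> /\<^sub>R N (X 0 \<omega>))) \<in> borel_measurable M"
    by (rule measurable_compose[OF measurable_seq fb]) measurable
  have 1: "(\<integral>y. f y \<partial>distr (uniform_measure M {\<omega>\<in>space M. N (X 0 \<omega>) > x})
                 (vecs ?J) (\<lambda>\<omega>. \<lambda>k\<in>?J. X k \<omega> /\<^sub>R N (X 0 \<omega>)))
     = (\<integral>\<omega>. f (\<lambda>k. X k \<omega> /\<^sub>R N (X 0 \<omega>)) * indicator {\<omega>\<in>space M. x < N (X 0 \<omega>)} \<omega> \<partial>M) / tail x" for x
  proof -
    have "f (\<lambda>k\<in>?J. X k \<omega> /\<^sub>R N (X 0 \<omega>)) = f (\<lambda>k. X k \<omega> /\<^sub>R N (X 0 \<omega>))" for \<omega>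
      by (rule dep) simp
    then show ?thesis
      unfolding uniform_measure_def tail_def using fm finite_measure_axioms tail_pos[of x]
      by (subst integral_distr) (auto intro!: integral_normalized_density simp: tail_def)
  qed
  have 2: "(\<integral>y. f y \<partial>distr Q (vecs ?J) (\<lambda>\<omega>. \<lambda>k\<in>?J. \<Theta> k \<omega>)) = (\<integral>\<omega>. f (\<lambda>k. \<Theta> k \<omega>) \<partial>Q)"
  proof -
    have "f (\<lambda>k\<in>?J. \<Theta> k \<omega>) = f (\<lambda>k. \<Theta> k \<omega>)" for \<omega>
      by (rule dep) simp
    then show ?thesis using fm by (subst integral_distr) auto
  qed
  show ?thesis using lim unfolding 1 2 .
qed

text \<open>A bounded continuous test function that measures the distance of the norm at time 0 from
  1 vanishes at the normalized series as soon as the value at time 0 is nonzero, so its limit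
  integral is 0.\<close>

lemma norm_spectral_0: "AE \<omega> in Q. N (\<Theta> 0 \<omega>) = 1"
proof -
  let ?f = "\<lambda>x :: int \<Rightarrow> 'v. min 1 \<bar>N (x 0) - 1\<bar>"
  have "((\<lambda>x. (\<integral>\<omega>. ?f (\<lambda>k. X k \<omega> /\<^sub>R N (X 0 \<omega>)) * indicator {\<omega>\<in>space M. x < N (X 0 \<omega>)} \<omega> \<partial>M) / tail x)
    \<longlongrightarrow> (\<integral>\<omega>. ?f (\<lambda>k. \<Theta> k \<omega>) \<partial>Q)) at_top"
    by (rule spectral_integral_limit[of 0 0]) (auto intro!: continuous_intros)
  moreover have "eventually (\<lambda>x. (\<integral>\<omega>. ?f (\<lambda>k. X k \<omega> /\<^sub>R N (X 0 \<omega>)) * indicator {\<omega>\<in>space M. x < N (X 0 \<omega>)} \<omega> \<partial>M) / tail x = 0) at_top"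
    using eventually_ge_at_top[of 0]
  proof eventually_elim
    case (elim x)
    have "?f (\<lambda>k. X k \<omega> /\<^sub>R N (X 0 \<omega>)) * indicator {\<omega>\<in>space M. x < N (X 0 \<omega>)} \<omega> = 0" for \<omega>
      using elim by (auto simp: N_scale indicator_def)
    then show ?case by (simp only: integral_zero div_0)
  qed
  ultimately have "((\<lambda>_. 0) \<longlongrightarrow> (\<integral>\<omega>. ?f (\<lambda>k. \<Theta> k \<omega>) \<partial>Q)) (at_top :: real filter)"
    using tendsto_cong by fast
  then have 0: "(\<integral>\<omega>. ?f (\<lambda>k. \<Theta> k \<omega>) \<partial>Q) = 0" by (simp add: tendsto_const_iff)
  have "integrable Q (\<lambda>\<omega>. ?f (\<lambda>k. \<Theta> k \<omega>))"
    by (rule Q.integrable_const_bound[where B=1]) auto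
  with 0 have "AE \<omega> in Q. ?f (\<lambda>k. \<Theta> k \<omega>) = 0"
    by (subst integral_nonneg_eq_0_iff_AE[symmetric]) auto
  then show ?thesis by eventually_elim (auto simp: min_def split: if_splits)
qed

text \<open>\<open>H\<close> factors as the norm at time 0 times \<open>H\<close> of the series
  divided by that norm. The bound by a multiple of the norm at time 0 keeps the second factor
  bounded and makes the factorization valid also where the norm is 0.\<close>

lemma spectral_limit:
  assumes st: "s \<le> t" and H: "homogeneous_on N {s..t} H" and C: "C \<ge> 0" "\<And>x. H x \<le> C * N (x 0)"
  shows "((\<lambda>x. prob {\<omega>\<in>space M. x < H (\<lambda>k. X k \<omega>)} / tail x) \<longlongrightarrow> (\<integral>\<omega>. H (\<lambda>k. \<Theta> k \<omega>) powr \<alpha> \<partial>Q)) at_top"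
proof -
  note HD = homogeneous_onD[OF H]
  note Hb = borel_measurable_homogeneous[OF H]
  let ?\<zeta> = "\<lambda>\<omega>. H (\<lambda>k. X k \<omega> /\<^sub>R N (X 0 \<omega>))"
  have [measurable]: "?\<zeta> \<in> borel_measurable M"
    by (rule measurable_compose[OF measurable_seq Hb]) measurable
  have [measurable]: "(\<lambda>\<omega>. H (\<lambda>k. \<Theta> k \<omega>)) \<in> borel_measurable Q"
    by (rule measurable_compose[OF measurable_seq Hb]) measurable
  have prod: "N (X 0 \<omega>) * ?\<zeta> \<omega> = H (\<lambda>k. X k \<omega>)" for \<omega>
  proof (cases "N (X 0 \<omega>) = 0")
    case True
    then show ?thesis using C(2)[of "\<lambda>k. X k \<omega>"] HD(2)[of "\<lambda>k. X k \<omega>"] by simp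
  next
    case False
    then have "N (X 0 \<omega>) > 0" using N_nonneg[of "X 0 \<omega>"] by simp
    then show ?thesis by (subst HD(4)[symmetric]) auto
  qed
  have "((\<lambda>x. prob {\<omega>\<in>space M. x < N (X 0 \<omega>) * ?\<zeta> \<omega>} / tail x) \<longlongrightarrow> (\<integral>\<omega>. H (\<lambda>k. \<Theta> k \<omega>) powr \<alpha> \<partial>Q)) at_top"
  proof (rule tail_product_limit[where C=C])
    show "prob_space M" "finite_measure Q" by unfold_locales
    show "0 \<le> ?\<zeta> \<omega> \<and> ?\<zeta> \<omega> \<le> C" for \<omega>
    proof -
      have "N (X 0 \<omega> /\<^sub>R N (X 0 \<omega>)) \<le> 1"
        using N_nonneg[of "X 0 \<omega>"] by (cases "N (X 0 \<omega>) = 0") (simp_all add: N_scale)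
      then have "C * N (X 0 \<omega> /\<^sub>R N (X 0 \<omega>)) \<le> C" using C(1) by (intro mult_left_le) auto
      then show ?thesis using C(2)[of "\<lambda>k. X k \<omega> /\<^sub>R N (X 0 \<omega>)"] HD(2) by auto
    qed
    show "AE \<omega> in Q. 0 \<le> H (\<lambda>k. \<Theta> k \<omega>) \<and> H (\<lambda>k. \<Theta> k \<omega>) \<le> C"
      using norm_spectral_0
    proof eventually_elim
      case (elim \<omega>)
      then show ?case using C(2)[of "\<lambda>k. \<Theta> k \<omega>"] HD(2)[of "\<lambda>k. \<Theta> k \<omega>"] by simp
    qed
    fix u :: real and \<phi> :: "real \<Rightarrow> real"
    assume u: "u > 0" and \<phi>: "continuous_on UNIV \<phi>" "\<And>s. 0 \<le> \<phi> s \<and> \<phi> s \<le> 1"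
    have "((\<lambda>x. (\<integral>\<omega>. \<phi> (?\<zeta> \<omega>) * indicator {\<omega>\<in>space M. x < N (X 0 \<omega>)} \<omega> \<partial>M) / tail x)
      \<longlongrightarrow> (\<integral>\<omega>. \<phi> (H (\<lambda>k. \<Theta> k \<omega>)) \<partial>Q)) at_top"
    proof (rule spectral_integral_limit[OF st])
      show "continuous_on UNIV (\<lambda>x. \<phi> (H x))" by (rule continuous_on_compose2[OF \<phi>(1) HD(1)]) simp
      show "\<phi> (H x) = \<phi> (H y)" if "\<And>k. k \<in> {s..t} \<Longrightarrow> x k = y k" for x y using HD(3)[OF that] by simp
    qed (use \<phi> in auto)
    moreover have "filterlim (\<lambda>x. u * x) at_top at_top"
      using u by (intro filterlim_tendsto_pos_mult_at_top[OF tendsto_const _ filterlim_ident]) auto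
    ultimately have "((\<lambda>x. (\<integral>\<omega>. \<phi> (?\<zeta> \<omega>) * indicator {\<omega>\<in>space M. u * x < N (X 0 \<omega>)} \<omega> \<partial>M) / tail (u * x))
      \<longlongrightarrow> (\<integral>\<omega>. \<phi> (H (\<lambda>k. \<Theta> k \<omega>)) \<partial>Q)) at_top"
      by (rule filterlim_compose)
    \<comment> \<open>The conditioning event and the denominator have the same level in the spectral
      limit; moving only the event to level \<open>u * x\<close> brings in the factor
      \<open>tail (u * x) / tail x\<close>.\<close>
    from tendsto_mult[OF tail_ratio[OF u] this]
    show "((\<lambda>x. (\<integral>\<omega>. \<phi> (?\<zeta> \<omega>) * indicator {\<omega>\<in>space M. u * x < N (X 0 \<omega>)} \<omega> \<partial>M) / tail x)
      \<longlongrightarrow> u powr (- \<alpha>) * (\<integral>\<omega>. \<phi> (H (\<lambda>k. \<Theta> k \<omega>)) \<partial>Q)) at_top"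
      using tail_pos by (simp add: less_imp_neq[symmetric])
  qed (use \<alpha>_pos tail_pos in auto)
  then show ?thesis unfolding prod .
qed

section \<open>Window masses and their counterpart over all integers\<close>

definition window :: "nat \<Rightarrow> nat \<Rightarrow> int set" where
  "window t m = {- int m..int t + int m}"

text \<open>The argument is \<open>H powr \<alpha>\<close> rather than \<open>H\<close>, because the
  mass is additive in the power; this also allows differences of such powers as arguments.\<close>

definition window_mass :: "nat \<Rightarrow> nat \<Rightarrow> ((int \<Rightarrow> 'v) \<Rightarrow> real) \<Rightarrow> ennreal" where
  "window_mass t m q = (\<Sum>l\<in>window t m. \<integral>\<^sup>+\<omega>. ennreal (q (\<lambda>k. \<Theta> (k - l) \<omega>) / window_sum (window t m) (\<lambda>k. \<Theta> (k - l) \<omega>)) \<partial>Q)"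

definition total :: "(int \<Rightarrow> 'v) \<Rightarrow> ennreal" where
  "total x = (\<integral>\<^sup>+k. ennreal (N (x k) powr \<alpha>) \<partial>count_space UNIV)"

text \<open>Formally the window mass for the window of all integers. The denominator carries no
  shift since \<open>total\<close> is shift invariant.\<close>

definition total_mass :: "((int \<Rightarrow> 'v) \<Rightarrow> real) \<Rightarrow> ennreal" where
  "total_mass q = (\<integral>\<^sup>+l. (\<integral>\<^sup>+\<omega>. ennreal (q (\<lambda>k. \<Theta> (k - l) \<omega>)) / total (\<lambda>k. \<Theta> k \<omega>) \<partial>Q) \<partial>count_space UNIV)"

text \<open>The part belonging to time \<open>l\<close>, shifted by \<open>l\<close>, is bounded by
  a multiple of the norm at time 0, so \<open>spectral_limit\<close> evaluates it; stationarity says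
  that the shift does not change its tail.\<close>

lemma tail_limit_window:
  assumes H: "homogeneous_on N {0..int t} H"
  shows "\<exists>c\<ge>0. ((\<lambda>x. prob {\<omega>\<in>space M. x < H (\<lambda>k. X k \<omega>)} / tail x) \<longlongrightarrow> c) at_top \<and>
    (\<forall>m. window_mass t m (\<lambda>x. H x powr \<alpha>) = ennreal c)"
proof -
  have ex: "\<exists>c\<ge>0. ((\<lambda>x. prob {\<omega>\<in>space M. x < H (\<lambda>k. X k \<omega>)} / tail x) \<longlongrightarrow> c) at_top \<and>
    window_mass t m (\<lambda>x. H x powr \<alpha>) = ennreal c" for m
  proof -
    let ?L = "window t m"
    let ?G = "\<lambda>l x. H x * component_weight ?L l x"
    have L: "{0..int t} \<subseteq> ?L" "finite ?L" "?L \<noteq> {}" by (auto simp: window_def)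
    obtain S \<kappa> where S: "prob_space S" "\<kappa> > (0::real)"
      and int: "\<And>H. homogeneous_on N ?L H \<Longrightarrow> integrable S (\<lambda>\<theta>. H \<theta> powr \<alpha>)"
      and lim: "\<And>H. homogeneous_on N ?L H \<Longrightarrow> ((\<lambda>x. prob {\<omega>\<in>space M. x < H (\<lambda>k. X k \<omega>)} / tail x)
        \<longlongrightarrow> (\<integral>\<theta>. H \<theta> powr \<alpha> \<partial>S) / \<kappa>) at_top"
      using tail_limit_linear[OF L(2,3)] by blast
    define c where "c = (\<integral>\<theta>. H \<theta> powr \<alpha> \<partial>S) / \<kappa>"
    have G: "homogeneous_on N ?L (?G l)" if "l \<in> ?L" for l
      by (rule homogeneous_weighted[OF H L(1,2) that])
    have term_eq: "(\<integral>\<theta>. ?G l \<theta> powr \<alpha> \<partial>S) / \<kappa> = (\<integral>\<omega>. ?G l (\<lambda>k. \<Theta> (k - l) \<omega>) powr \<alpha> \<partial>Q)"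
      and term_int: "integrable Q (\<lambda>\<omega>. ?G l (\<lambda>k. \<Theta> (k - l) \<omega>) powr \<alpha>)" if l: "l \<in> ?L" for l
    proof -
      let ?G' = "\<lambda>x. ?G l (\<lambda>k. x (k - l))"
      have hom: "homogeneous_on N {- int m - l..int t + int m - l} ?G'"
        using homogeneous_shift[OF G[OF l, unfolded window_def]] by (simp add: window_def)
      obtain C where C: "C \<ge> 0" "\<And>x. ?G l x \<le> C * N (x l)"
        using homogeneous_weighted(2)[OF H L(1,2) l] by blast
      have C': "?G' x \<le> C * N (x 0)" for x using C(2)[of "\<lambda>k. x (k - l)"] by simp
      have "((\<lambda>x. prob {\<omega>\<in>space M. x < ?G' (\<lambda>k. X k \<omega>)} / tail x) \<longlongrightarrow> (\<integral>\<omega>. ?G' (\<lambda>k. \<Theta> k \<omega>) powr \<alpha> \<partial>Q)) at_top"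
        by (rule spectral_limit[OF _ hom C(1) C']) simp
      moreover have "prob {\<omega>\<in>space M. x < ?G' (\<lambda>k. X k \<omega>)} = prob {\<omega>\<in>space M. x < ?G l (\<lambda>k. X k \<omega>)}" for x
        using prob_shift[OF G[OF l], of x "- l"] by simp
      ultimately have "((\<lambda>x. prob {\<omega>\<in>space M. x < ?G l (\<lambda>k. X k \<omega>)} / tail x) \<longlongrightarrow> (\<integral>\<omega>. ?G' (\<lambda>k. \<Theta> k \<omega>) powr \<alpha> \<partial>Q)) at_top"
        by simp
      then show "(\<integral>\<theta>. ?G l \<theta> powr \<alpha> \<partial>S) / \<kappa> = (\<integral>\<omega>. ?G l (\<lambda>k. \<Theta> (k - l) \<omega>) powr \<alpha> \<partial>Q)"
        using lim[OF G[OF l]] by (intro tendsto_unique[of at_top]) auto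
      show "integrable Q (\<lambda>\<omega>. ?G l (\<lambda>k. \<Theta> (k - l) \<omega>) powr \<alpha>)"
      proof (rule Q.integrable_const_bound[where B="C powr \<alpha>"])
        show "AE \<omega> in Q. norm (?G l (\<lambda>k. \<Theta> (k - l) \<omega>) powr \<alpha>) \<le> C powr \<alpha>"
          using norm_spectral_0
        proof eventually_elim
          case (elim \<omega>)
          then show ?case
            using C'[of "\<lambda>k. \<Theta> k \<omega>"] homogeneous_onD(2)[OF hom, of "\<lambda>k. \<Theta> k \<omega>"] \<alpha>_pos
            by (auto intro!: powr_mono2)
        qed
        show "(\<lambda>\<omega>. ?G l (\<lambda>k. \<Theta> (k - l) \<omega>) powr \<alpha>) \<in> borel_measurable Q"
          by (rule measurable_compose[OF measurable_compose[OF measurable_seq borel_measurable_homogeneous[OF G[OF l]]]]) measurable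
      qed
    qed
    \<comment> \<open>Additivity enters here: all parts are integrated against the same
      \<open>S\<close> and divided by the same \<open>\<kappa>\<close>.\<close>
    have "c = (\<Sum>l\<in>?L. (\<integral>\<theta>. ?G l \<theta> powr \<alpha> \<partial>S) / \<kappa>)"
      unfolding c_def sum_divide_distrib[symmetric]
      using int G by (subst Bochner_Integration.integral_sum[symmetric]) (auto simp: sum_weighted_powr[OF H L(1,2)])
    also have "\<dots> = (\<Sum>l\<in>?L. \<integral>\<omega>. ?G l (\<lambda>k. \<Theta> (k - l) \<omega>) powr \<alpha> \<partial>Q)"
      by (intro sum.cong refl term_eq)
    finally have c: "c = (\<Sum>l\<in>?L. \<integral>\<omega>. ?G l (\<lambda>k. \<Theta> (k - l) \<omega>) powr \<alpha> \<partial>Q)" .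
    have "ennreal c = (\<Sum>l\<in>?L. ennreal (\<integral>\<omega>. ?G l (\<lambda>k. \<Theta> (k - l) \<omega>) powr \<alpha> \<partial>Q))"
      unfolding c by (rule sum_ennreal[symmetric]) simp
    also have "\<dots> = window_mass t m (\<lambda>x. H x powr \<alpha>)"
      unfolding window_mass_def
    proof (rule sum.cong[OF refl])
      fix l assume l: "l \<in> ?L"
      have "ennreal (\<integral>\<omega>. ?G l (\<lambda>k. \<Theta> (k - l) \<omega>) powr \<alpha> \<partial>Q) = (\<integral>\<^sup>+\<omega>. ennreal (?G l (\<lambda>k. \<Theta> (k - l) \<omega>) powr \<alpha>) \<partial>Q)"
        using term_int[OF l] by (rule nn_integral_eq_integral[symmetric]) simp
      also have "\<dots> = (\<integral>\<^sup>+\<omega>. ennreal (H (\<lambda>k. \<Theta> (k - l) \<omega>) powr \<alpha> / window_sum ?L (\<lambda>k. \<Theta> (k - l) \<omega>)) \<partial>Q)"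
        using norm_spectral_0
        by (intro nn_integral_cong_AE) (auto simp: weighted_powr[OF H] elim!: eventually_mono)
      finally show "ennreal (\<integral>\<omega>. ?G l (\<lambda>k. \<Theta> (k - l) \<omega>) powr \<alpha> \<partial>Q) =
        (\<integral>\<^sup>+\<omega>. ennreal (H (\<lambda>k. \<Theta> (k - l) \<omega>) powr \<alpha> / window_sum ?L (\<lambda>k. \<Theta> (k - l) \<omega>)) \<partial>Q)" .
    qed
    finally have "window_mass t m (\<lambda>x. H x powr \<alpha>) = ennreal c" ..
    moreover have "c \<ge> 0" unfolding c_def using S by (intro divide_nonneg_pos integral_nonneg) auto
    moreover have "((\<lambda>x. prob {\<omega>\<in>space M. x < H (\<lambda>k. X k \<omega>)} / tail x) \<longlongrightarrow> c) at_top"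
      unfolding c_def by (rule lim[OF homogeneous_on_mono[OF H L(1,2)]])
    ultimately show ?thesis by blast
  qed
  obtain c where c: "c \<ge> 0" "((\<lambda>x. prob {\<omega>\<in>space M. x < H (\<lambda>k. X k \<omega>)} / tail x) \<longlongrightarrow> c) at_top"
    using ex[of 0] by blast
  \<comment> \<open>Each window has its own \<open>S\<close> and \<open>\<kappa>\<close>, but the
    tail ratio does not mention \<open>m\<close>, so all window masses agree.\<close>
  have "window_mass t m (\<lambda>x. H x powr \<alpha>) = ennreal c" for m
  proof -
    obtain c' where c': "((\<lambda>x. prob {\<omega>\<in>space M. x < H (\<lambda>k. X k \<omega>)} / tail x) \<longlongrightarrow> c') at_top"
      "window_mass t m (\<lambda>x. H x powr \<alpha>) = ennreal c'" using ex[of m] by blast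
    have "c' = c" by (rule tendsto_unique[OF _ c'(1) c(2)]) simp
    then show ?thesis using c' by simp
  qed
  with c show ?thesis by blast
qed

lemma measurable_spectral_shift:
  assumes "q \<in> borel_measurable borel"
  shows "(\<lambda>\<omega>. q (\<lambda>k. \<Theta> (k - l) \<omega>)) \<in> borel_measurable Q"
  by (rule measurable_compose[OF measurable_seq assms]) measurable

lemma window_sum_measurable [measurable]: "window_sum L \<in> borel_measurable borel"
proof -
  have [measurable]: "(\<lambda>x :: int \<Rightarrow> 'v. N (x k)) \<in> borel_measurable borel" for k
    by (rule borel_measurable_continuous_onI) (rule continuous_on_N_component)
  show ?thesis unfolding window_sum_def[abs_def] by measurable
qed

lemma nn_integral_window_SUP:
  fixes f :: "int \<Rightarrow> ennreal"
  shows "(\<integral>\<^sup>+l. f l \<partial>count_space UNIV) = (SUP m. \<Sum>l\<in>window t m. f l)"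
proof -
  have mono: "window t m \<subseteq> window t n" if "m \<le> n" for m n using that by (auto simp: window_def)
  have "f l = (SUP m. f l * indicator (window t m) l)" for l
  proof (rule antisym)
    have "l \<in> window t (nat \<bar>l\<bar>)" by (auto simp: window_def)
    then show "f l \<le> (SUP m. f l * indicator (window t m) l)"
      by (intro SUP_upper2[of "nat \<bar>l\<bar>"]) auto
  qed (auto intro!: SUP_least simp: indicator_def)
  then have "(\<integral>\<^sup>+l. f l \<partial>count_space UNIV) = (\<integral>\<^sup>+l. (SUP m. f l * indicator (window t m) l) \<partial>count_space UNIV)"
    by simp
  also have "\<dots> = (SUP m. \<integral>\<^sup>+l. f l * indicator (window t m) l \<partial>count_space UNIV)"
    using mono by (intro nn_integral_monotone_convergence_SUP)
      (auto simp: incseq_def le_fun_def indicator_def subset_iff)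
  also have "\<dots> = (SUP m. \<Sum>l\<in>window t m. f l)"
    by (intro SUP_cong refl) (subst nn_integral_indicator_finite, auto simp: window_def)
  finally show ?thesis .
qed

lemma total_measurable [measurable]: "total \<in> borel_measurable borel"
proof -
  have [measurable]: "(\<lambda>x :: int \<Rightarrow> 'v. N (x k)) \<in> borel_measurable borel" for k
    by (rule borel_measurable_continuous_onI) (rule continuous_on_N_component)
  show ?thesis unfolding total_def[abs_def] nn_integral_window_SUP[of _ 0] by measurable
qed

lemma total_shift: "total (\<lambda>k. x (k - l)) = total x"
  unfolding total_def
  by (rule nn_integral_bij_count_space[of "\<lambda>k. k - l" UNIV UNIV])
     (rule bij_betwI[of _ _ _ "\<lambda>k. k + l"], auto)

lemma window_sum_le_total:
  assumes "finite L"
  shows "ennreal (window_sum L x) \<le> total x"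
proof -
  have "ennreal (window_sum L x) = (\<Sum>k\<in>L. ennreal (N (x k) powr \<alpha>))"
    by (simp add: window_sum_def sum_ennreal)
  also have "\<dots> = (\<integral>\<^sup>+k. ennreal (N (x k) powr \<alpha>) * indicator L k \<partial>count_space UNIV)"
    using assms by (subst nn_integral_indicator_finite) auto
  also have "\<dots> \<le> total x" unfolding total_def by (intro nn_integral_mono) (auto simp: indicator_def)
  finally show ?thesis .
qed

text \<open>For each \<open>l\<close> the window sum in the denominator is at most
  \<open>total\<close>, so every finite partial sum of the total mass is below a window
  mass.\<close>

lemma total_mass_le:
  assumes q: "\<And>x. 0 \<le> q x" and le: "\<And>m. window_mass t m q \<le> c"
  shows "total_mass q \<le> c"
  unfolding total_mass_def nn_integral_window_SUP[of _ t]
proof (rule SUP_least)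
  fix m
  have "(\<Sum>l\<in>window t m. \<integral>\<^sup>+\<omega>. ennreal (q (\<lambda>k. \<Theta> (k - l) \<omega>)) / total (\<lambda>k. \<Theta> k \<omega>) \<partial>Q) \<le> window_mass t m q"
    unfolding window_mass_def
  proof (rule sum_mono, rule nn_integral_mono_AE)
    fix l assume l: "l \<in> window t m"
    show "AE \<omega> in Q. ennreal (q (\<lambda>k. \<Theta> (k - l) \<omega>)) / total (\<lambda>k. \<Theta> k \<omega>)
      \<le> ennreal (q (\<lambda>k. \<Theta> (k - l) \<omega>) / window_sum (window t m) (\<lambda>k. \<Theta> (k - l) \<omega>))"
      using norm_spectral_0
    proof eventually_elim
      case (elim \<omega>)
      let ?x = "\<lambda>k. \<Theta> (k - l) \<omega>"
      \<comment> \<open>Coordinate \<open>l\<close> of the shifted sequence is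
        \<open>\<Theta> 0\<close>, of norm 1, so the real quotient is not a division by zero with
        value 0.\<close>
      have "N (?x l) \<le> window_sum (window t m) ?x powr (1 / \<alpha>)"
        by (rule component_le_window_sum[OF _ l]) (simp add: window_def)
      then have "window_sum (window t m) ?x \<noteq> 0" using elim by auto
      then have w: "window_sum (window t m) ?x > 0" using window_sum_nonneg[of "window t m" ?x] by linarith
      have "ennreal (window_sum (window t m) ?x) \<le> total ?x" by (rule window_sum_le_total) (simp add: window_def)
      then have "ennreal (window_sum (window t m) ?x) \<le> total (\<lambda>k. \<Theta> k \<omega>)" using total_shift[of "\<lambda>k. \<Theta> k \<omega>" l] by simp
      then show ?case using w q by (intro ennreal_divide_le_divide)
    qed
  qed
  then show "(\<Sum>l\<in>window t m. \<integral>\<^sup>+\<omega>. ennreal (q (\<lambda>k. \<Theta> (k - l) \<omega>)) / total (\<lambda>k. \<Theta> k \<omega>) \<partial>Q) \<le> c"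
    using le[of m] by (rule order_trans)
qed

lemma window_mass_add:
  assumes [measurable]: "q \<in> borel_measurable borel" "r \<in> borel_measurable borel"
    and "\<And>x. 0 \<le> q x" "\<And>x. 0 \<le> r x"
  shows "window_mass t m (\<lambda>x. q x + r x) = window_mass t m q + window_mass t m r"
proof -
  note [measurable] = measurable_spectral_shift[OF assms(1)] measurable_spectral_shift[OF assms(2)]
    measurable_spectral_shift[OF window_sum_measurable]
  show ?thesis
    unfolding window_mass_def sum.distrib[symmetric]
    using assms(3,4) window_sum_nonneg
    by (intro sum.cong refl, subst nn_integral_add[symmetric])
       (auto simp: add_divide_distrib ennreal_plus[symmetric] simp del: ennreal_plus)
qed

lemma total_mass_add:
  assumes [measurable]: "q \<in> borel_measurable borel" "r \<in> borel_measurable borel"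
    and "\<And>x. 0 \<le> q x" "\<And>x. 0 \<le> r x"
  shows "total_mass (\<lambda>x. q x + r x) = total_mass q + total_mass r"
proof -
  note [measurable] = measurable_spectral_shift[OF assms(1)] measurable_spectral_shift[OF assms(2)]
    measurable_spectral_shift[OF total_measurable, of 0, simplified]
  show ?thesis
    unfolding total_mass_def
    using assms(3,4)
    by (subst nn_integral_add[symmetric], simp, simp, intro nn_integral_cong, subst nn_integral_add[symmetric])
       (auto simp: add_divide_distrib_ennreal ennreal_plus)
qed

lemma window_mass_cmult:
  assumes "q \<in> borel_measurable borel" "c \<ge> 0"
  shows "window_mass t m (\<lambda>x. c * q x) = ennreal c * window_mass t m q"
proof -
  note [measurable] = measurable_spectral_shift[OF assms(1)] measurable_spectral_shift[OF window_sum_measurable]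
  show ?thesis
    unfolding window_mass_def sum_distrib_left
    using assms(2) by (intro sum.cong refl, subst nn_integral_cmult[symmetric]) (auto simp: ennreal_mult'[symmetric])
qed

lemma total_mass_cmult:
  assumes "q \<in> borel_measurable borel" "c \<ge> 0"
  shows "total_mass (\<lambda>x. c * q x) = ennreal c * total_mass q"
proof -
  note [measurable] = measurable_spectral_shift[OF assms(1)] measurable_spectral_shift[OF total_measurable, of 0, simplified]
  show ?thesis
    unfolding total_mass_def
    using assms(2) by (subst nn_integral_cmult[symmetric], simp, intro nn_integral_cong, subst nn_integral_cmult[symmetric])
      (auto simp: ennreal_mult' ennreal_times_divide)
qed

lemma component_powr_measurable: "(\<lambda>x :: int \<Rightarrow> 'v. N (x k) powr \<alpha>) \<in> borel_measurable borel"
proof -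
  have [measurable]: "(\<lambda>x :: int \<Rightarrow> 'v. N (x k)) \<in> borel_measurable borel"
    by (rule borel_measurable_continuous_onI) (rule continuous_on_N_component)
  show ?thesis by measurable
qed

text \<open>By stationarity the norm at time \<open>k\<close> has the tail of the norm at time 0, so
  the tail ratio is identically 1.\<close>

lemma window_mass_component:
  assumes "k \<in> {0..int t}"
  shows "window_mass t m (\<lambda>x. N (x k) powr \<alpha>) = 1"
proof -
  have hom: "homogeneous_on N {0..int t} (\<lambda>x. N (x k))"
    using homogeneous_component[of k "{0..int t}" 1] assms by simp
  have same: "prob {\<omega>\<in>space M. x < N (X k \<omega>)} = tail x" for x
    using prob_shift[OF homogeneous_component[of 0 "{0}" 1], of x k] by (simp add: tail_def)
  have lim: "((\<lambda>x. prob {\<omega>\<in>space M. x < N (X k \<omega>)} / tail x) \<longlongrightarrow> 1) at_top"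
    using tail_pos by (simp add: same less_imp_neq[symmetric])
  obtain c where c: "((\<lambda>x. prob {\<omega>\<in>space M. x < N (X k \<omega>)} / tail x) \<longlongrightarrow> c) at_top"
    "window_mass t m (\<lambda>x. N (x k) powr \<alpha>) = ennreal c"
    using tail_limit_window[OF hom] by auto
  have "c = 1" by (rule tendsto_unique[OF _ c(1) lim]) simp
  with c(2) show ?thesis by simp
qed

text \<open>After exchanging sum and integral, the numerators for fixed \<open>\<omega>\<close> run
  through all times and add up to \<open>total\<close>. The quotient is 1 because
  \<open>total\<close> is finite by assumption and at least 1 by its term at time 0.\<close>

lemma total_mass_component:
  assumes fin: "AE \<omega> in Q. total (\<lambda>k. \<Theta> k \<omega>) < \<infinity>"
  shows "total_mass (\<lambda>x. N (x k) powr \<alpha>) = 1"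
proof -
  note [measurable] = measurable_spectral_shift[OF component_powr_measurable]
    measurable_spectral_shift[OF total_measurable, of 0, simplified]
  have "total_mass (\<lambda>x. N (x k) powr \<alpha>) =
      (\<integral>\<^sup>+\<omega>. (\<integral>\<^sup>+l. ennreal (N (\<Theta> (k - l) \<omega>) powr \<alpha>) / total (\<lambda>k. \<Theta> k \<omega>) \<partial>count_space UNIV) \<partial>Q)"
    unfolding total_mass_def by (rule nn_integral_count_space_nn_integral[symmetric]) auto
  also have "\<dots> = (\<integral>\<^sup>+\<omega>. 1 \<partial>Q)"
  proof (rule nn_integral_cong_AE)
    show "AE \<omega> in Q. (\<integral>\<^sup>+l. ennreal (N (\<Theta> (k - l) \<omega>) powr \<alpha>) / total (\<lambda>k. \<Theta> k \<omega>) \<partial>count_space UNIV) = 1"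
      using fin norm_spectral_0
    proof eventually_elim
      case (elim \<omega>)
      have "(\<integral>\<^sup>+l. ennreal (N (\<Theta> (k - l) \<omega>) powr \<alpha>) / total (\<lambda>k. \<Theta> k \<omega>) \<partial>count_space UNIV)
          = (\<integral>\<^sup>+l. ennreal (N (\<Theta> (k - l) \<omega>) powr \<alpha>) \<partial>count_space UNIV) / total (\<lambda>k. \<Theta> k \<omega>)"
        by (rule nn_integral_divide) simp
      also have "(\<integral>\<^sup>+l. ennreal (N (\<Theta> (k - l) \<omega>) powr \<alpha>) \<partial>count_space UNIV) = total (\<lambda>k. \<Theta> k \<omega>)"
        unfolding total_def
        by (rule nn_integral_bij_count_space[of "\<lambda>l. k - l" UNIV UNIV "\<lambda>k. ennreal (N (\<Theta> k \<omega>) powr \<alpha>)"])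
           (rule bij_betwI[of _ _ _ "\<lambda>l. k - l"], auto)
      also have "total (\<lambda>k. \<Theta> k \<omega>) / total (\<lambda>k. \<Theta> k \<omega>) = 1"
      proof (rule ennreal_divide_self)
        have "ennreal 1 \<le> total (\<lambda>k. \<Theta> k \<omega>)"
          using window_sum_le_total[of "{0}" "\<lambda>k. \<Theta> k \<omega>"] elim by (simp add: window_sum_def)
        then show "total (\<lambda>k. \<Theta> k \<omega>) \<noteq> 0" by auto
      qed (use elim in auto)
      finally show ?case .
    qed
  qed
  also have "\<dots> = 1" using Q.emeasure_space_1 by simp
  finally show ?thesis .
qed

lemma mass_window_sum:
  assumes fin: "AE \<omega> in Q. total (\<lambda>k. \<Theta> k \<omega>) < \<infinity>" and K: "K \<subseteq> {0..int t}"
  shows "window_mass t m (window_sum K) = ennreal (real (card K))"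
    and "total_mass (window_sum K) = ennreal (real (card K))"
proof -
  have "finite K" using K by (rule finite_subset) simp
  then have "window_mass t m (window_sum K) = ennreal (real (card K)) \<and> total_mass (window_sum K) = ennreal (real (card K))"
    using K
  proof (induction K)
    case empty
    then show ?case by (simp add: window_mass_def total_mass_def window_sum_def[abs_def])
  next
    case (insert k K)
    have eq: "window_sum (insert k K) = (\<lambda>x. N (x k) powr \<alpha> + window_sum K x)"
      using insert by (auto simp: window_sum_def)
    have "ennreal (real (card (insert k K))) = 1 + ennreal (real (card K))"
    proof -
      have "ennreal (real (card (insert k K))) = ennreal (1 + real (card K))" using insert by simp
      also have "\<dots> = ennreal 1 + ennreal (real (card K))" by (rule ennreal_plus) auto
      finally show ?thesis by simp
    qed
    then show ?case
      unfolding eq using insert window_sum_nonneg component_powr_measurable window_sum_measurable fin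
      by (simp add: window_mass_add total_mass_add window_mass_component total_mass_component)
  qed
  then show "window_mass t m (window_sum K) = ennreal (real (card K))"
    and "total_mass (window_sum K) = ennreal (real (card K))" by auto
qed

text \<open>The inequality \<open>total_mass q \<le> c\<close> is termwise. For the sum of the powers of the component
  norms it is an equality; subtracting \<open>H\<^sup>\<alpha>\<close> from a multiple of that sum gives the converse.\<close>
lemma tail_limit_total:
  assumes fin: "AE \<omega> in Q. total (\<lambda>k. \<Theta> k \<omega>) < \<infinity>" and H: "homogeneous_on N {0..int t} H"
  shows "\<exists>c\<ge>0. ((\<lambda>x. prob {\<omega>\<in>space M. x < H (\<lambda>k. X k \<omega>)} / tail x) \<longlongrightarrow> c) at_top \<and>
    total_mass (\<lambda>x. H x powr \<alpha>) = ennreal c"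
proof -
  let ?J = "{0..int t}" and ?q = "\<lambda>x. H x powr \<alpha>"
  obtain c where c: "c \<ge> 0" "((\<lambda>x. prob {\<omega>\<in>space M. x < H (\<lambda>k. X k \<omega>)} / tail x) \<longlongrightarrow> c) at_top"
    "\<And>m. window_mass t m ?q = ennreal c"
    using tail_limit_window[OF H] by blast
  obtain C where C: "C \<ge> 0" "\<And>x. H x \<le> C * window_sum ?J x powr (1 / \<alpha>)"
    using homogeneous_powr_bound[OF H order_refl] by auto
  define D where "D = C powr \<alpha>"
  \<comment> \<open>\<open>D\<close> is chosen so that this complement of \<open>?q\<close> is
    nonnegative; the two together form a functional whose window mass and total mass are known to
    agree.\<close>
  let ?r = "\<lambda>x. D * window_sum ?J x - ?q x"
  have r: "0 \<le> ?r x" for x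
  proof -
    have "?q x \<le> (C * window_sum ?J x powr (1 / \<alpha>)) powr \<alpha>"
      using C(2)[of x] homogeneous_onD(2)[OF H, of x] \<alpha>_pos by (intro powr_mono2) auto
    also have "\<dots> = D * window_sum ?J x"
      using C(1) \<alpha>_pos window_sum_nonneg[of ?J x] by (simp add: D_def powr_mult powr_powr)
    finally show ?thesis by simp
  qed
  have [measurable]: "H \<in> borel_measurable borel" by (rule borel_measurable_homogeneous[OF H])
  have split: "(\<lambda>x. D * window_sum ?J x) = (\<lambda>x. ?q x + ?r x)" by auto
  define G where "G = D * real (card ?J)"
  have G: "G \<ge> 0" by (simp add: G_def D_def)
  have "window_mass t m (\<lambda>x. D * window_sum ?J x) = ennreal G" "total_mass (\<lambda>x. D * window_sum ?J x) = ennreal G" for m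
    using mass_window_sum[OF fin order_refl]
    by (simp_all add: window_mass_cmult total_mass_cmult window_sum_measurable G_def D_def ennreal_mult')
  note G_mass = this
  have [measurable]: "?q \<in> borel_measurable borel" by measurable
  have [measurable]: "?r \<in> borel_measurable borel" using window_sum_measurable[of ?J] by measurable
  have G_window: "ennreal c + window_mass t m ?r = ennreal G" for m
    unfolding G_mass(1)[of m, symmetric] c(3)[of m, symmetric] split
    by (rule window_mass_add[symmetric]) (use r in auto)
  have G_total: "total_mass ?q + total_mass ?r = ennreal G"
    unfolding G_mass(2)[symmetric] split
    by (rule total_mass_add[symmetric]) (use r in auto)
  have "c \<le> G"
    using G_window[of 0] c(1) G by (metis ennreal_le_iff le_iff_add)
  have wr: "window_mass t m ?r = ennreal (G - c)" for m
  proof -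
    have "window_mass t m ?r = ennreal G - ennreal c"
      using G_window[of m] by (metis ennreal_add_diff_cancel_left ennreal_neq_top infinity_ennreal_def)
    then show ?thesis using c(1) by (simp add: ennreal_minus)
  qed
  have q_le: "total_mass ?q \<le> ennreal c" using c(3) by (intro total_mass_le[of _ t]) auto
  have r_le: "total_mass ?r \<le> ennreal (G - c)" using wr r by (intro total_mass_le[of _ t]) auto
  obtain a where a: "total_mass ?q = ennreal a" "a \<ge> 0"
    using q_le by (cases "total_mass ?q") (auto simp: top_unique)
  obtain b where b: "total_mass ?r = ennreal b" "b \<ge> 0"
    using r_le by (cases "total_mass ?r") (auto simp: top_unique)
  \<comment> \<open>The masses of \<open>?q\<close> and \<open>?r\<close> are bounded by
    \<open>c\<close> and \<open>G - c\<close>, and their sum is exactly \<open>G\<close>, so neither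
    bound can be strict.\<close>
  have "a \<le> c" "b \<le> G - c" using q_le r_le a b c(1) \<open>c \<le> G\<close> by simp_all
  moreover have "a + b = G" using G_total a b G by (simp add: ennreal_plus[symmetric] del: ennreal_plus)
  ultimately have "a = c" by linarith
  with a c show ?thesis by blast
qed

end

section \<open>The Poisson process and maxima of i.i.d. copies\<close>

text \<open>The inserted 0 makes the functional nonnegative on sequences with negative components
  and gives the empty set of thresholds a value. Levels below 0 are never compared with it.\<close>

definition threshold_ratio :: "(int \<times> 'd \<times> real) set \<Rightarrow> (int \<Rightarrow> real^'d) \<Rightarrow> real" where
  "threshold_ratio F x = Max (insert 0 ((\<lambda>(k, j, c). x k $ j / c) ` F))"

lemma threshold_ratio_empty [simp]: "threshold_ratio {} x = 0"
  by (simp add: threshold_ratio_def)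

lemma threshold_ratio_insert:
  assumes "finite F"
  shows "threshold_ratio (insert (k, j, c) F) x = max (x k $ j / c) (threshold_ratio F x)"
  using assms by (simp add: threshold_ratio_def insert_commute[of 0])

lemma threshold_ratio_le_iff:
  assumes "finite F" "y \<ge> 0" "F \<subseteq> J \<times> UNIV \<times> {0<..}"
  shows "threshold_ratio F x \<le> y \<longleftrightarrow> (\<forall>(k, j, c)\<in>F. x k $ j \<le> c * y)"
proof -
  have "threshold_ratio F x \<le> y \<longleftrightarrow> (\<forall>(k, j, c)\<in>F. x k $ j / c \<le> y)"
    using assms(1,2) by (auto simp: threshold_ratio_def)
  also have "\<dots> \<longleftrightarrow> (\<forall>(k, j, c)\<in>F. x k $ j \<le> c * y)"
    using assms(3) by (intro ball_cong refl) (auto simp: divide_le_eq mult.commute)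
  finally show ?thesis .
qed

section \<open>Measurability of suprema, and auxiliary integrals\<close>

lemma component_measurable:
  "k \<in> J \<Longrightarrow> (\<lambda>x. x k $ j) \<in> borel_measurable (vecs J :: (int \<Rightarrow> real^'d) measure)"
  by (rule measurable_compose[OF measurable_component_singleton])
     (auto intro!: borel_measurable_continuous_onI continuous_intros)

lemma orthant_sets:
  fixes F :: "(int \<times> 'd::finite \<times> real) set" and g :: "real \<Rightarrow> real"
  assumes F: "finite F" "F \<subseteq> J \<times> UNIV \<times> {0<..}"
  shows "{x\<in>space (vecs J). \<forall>(k, j, c)\<in>F. x k $ j \<le> g c} \<in> sets (vecs J)"
proof (rule sets.sets_Collect_finite_All[OF _ F(1)])
  fix e assume "e \<in> F"
  then obtain k j c where e: "e = (k, j, c)" "k \<in> J" using F(2) by auto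
  have [measurable]: "(\<lambda>x. x k $ j) \<in> borel_measurable (vecs J :: (int \<Rightarrow> real^'d) measure)"
    by (rule component_measurable[OF e(2)])
  show "{x \<in> space (vecs J). case e of (k, j, c) \<Rightarrow> x k $ j \<le> g c} \<in> sets (vecs J)"
    unfolding e by simp
qed

lemma borel_measurable_vec_lambda:
  fixes f :: "'a \<Rightarrow> 'd::finite \<Rightarrow> real"
  assumes "\<And>j. (\<lambda>\<omega>. f \<omega> j) \<in> borel_measurable M"
  shows "(\<lambda>\<omega>. \<chi> j. f \<omega> j) \<in> borel_measurable M"
  by (subst borel_measurable_euclidean_space) (use assms in \<open>auto simp: Basis_vec_def inner_axis\<close>)

text \<open>The real supremum of an unbounded set is \<open>LEAST\<close> of a predicate that is
  constantly false, hence one fixed number. The function is therefore constant on the measurable set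
  where the family is unbounded, and an ordinary supremum elsewhere.\<close>

lemma borel_measurable_SUP_unbounded:
  fixes W :: "nat \<Rightarrow> 'a \<Rightarrow> real"
  assumes [measurable]: "\<And>i. W i \<in> borel_measurable M"
  shows "(\<lambda>\<omega>. SUP i. W i \<omega>) \<in> borel_measurable M"
proof -
  define B where "B \<omega> \<longleftrightarrow> (\<exists>n::nat. \<forall>i. W i \<omega> \<le> real n)" for \<omega>
  have [measurable]: "Measurable.pred M B" unfolding B_def[abs_def] by measurable
  have B: "B \<omega> \<longleftrightarrow> bdd_above (range (\<lambda>i. W i \<omega>))" for \<omega>
  proof
    assume "bdd_above (range (\<lambda>i. W i \<omega>))"
    then obtain y where y: "\<And>i. W i \<omega> \<le> y" by (auto simp: bdd_above_def)
    obtain n :: nat where "y \<le> real n" using real_arch_simple by blast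
    then show "B \<omega>" unfolding B_def using y order_trans by blast
  qed (auto simp: B_def bdd_above_def)
  define W' where "W' i \<omega> = (if B \<omega> then W i \<omega> else 0)" for i \<omega>
  have "(\<lambda>\<omega>. SUP i. W' i \<omega>) \<in> borel_measurable M"
  proof (rule borel_measurable_cSUP)
    show "W' i \<in> borel_measurable M" for i unfolding W'_def[abs_def] by measurable
    show "bdd_above (range (\<lambda>i. W' i \<omega>))" for \<omega>
      by (cases "B \<omega>") (auto simp: W'_def B[symmetric])
  qed simp
  then have "(\<lambda>\<omega>. if B \<omega> then SUP i. W' i \<omega> else (LEAST z::real. False)) \<in> borel_measurable M"
    by measurable
  moreover have "(SUP i. W i \<omega>) = (if B \<omega> then SUP i. W' i \<omega> else (LEAST z. False))" for \<omega>
  proof (cases "B \<omega>")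
    case False
    then have "(\<lambda>z. \<forall>x\<in>range (\<lambda>i. W i \<omega>). x \<le> z) = (\<lambda>z. False)"
      unfolding B by (auto simp: bdd_above_def fun_eq_iff)
    then show ?thesis using False by (simp add: Sup_real_def)
  qed (simp add: W'_def)
  ultimately show ?thesis by simp
qed

lemma nn_integral_power_density:
  assumes \<alpha>: "\<alpha> > 0" and h: "h \<ge> (0::real)"
  shows "(\<integral>\<^sup>+u. indicator {u. 1 < u * h} u \<partial>density (restrict_space lborel {0<..}) (\<lambda>u. ennreal (\<alpha> * u powr (- \<alpha> - 1))))
    = ennreal (h powr \<alpha>)"
proof (cases "h = 0")
  case True
  then show ?thesis using \<alpha> by simp
next
  case False
  then have h: "h > 0" using h by simp
  let ?f = "\<lambda>u. \<alpha> * u powr (- \<alpha> - 1)"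
  have "(\<integral>\<^sup>+u. indicator {u. 1 < u * h} u \<partial>density (restrict_space lborel {0<..}) (\<lambda>u. ennreal (?f u)))
      = (\<integral>\<^sup>+u. ennreal (?f u) * indicator {u. 1 < u * h} u \<partial>restrict_space lborel {0<..})"
    by (rule nn_integral_density) (auto intro!: measurable_restrict_space1)
  also have "\<dots> = (\<integral>\<^sup>+u. ennreal (?f u) * indicator {u. 1 < u * h} u * indicator {0<..} u \<partial>lborel)"
    by (rule nn_integral_restrict_space) simp
  \<comment> \<open>The fundamental theorem wants a closed half-line; adding the endpoint
    \<open>1 / h\<close> changes a null set only.\<close>
  also have "\<dots> = (\<integral>\<^sup>+u. ennreal (?f u) * indicator {1 / h..} u \<partial>lborel)"
  proof (rule nn_integral_cong_AE)
    show "AE u in lborel. ennreal (?f u) * indicator {u. 1 < u * h} u * indicator {0<..} u = ennreal (?f u) * indicator {1 / h..} u"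
      using AE_lborel_singleton[of "1 / h"]
    proof eventually_elim
      case (elim u)
      have "(1 < u * h \<and> 0 < u) \<longleftrightarrow> 1 / h \<le> u"
      proof -
        have "1 < u * h \<longleftrightarrow> 1 / h < u" using h by (simp add: pos_divide_less_eq)
        moreover have "0 < 1 / h" using h by simp
        ultimately show ?thesis using elim by linarith
      qed
      then show ?case by (auto simp: indicator_def)
    qed
  qed
  also have "\<dots> = ennreal (0 - (- ((1 / h) powr (- \<alpha>))))"
  proof (rule nn_integral_FTC_atLeast)
    fix u assume "1 / h \<le> u"
    then have u: "u > 0" using h by (smt (verit) divide_pos_pos)
    show "((\<lambda>u. - (u powr (- \<alpha>))) has_real_derivative ?f u) (at u)"
      using u by (auto intro!: derivative_eq_intros)
    show "0 \<le> ?f u" using \<alpha> by simp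
  next
    have "((\<lambda>u::real. u powr (- \<alpha>)) \<longlongrightarrow> 0) at_top"
      using \<alpha> by (intro tendsto_neg_powr filterlim_ident) auto
    from tendsto_minus[OF this] show "((\<lambda>u::real. - (u powr (- \<alpha>))) \<longlongrightarrow> 0) at_top" by simp
  qed measurable
  also have "0 - (- ((1 / h) powr (- \<alpha>))) = h powr \<alpha>"
    using h by (simp add: powr_minus powr_divide)
  finally show ?thesis .
qed

lemma tail_probability_tendsto_0:
  fixes Y :: "'a \<Rightarrow> real"
  assumes "prob_space M" and [measurable]: "Y \<in> borel_measurable M"
  shows "((\<lambda>x. measure M {\<omega>\<in>space M. x < Y \<omega>}) \<longlongrightarrow> 0) at_top"
proof -
  interpret prob_space M by fact
  have "(\<lambda>n. prob {\<omega>\<in>space M. real n < Y \<omega>}) \<longlonglongrightarrow> prob (\<Inter>n. {\<omega>\<in>space M. real n < Y \<omega>})"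
    by (rule finite_Lim_measure_decseq) (auto simp: decseq_def)
  moreover have "(\<Inter>n. {\<omega>\<in>space M. real n < Y \<omega>}) = {}"
  proof -
    have "\<exists>n::nat. \<not> real n < Y \<omega>" for \<omega> using real_arch_simple[of "Y \<omega>"] by (meson linorder_not_le)
    then show ?thesis by blast
  qed
  ultimately have lim: "(\<lambda>n. prob {\<omega>\<in>space M. real n < Y \<omega>}) \<longlonglongrightarrow> 0" by simp
  show ?thesis
  proof (rule tendstoI)
    fix e :: real assume "e > 0"
    from eventually_happens'[OF sequentially_bot order_tendstoD(2)[OF lim this]]
    obtain n :: nat where n: "prob {\<omega>\<in>space M. real n < Y \<omega>} < e" by blast
    show "eventually (\<lambda>x. dist (prob {\<omega>\<in>space M. x < Y \<omega>}) 0 < e) at_top"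
      using eventually_ge_at_top[of "real n"]
    proof eventually_elim
      case (elim x)
      have "prob {\<omega>\<in>space M. x < Y \<omega>} \<le> prob {\<omega>\<in>space M. real n < Y \<omega>}"
        using elim by (intro finite_measure_mono) auto
      then show ?case using n by (simp add: measure_nonneg)
    qed
  qed
qed

text \<open>Divergence is consistent in the first equation: \<open>infsum\<close> defaults to 0, and
  so does \<open>enn2real\<close> at infinity.\<close>

lemma infsum_eq_nn_integral:
  fixes f :: "'i \<Rightarrow> real"
  assumes "\<And>i. 0 \<le> f i"
  shows "infsum f UNIV = enn2real (\<integral>\<^sup>+i. ennreal (f i) \<partial>count_space UNIV)"
    and "f summable_on UNIV \<longleftrightarrow> (\<integral>\<^sup>+i. ennreal (f i) \<partial>count_space UNIV) < \<infinity>"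
proof -
  have n: "(\<lambda>i. norm (f i)) = f" using assms by auto
  have s: "f summable_on UNIV \<longleftrightarrow> integrable (count_space UNIV) f"
    using abs_summable_equivalent[of f UNIV] unfolding n abs_summable_on_def by simp
  also have "\<dots> \<longleftrightarrow> (\<integral>\<^sup>+i. ennreal (f i) \<partial>count_space UNIV) < \<infinity>"
    using assms by (simp add: integrable_iff_bounded)
  finally show s': "f summable_on UNIV \<longleftrightarrow> (\<integral>\<^sup>+i. ennreal (f i) \<partial>count_space UNIV) < \<infinity>" .
  show "infsum f UNIV = enn2real (\<integral>\<^sup>+i. ennreal (f i) \<partial>count_space UNIV)"
  proof (cases "f summable_on UNIV")
    case True
    then have "infsum f UNIV = (\<integral>i. f i \<partial>count_space UNIV)"
      using s infsetsum_infsum[of f UNIV] by (simp add: abs_summable_on_def infsetsum_def)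
    then show ?thesis using assms by (simp add: integral_eq_nn_integral)
  next
    case False
    then have "(\<integral>\<^sup>+i. ennreal (f i) \<partial>count_space UNIV) = \<infinity>" using s' by (simp add: less_top[symmetric])
    then show ?thesis using False by (simp add: infsum_not_exists)
  qed
qed

section \<open>Intensity of the points that exceed given thresholds\<close>

locale max_stable_series = spectral_series M N \<alpha> X Q \<Theta>
  for M :: "'a measure" and N :: "real^'d \<Rightarrow> real" and \<alpha> :: real and X :: "int \<Rightarrow> 'a \<Rightarrow> real^'d"
    and Q :: "'b measure" and \<Theta> :: "int \<Rightarrow> 'b \<Rightarrow> real^'d" +
  assumes \<Theta>_nonneg: "\<And>t \<omega> j. \<omega> \<in> space Q \<Longrightarrow> 0 \<le> \<Theta> t \<omega> $ j"
    and summable: "AE \<omega> in Q. (\<lambda>t. N (\<Theta> t \<omega>) powr \<alpha>) summable_on UNIV"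
begin

lemma total_finite: "AE \<omega> in Q. total (\<lambda>k. \<Theta> k \<omega>) < \<infinity>"
  using summable by eventually_elim (simp add: infsum_eq_nn_integral(2) total_def)

lemma alpha_norm_eq: "alpha_norm N \<alpha> x = enn2real (total x) powr (1 / \<alpha>)"
  by (simp add: alpha_norm_def total_def infsum_eq_nn_integral(1))

lemma alpha_norm_measurable [measurable]: "alpha_norm N \<alpha> \<in> borel_measurable borel"
  unfolding alpha_norm_eq[abs_def] by measurable

lemma alpha_norm_nonneg: "alpha_norm N \<alpha> x \<ge> 0"
  by (simp add: alpha_norm_eq)

lemma homogeneous_threshold_ratio:
  assumes "finite F" "F \<subseteq> J \<times> UNIV \<times> {0<..}" "finite J"
  shows "homogeneous_on N J (threshold_ratio F)"
proof -
  obtain a where a: "a > 0" "\<And>x. norm x \<le> a * N x" using norm_le_is_norm[OF norm_N] by blast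
  show ?thesis
    using assms(1,2)
  proof (induction F)
    case empty
    have "threshold_ratio {} = (\<lambda>_ :: int \<Rightarrow> real^'d. 0)" by auto
    then show ?case by (auto simp: homogeneous_on_def intro!: exI[of _ 0])
  next
    case (insert e F)
    obtain k j c where e: "e = (k, j, c)" by (cases e)
    then have c: "c > 0" "k \<in> J" using insert.prems by auto
    have F: "homogeneous_on N J (threshold_ratio F)" using insert by blast
    note FD = homogeneous_onD[OF F]
    obtain C where C: "C \<ge> 0" "\<And>x. threshold_ratio F x \<le> C * (\<Sum>k\<in>J. N (x k))" using FD(5) by blast
    have eq: "threshold_ratio (insert e F) = (\<lambda>x. max (x k $ j / c) (threshold_ratio F x))"
      using insert e by (auto simp: threshold_ratio_insert)
    have comp: "x k $ j / c \<le> (a / c) * (\<Sum>k\<in>J. N (x k))" for x :: "int \<Rightarrow> real^'d"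
    proof -
      have "x k $ j \<le> norm (x k)" using component_le_norm_cart[of "x k" j] by linarith
      also have "\<dots> \<le> a * N (x k)" by (rule a(2))
      also have "\<dots> \<le> a * (\<Sum>k\<in>J. N (x k))"
        using a(1) c assms(3) N_nonneg by (intro mult_left_mono member_le_sum) auto
      finally show ?thesis using c by (simp add: divide_right_mono)
    qed
    have S: "(\<Sum>k\<in>J. N (x k)) \<ge> 0" for x using N_nonneg by (simp add: sum_nonneg)
    show ?case
      unfolding eq homogeneous_on_def
    proof (intro conjI allI impI)
      show "continuous_on UNIV (\<lambda>x. max (x k $ j / c) (threshold_ratio F x))"
        using c by (intro continuous_intros FD(1)) auto
      show "0 \<le> max (x k $ j / c) (threshold_ratio F x)" for x using FD(2)[of x] by simp
      show "max (x k $ j / c) (threshold_ratio F x) = max (y k $ j / c) (threshold_ratio F y)"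
        if "\<forall>k\<in>J. x k = y k" for x y
        using FD(3)[of x y] that c(2) by simp
      show "max ((r *\<^sub>R x k) $ j / c) (threshold_ratio F (\<lambda>k. r *\<^sub>R x k)) = r * max (x k $ j / c) (threshold_ratio F x)"
        if "r > 0" for r x
        using FD(4)[OF that, of x] that by (simp add: max_mult_distrib_left)
      show "\<exists>C\<ge>0. \<forall>x. max (x k $ j / c) (threshold_ratio F x) \<le> C * (\<Sum>k\<in>J. N (x k))"
      proof (intro exI[of _ "max (a / c) C"] conjI allI)
        fix x
        have "(a / c) * (\<Sum>k\<in>J. N (x k)) \<le> max (a / c) C * (\<Sum>k\<in>J. N (x k))"
          "C * (\<Sum>k\<in>J. N (x k)) \<le> max (a / c) C * (\<Sum>k\<in>J. N (x k))"
          by (rule mult_right_mono[OF max.cobounded1 S], rule mult_right_mono[OF max.cobounded2 S])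
        then show "max (x k $ j / c) (threshold_ratio F x) \<le> max (a / c) C * (\<Sum>k\<in>J. N (x k))"
          using comp[of x] C(2)[of x] by linarith
      qed (use C(1) in simp)
    qed
  qed
qed

abbreviation points :: "(real \<times> int \<times> (int \<Rightarrow> real^'d)) measure" where
  "points \<equiv> intensity \<alpha> Q \<Theta>"

text \<open>The contribution of a point with this mark to the functional, per unit of its radius
  \<open>u\<close>.\<close>

definition rescaled :: "((int \<Rightarrow> real^'d) \<Rightarrow> real) \<Rightarrow> int \<times> (int \<Rightarrow> real^'d) \<Rightarrow> real" where
  "rescaled H = (\<lambda>(\<tau>, \<theta>). H (\<lambda>k. \<theta> (k + \<tau>)) / alpha_norm N \<alpha> \<theta>)"

abbreviation nonneg_seqs :: "(int \<Rightarrow> real^'d) measure" where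
  "nonneg_seqs \<equiv> Pi\<^sub>M UNIV (\<lambda>_. restrict_space borel {v. \<forall>j. 0 \<le> v $ j})"

abbreviation spectral_law :: "(int \<Rightarrow> real^'d) measure" where
  "spectral_law \<equiv> distr Q nonneg_seqs (\<lambda>\<omega> t. \<Theta> t \<omega>)"

abbreviation mark_law :: "(int \<times> (int \<Rightarrow> real^'d)) measure" where
  "mark_law \<equiv> count_space UNIV \<Otimes>\<^sub>M spectral_law"

abbreviation power_law :: "real measure" where
  "power_law \<equiv> density (restrict_space lborel {0<..}) (\<lambda>u. ennreal (\<alpha> * u powr (- \<alpha> - 1)))"

lemma nonneg_seqs_component: "(\<lambda>\<theta>. \<theta> k) \<in> borel_measurable nonneg_seqs"
proof (rule measurable_compose)
  show "(\<lambda>\<theta>. \<theta> k) \<in> measurable nonneg_seqs (restrict_space borel {v. \<forall>j. 0 \<le> v $ j})"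
    by (rule measurable_component_singleton) simp
  show "(\<lambda>v. v) \<in> borel_measurable (restrict_space borel {v :: real^'d. \<forall>j. 0 \<le> v $ j})"
    by (rule measurable_restrict_space1) simp
qed

lemma \<Theta>_seq_measurable: "(\<lambda>\<omega> t. \<Theta> t \<omega>) \<in> measurable Q nonneg_seqs"
  by (rule measurable_PiM_single') (auto intro!: measurable_restrict_space2 simp: \<Theta>_nonneg)

lemma rescaled_measurable:
  assumes [measurable]: "H \<in> borel_measurable borel"
  shows "rescaled H \<in> borel_measurable (count_space UNIV \<Otimes>\<^sub>M nonneg_seqs)"
proof -
  have 1: "(\<lambda>p. \<lambda>k. snd p (k + fst p)) \<in> measurable (count_space UNIV \<Otimes>\<^sub>M nonneg_seqs) borel"
  proof (rule measurable_seq)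
    fix k
    show "(\<lambda>p. snd p (k + fst p)) \<in> borel_measurable (count_space UNIV \<Otimes>\<^sub>M nonneg_seqs)"
      \<comment> \<open>The shift is itself a coordinate of the point; since it has countably many
        values, it can be treated as fixed.\<close>
      by (rule measurable_compose_countable[where f="\<lambda>\<tau> p. snd p (k + \<tau>)" and g=fst])
         (auto intro: measurable_compose[OF measurable_snd nonneg_seqs_component])
  qed
  have 2: "(\<lambda>p. snd p) \<in> measurable (count_space UNIV \<Otimes>\<^sub>M nonneg_seqs) borel"
    by (rule measurable_seq[where X="\<lambda>k p. snd p k"]) (rule measurable_compose[OF measurable_snd nonneg_seqs_component])
  show ?thesis
    unfolding rescaled_def split_beta'
    by (intro borel_measurable_divide measurable_compose[OF 1] measurable_compose[OF 2]) measurable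
qed

definition exceedances :: "((int \<Rightarrow> real^'d) \<Rightarrow> real) \<Rightarrow> (real \<times> int \<times> (int \<Rightarrow> real^'d)) set" where
  "exceedances H = {p\<in>space points. 1 < fst p * rescaled H (snd p)}"

lemma points_measurable:
  assumes "H \<in> borel_measurable borel"
  shows "(\<lambda>p. fst p * rescaled H (snd p)) \<in> borel_measurable points"
proof -
  have 1: "(\<lambda>p. fst p) \<in> borel_measurable points"
    unfolding intensity_def
    by (rule measurable_compose[OF measurable_fst]) (simp add: measurable_restrict_space1)
  have m: "rescaled H \<in> borel_measurable mark_law"
    using rescaled_measurable[OF assms] by (simp cong: measurable_cong_sets)
  have 2: "(\<lambda>p. rescaled H (snd p)) \<in> borel_measurable points"
    unfolding intensity_def by (rule measurable_compose[OF measurable_snd m])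
  from 1 2 show ?thesis by (rule borel_measurable_times)
qed

lemma sets_exceedances: "H \<in> borel_measurable borel \<Longrightarrow> exceedances H \<in> sets points"
  unfolding exceedances_def by (intro borel_measurable_less points_measurable) auto

text \<open>Integrating over the radius first gives the power \<open>\<alpha>\<close> of the
  rescaled functional, which turns the norm of the mark in the denominator into
  \<open>total\<close>. Points shift by \<open>+ \<tau>\<close> while \<open>total_mass\<close>
  shifts by \<open>- l\<close>, whence the final substitution \<open>l = - \<tau>\<close>.\<close>

lemma emeasure_exceedances:
  assumes [measurable]: "H \<in> borel_measurable borel" and H: "\<And>x. 0 \<le> H x"
  shows "emeasure points (exceedances H) = total_mass (\<lambda>x. H x powr \<alpha>)"
proof -
  interpret D: prob_space spectral_law
    by (rule prob_space.prob_space_distr[OF prob_Q \<Theta>_seq_measurable])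
  interpret L: sigma_finite_measure "restrict_space lborel {0<..} :: real measure"
    by (rule sigma_finite_measure_restrict_space) (auto intro: lborel.sigma_finite_measure_axioms)
  interpret P: sigma_finite_measure power_law
    by (subst L.sigma_finite_iff_density_finite) (auto intro!: measurable_restrict_space1)
  interpret Z: sigma_finite_measure "count_space (UNIV :: int set)"
    by (rule sigma_finite_measure_count_space)
  interpret ZD: pair_sigma_finite "count_space (UNIV :: int set)" spectral_law ..
  interpret PZD: pair_sigma_finite power_law mark_law ..
  have m: "rescaled H \<in> borel_measurable mark_law"
    using rescaled_measurable[of H] by (simp cong: measurable_cong_sets)
  have r: "rescaled H p \<ge> 0" for p using H alpha_norm_nonneg by (simp add: rescaled_def split_beta)
  have "emeasure points (exceedances H) = (\<integral>\<^sup>+p. emeasure power_law ((\<lambda>u. (u, p)) -` exceedances H) \<partial>mark_law)"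
    using sets_exceedances[of H] unfolding intensity_def by (intro PZD.emeasure_pair_measure_alt2) simp
  also have "\<dots> = (\<integral>\<^sup>+p. ennreal (rescaled H p powr \<alpha>) \<partial>mark_law)"
  proof (rule nn_integral_cong)
    fix p assume p: "p \<in> space mark_law"
    have eq: "(\<lambda>u. (u, p)) -` exceedances H = {u. 1 < u * rescaled H p} \<inter> space power_law"
      using p by (auto simp: exceedances_def intensity_def space_pair_measure)
    have s: "{u. 1 < u * rescaled H p} \<inter> space power_law \<in> sets power_law"
      unfolding eq[symmetric] using sets_exceedances[of H] unfolding intensity_def
      by (intro sets_Pair2) simp
    have "emeasure power_law ({u. 1 < u * rescaled H p} \<inter> space power_law)
       = (\<integral>\<^sup>+u. indicator ({u. 1 < u * rescaled H p} \<inter> space power_law) u \<partial>power_law)"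
      by (rule nn_integral_indicator[OF s, symmetric])
    also have "\<dots> = (\<integral>\<^sup>+u. indicator {u. 1 < u * rescaled H p} u \<partial>power_law)"
      by (rule nn_integral_cong) (simp add: indicator_def)
    finally show "emeasure power_law ((\<lambda>u. (u, p)) -` exceedances H) = ennreal (rescaled H p powr \<alpha>)"
      unfolding eq using nn_integral_power_density[OF \<alpha>_pos r[of p]] by simp
  qed
  also have "\<dots> = (\<integral>\<^sup>+\<tau>. \<integral>\<^sup>+\<theta>. ennreal (rescaled H (\<tau>, \<theta>) powr \<alpha>) \<partial>spectral_law \<partial>count_space UNIV)"
    using m by (intro D.nn_integral_fst[symmetric]) simp
  also have "\<dots> = (\<integral>\<^sup>+\<tau>. \<integral>\<^sup>+\<omega>. ennreal (H (\<lambda>k. \<Theta> (k + \<tau>) \<omega>) powr \<alpha>) / total (\<lambda>k. \<Theta> k \<omega>) \<partial>Q \<partial>count_space UNIV)"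
  proof (rule nn_integral_cong)
    fix \<tau> :: int
    have "(\<lambda>\<theta>. rescaled H (\<tau>, \<theta>)) \<in> borel_measurable nonneg_seqs"
      by (rule measurable_compose[OF measurable_Pair1' rescaled_measurable]) auto
    then have "(\<integral>\<^sup>+\<theta>. ennreal (rescaled H (\<tau>, \<theta>) powr \<alpha>) \<partial>spectral_law)
        = (\<integral>\<^sup>+\<omega>. ennreal (rescaled H (\<tau>, \<lambda>t. \<Theta> t \<omega>) powr \<alpha>) \<partial>Q)"
      by (intro nn_integral_distr[OF \<Theta>_seq_measurable]) measurable
    also have "\<dots> = (\<integral>\<^sup>+\<omega>. ennreal (H (\<lambda>k. \<Theta> (k + \<tau>) \<omega>) powr \<alpha>) / total (\<lambda>k. \<Theta> k \<omega>) \<partial>Q)"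
    proof (rule nn_integral_cong_AE)
      show "AE \<omega> in Q. ennreal (rescaled H (\<tau>, \<lambda>t. \<Theta> t \<omega>) powr \<alpha>) = ennreal (H (\<lambda>k. \<Theta> (k + \<tau>) \<omega>) powr \<alpha>) / total (\<lambda>k. \<Theta> k \<omega>)"
        using total_finite norm_spectral_0
      proof eventually_elim
        case (elim \<omega>)
        obtain T where T: "total (\<lambda>k. \<Theta> k \<omega>) = ennreal T" "T \<ge> 0"
          using elim by (cases "total (\<lambda>k. \<Theta> k \<omega>)") auto
        have "ennreal 1 \<le> total (\<lambda>k. \<Theta> k \<omega>)"
          using window_sum_le_total[of "{0}" "\<lambda>k. \<Theta> k \<omega>"] elim by (simp add: window_sum_def)
        then have "T \<ge> 1" using T by (metis ennreal_le_iff)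
        then show ?case
          using T H \<alpha>_pos by (simp add: rescaled_def alpha_norm_eq powr_divide powr_powr divide_ennreal)
      qed
    qed
    finally show "(\<integral>\<^sup>+\<theta>. ennreal (rescaled H (\<tau>, \<theta>) powr \<alpha>) \<partial>spectral_law)
      = (\<integral>\<^sup>+\<omega>. ennreal (H (\<lambda>k. \<Theta> (k + \<tau>) \<omega>) powr \<alpha>) / total (\<lambda>k. \<Theta> k \<omega>) \<partial>Q)" .
  qed
  also have "\<dots> = total_mass (\<lambda>x. H x powr \<alpha>)"
    unfolding total_mass_def
    using nn_integral_bij_count_space[of uminus UNIV UNIV
       "\<lambda>l. \<integral>\<^sup>+\<omega>. ennreal (H (\<lambda>k. \<Theta> (k - l) \<omega>) powr \<alpha>) / total (\<lambda>k. \<Theta> k \<omega>) \<partial>Q"]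
    by (simp add: bij_uminus)
  finally show ?thesis .
qed

lemma rescaled_threshold_ratio_le_iff:
  assumes F: "finite F" "F \<subseteq> J \<times> UNIV \<times> {0<..}" and u: "u > 0"
  shows "u * rescaled (threshold_ratio F) (\<tau>, \<theta>) \<le> 1 \<longleftrightarrow>
    (\<forall>(k, j, c)\<in>F. u * (\<theta> (k + \<tau>) $ j / alpha_norm N \<alpha> \<theta>) \<le> c)"
proof (cases "alpha_norm N \<alpha> \<theta> = 0")
  \<comment> \<open>All quotients by the norm are 0 here, and every threshold is positive, so both
    sides hold.\<close>
  case True
  then show ?thesis using F by (auto simp: rescaled_def dest!: subsetD)
next
  case False
  define a where "a = alpha_norm N \<alpha> \<theta>"
  have a: "a > 0" using False alpha_norm_nonneg[of \<theta>] by (simp add: a_def)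
  have iff: "u * (v / a) \<le> c \<longleftrightarrow> v \<le> c * (a / u)" for v c using a u by (simp add: field_simps)
  have "u * rescaled (threshold_ratio F) (\<tau>, \<theta>) \<le> 1 \<longleftrightarrow> threshold_ratio F (\<lambda>k. \<theta> (k + \<tau>)) \<le> a / u"
    using iff[of _ 1] by (simp add: rescaled_def a_def[symmetric])
  also have "\<dots> \<longleftrightarrow> (\<forall>(k, j, c)\<in>F. \<theta> (k + \<tau>) $ j \<le> c * (a / u))"
    using a u by (intro threshold_ratio_le_iff[OF F(1) _ F(2)]) simp
  finally show ?thesis unfolding a_def[symmetric] iff .
qed

section \<open>The law of the limit vector on orthants\<close>

context
  fixes P :: "'c measure" and U :: "nat \<Rightarrow> 'c \<Rightarrow> real" and T :: "nat \<Rightarrow> 'c \<Rightarrow> int"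
    and \<Xi> :: "nat \<Rightarrow> 'c \<Rightarrow> int \<Rightarrow> real^'d"
  assumes poisson: "poisson_points P points (\<lambda>i \<omega>. (U i \<omega>, T i \<omega>, \<Xi> i \<omega>))"
begin

interpretation P: prob_space P
  using poisson unfolding poisson_points_def by blast

lemma mark_measurable: "(\<lambda>\<omega>. (U i \<omega>, T i \<omega>, \<Xi> i \<omega>)) \<in> measurable P points"
  using poisson unfolding poisson_points_def by blast

lemma mark_nonneg:
  assumes "\<omega> \<in> space P"
  shows "U i \<omega> > 0" "0 \<le> \<Xi> i \<omega> k $ j"
  using measurable_space[OF mark_measurable[of i] assms]
  by (auto simp: intensity_def space_pair_measure space_PiM space_restrict_space)

definition ray :: "int \<Rightarrow> 'd \<Rightarrow> nat \<Rightarrow> 'c \<Rightarrow> real" where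
  "ray k j i \<omega> = U i \<omega> * (\<Xi> i \<omega> (k + T i \<omega>) $ j / alpha_norm N \<alpha> (\<Xi> i \<omega>))"

lemma ray_measurable [measurable]: "ray k j i \<in> borel_measurable P"
proof -
  have "(\<lambda>x :: int \<Rightarrow> real^'d. x k $ j) \<in> borel_measurable borel"
    by (intro borel_measurable_continuous_onI continuous_intros) auto
  from measurable_compose[OF mark_measurable points_measurable[OF this], of i]
  show ?thesis by (simp add: ray_def[abs_def] rescaled_def)
qed

lemma ray_nonneg: "\<omega> \<in> space P \<Longrightarrow> 0 \<le> ray k j i \<omega>"
  using mark_nonneg alpha_norm_nonneg by (simp add: ray_def less_imp_le)

text \<open>The event says that no point lies in the exceedance set, which is the Poisson
  probability of the count 0. Inside the set, \<open>c\<close> is a threshold bound by the pattern;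
  outside, it is the intensity of the exceedance set.\<close>

lemma void_probability:
  assumes F: "finite F" "F \<subseteq> J \<times> UNIV \<times> {0<..}" "finite J"
    and c: "c \<ge> 0" "total_mass (\<lambda>x. threshold_ratio F x powr \<alpha>) = ennreal c"
  shows "measure P {\<omega>\<in>space P. \<forall>i. \<forall>(k, j, c)\<in>F. ray k j i \<omega> \<le> c} = exp (- c)"
proof -
  note hom = homogeneous_threshold_ratio[OF F]
  let ?A = "exceedances (threshold_ratio F)"
  have A: "?A \<in> sets points" by (rule sets_exceedances[OF borel_measurable_homogeneous[OF hom]])
  have e: "emeasure points ?A = ennreal c"
    unfolding emeasure_exceedances[OF borel_measurable_homogeneous[OF hom] homogeneous_onD(2)[OF hom]] by (rule c(2))
  then have m: "measure points ?A = c" using c(1) by (simp add: measure_def)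
  have "measure P {\<omega>\<in>space P. count_points (\<lambda>i \<omega>. (U i \<omega>, T i \<omega>, \<Xi> i \<omega>)) ?A \<omega> = of_nat 0}
      = measure points ?A ^ 0 / fact 0 * exp (- measure points ?A)"
    by (rule poisson[unfolded poisson_points_def, THEN conjunct2, THEN conjunct2, THEN conjunct1, rule_format, OF A])
       (simp add: e)
  moreover have "{\<omega>\<in>space P. count_points (\<lambda>i \<omega>. (U i \<omega>, T i \<omega>, \<Xi> i \<omega>)) ?A \<omega> = of_nat 0}
      = {\<omega>\<in>space P. \<forall>i. \<forall>(k, j, c)\<in>F. ray k j i \<omega> \<le> c}"
  proof (intro Collect_cong conj_cong refl)
    fix \<omega> assume \<omega>: "\<omega> \<in> space P"
    have "count_points (\<lambda>i \<omega>. (U i \<omega>, T i \<omega>, \<Xi> i \<omega>)) ?A \<omega> = of_nat 0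
        \<longleftrightarrow> (\<forall>i. (U i \<omega>, T i \<omega>, \<Xi> i \<omega>) \<notin> ?A)"
      unfolding count_points_def of_nat_0 by (simp add: emeasure_count_space_eq_0)
    also have "\<dots> \<longleftrightarrow> (\<forall>i. U i \<omega> * rescaled (threshold_ratio F) (T i \<omega>, \<Xi> i \<omega>) \<le> 1)"
      using measurable_space[OF mark_measurable \<omega>] by (simp add: exceedances_def not_less)
    also have "\<dots> \<longleftrightarrow> (\<forall>i. \<forall>(k, j, c)\<in>F. ray k j i \<omega> \<le> c)"
      unfolding rescaled_threshold_ratio_le_iff[OF F(1,2) mark_nonneg(1)[OF \<omega>]] ray_def ..
    finally show "count_points (\<lambda>i \<omega>. (U i \<omega>, T i \<omega>, \<Xi> i \<omega>)) ?A \<omega> = of_nat 0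
        \<longleftrightarrow> (\<forall>i. \<forall>(k, j, c)\<in>F. ray k j i \<omega> \<le> c)" .
  qed
  ultimately show ?thesis by (simp add: m)
qed

text \<open>Needed because the real supremum is meaningful only for bounded families. For the single
  threshold \<open>n + 1\<close> the intensity is \<open>(n + 1) powr (- \<alpha>)\<close> times a
  finite constant, so the void probabilities tend to 1.\<close>

lemma rays_bounded: "AE \<omega> in P. bdd_above (range (\<lambda>i. ray (int k) j i \<omega>))"
proof -
  let ?F = "\<lambda>n. {(int k, j, real (Suc n))}" and ?J = "{0..int k}"
  have F: "finite (?F n)" "?F n \<subseteq> ?J \<times> UNIV \<times> {0<..}" "finite ?J" for n by auto
  have hom: "homogeneous_on N ?J (threshold_ratio (?F n))" for n
    by (rule homogeneous_threshold_ratio[OF F])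
  obtain c where c: "c \<ge> 0" "total_mass (\<lambda>x. threshold_ratio (?F 0) x powr \<alpha>) = ennreal c"
    using tail_limit_total[OF total_finite hom] by blast
  have ratio: "threshold_ratio (?F n) x = (1 / real (Suc n)) * threshold_ratio (?F 0) x" for n x
  proof -
    have "max (x (int k) $ j / real (Suc n)) 0 = (1 / real (Suc n)) * max (x (int k) $ j / 1) 0"
      by (subst max_mult_distrib_left) auto
    then show ?thesis using threshold_ratio_insert[of "{}" "int k" j] by simp
  qed
  have "threshold_ratio (?F n) x powr \<alpha> = (1 / real (Suc n)) powr \<alpha> * threshold_ratio (?F 0) x powr \<alpha>" for n x
    unfolding ratio[of n x] by (rule powr_mult)
  moreover have "(\<lambda>x. threshold_ratio (?F 0) x powr \<alpha>) \<in> borel_measurable borel"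
    using borel_measurable_homogeneous[OF hom[of 0]] by measurable
  ultimately have "total_mass (\<lambda>x. threshold_ratio (?F n) x powr \<alpha>) = ennreal ((1 / real (Suc n)) powr \<alpha> * c)" for n
    using c by (simp add: total_mass_cmult ennreal_mult')
  then have "measure P {\<omega>\<in>space P. \<forall>i. \<forall>(k, j, c)\<in>?F n. ray k j i \<omega> \<le> c} = exp (- ((1 / real (Suc n)) powr \<alpha> * c))" for n
    using c(1) by (intro void_probability[OF F]) auto
  then have p: "measure P {\<omega>\<in>space P. \<forall>i. ray (int k) j i \<omega> \<le> real (Suc n)} = exp (- ((1 / real (Suc n)) powr \<alpha> * c))" for n
    by simp
  let ?B = "{\<omega>\<in>space P. \<exists>n::nat. \<forall>i. ray (int k) j i \<omega> \<le> real n}"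
  have B: "?B \<in> sets P" by measurable
  have "1 \<le> measure P ?B"
  proof (rule LIMSEQ_le_const2)
    have "(\<lambda>n. (1 / real (Suc n)) powr \<alpha>) \<longlonglongrightarrow> 0 powr \<alpha>"
      using \<alpha>_pos by (intro tendsto_powr' LIMSEQ_Suc[OF lim_1_over_n] tendsto_const) auto
    from tendsto_exp[OF tendsto_minus[OF tendsto_mult_right[OF this, of c]]] \<alpha>_pos
    show "(\<lambda>n. exp (- ((1 / real (Suc n)) powr \<alpha> * c))) \<longlonglongrightarrow> 1" by simp
    show "\<exists>N. \<forall>n\<ge>N. exp (- ((1 / real (Suc n)) powr \<alpha> * c)) \<le> measure P ?B"
      unfolding p[symmetric] by (intro exI allI impI P.finite_measure_mono B) blast
  qed
  then have "measure P ?B = 1" using P.prob_le_1[of ?B] by linarith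
  then have "AE \<omega> in P. \<omega> \<in> ?B" using B by (simp add: P.prob_eq_1)
  then show ?thesis by eventually_elim (auto simp: bdd_above_def)
qed

lemma max_stable_limit_component: "max_stable_limit N \<alpha> U T \<Xi> k \<omega> $ j = (SUP i. ray k j i \<omega>)"
  by (simp add: max_stable_limit_def ray_def)

lemma max_stable_limit_measurable: "max_stable_limit N \<alpha> U T \<Xi> k \<in> borel_measurable P"
proof -
  have "(\<lambda>\<omega>. \<chi> j. SUP i. ray k j i \<omega>) \<in> borel_measurable P"
    by (intro borel_measurable_vec_lambda borel_measurable_SUP_unbounded) measurable
  then show ?thesis by (simp add: max_stable_limit_def[abs_def] ray_def)
qed

lemma max_stable_limit_nonneg: "AE \<omega> in P. 0 \<le> max_stable_limit N \<alpha> U T \<Xi> (int k) \<omega> $ j"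
  using rays_bounded[of k j] AE_space
proof eventually_elim
  case (elim \<omega>)
  have "ray (int k) j 0 \<omega> \<le> (SUP i. ray (int k) j i \<omega>)" by (rule cSUP_upper[OF _ elim(1)]) simp
  then show ?case
    unfolding max_stable_limit_component by (rule order_trans[OF ray_nonneg[OF elim(2)]])
qed

text \<open>The link between the two processes: the exponent in the law of the limit is the tail
  limit of the series. Bounding the supremum is bounding every ray only if the rays are bounded, so
  the events agree almost surely.\<close>

lemma orthant_probability:
  assumes F: "finite F" "F \<subseteq> {0..int t} \<times> UNIV \<times> {0<..}"
  shows "\<exists>c. ((\<lambda>x. prob {\<omega>\<in>space M. x < threshold_ratio F (\<lambda>k. X k \<omega>)} / tail x) \<longlongrightarrow> c) at_top \<and>
    measure P {\<omega>\<in>space P. \<forall>(k, j, c)\<in>F. max_stable_limit N \<alpha> U T \<Xi> k \<omega> $ j \<le> c} = exp (- c)"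
proof -
  have hom: "homogeneous_on N {0..int t} (threshold_ratio F)"
    by (rule homogeneous_threshold_ratio[OF F]) simp
  obtain c where c: "c \<ge> 0" "((\<lambda>x. prob {\<omega>\<in>space M. x < threshold_ratio F (\<lambda>k. X k \<omega>)} / tail x) \<longlongrightarrow> c) at_top"
    "total_mass (\<lambda>x. threshold_ratio F x powr \<alpha>) = ennreal c"
    using tail_limit_total[OF total_finite hom] by blast
  have "AE \<omega> in P. \<forall>k\<in>{0..t}. \<forall>j. bdd_above (range (\<lambda>i. ray (int k) j i \<omega>))"
    using rays_bounded by (simp add: AE_ball_countable AE_all_countable)
  then have "AE \<omega> in P. (\<forall>(k, j, c)\<in>F. max_stable_limit N \<alpha> U T \<Xi> k \<omega> $ j \<le> c) \<longleftrightarrow> (\<forall>i. \<forall>(k, j, c)\<in>F. ray k j i \<omega> \<le> c)"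
  proof eventually_elim
    case (elim \<omega>)
    have "max_stable_limit N \<alpha> U T \<Xi> k \<omega> $ j \<le> c \<longleftrightarrow> (\<forall>i. ray k j i \<omega> \<le> c)" if "(k, j, c) \<in> F" for k j c
    proof -
      have "0 \<le> k" "k \<le> int t" using that F(2) by auto
      then have "0 \<le> k" "nat k \<in> {0..t}" by auto
      then have "bdd_above (range (\<lambda>i. ray k j i \<omega>))" using elim by (metis int_nat_eq)
      then show ?thesis unfolding max_stable_limit_component by (subst cSUP_le_iff) auto
    qed
    then show ?case by fast
  qed
  moreover have "{\<omega>\<in>space P. \<forall>(k, j, c)\<in>F. max_stable_limit N \<alpha> U T \<Xi> k \<omega> $ j \<le> c} \<in> sets P"
  proof (rule sets.sets_Collect_finite_All[OF _ F(1)])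
    fix e assume "e \<in> F"
    obtain k j c where e: "e = (k, j, c)" by (cases e)
    have "(\<lambda>\<omega>. max_stable_limit N \<alpha> U T \<Xi> k \<omega> $ j) \<in> borel_measurable P"
      unfolding max_stable_limit_component by (rule borel_measurable_SUP_unbounded) measurable
    then show "{\<omega>\<in>space P. case e of (k, j, c) \<Rightarrow> max_stable_limit N \<alpha> U T \<Xi> k \<omega> $ j \<le> c} \<in> sets P"
      unfolding e by simp
  qed
  moreover have "{\<omega>\<in>space P. \<forall>i. \<forall>(k, j, c)\<in>F. ray k j i \<omega> \<le> c} \<in> sets P"
  proof (rule sets.sets_Collect_countable_All, rule sets.sets_Collect_finite_All[OF _ F(1)])
    fix i e assume "e \<in> F"
    obtain k j c where e: "e = (k, j, c)" by (cases e)
    show "{\<omega>\<in>space P. case e of (k, j, c) \<Rightarrow> ray k j i \<omega> \<le> c} \<in> sets P" unfolding e by simp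
  qed
  ultimately have "measure P {\<omega>\<in>space P. \<forall>(k, j, c)\<in>F. max_stable_limit N \<alpha> U T \<Xi> k \<omega> $ j \<le> c}
      = measure P {\<omega>\<in>space P. \<forall>i. \<forall>(k, j, c)\<in>F. ray k j i \<omega> \<le> c}"
    by (intro measure_eq_AE) auto
  also have "\<dots> = exp (- c)" by (rule void_probability[OF F _ c(1,3)]) simp
  finally show ?thesis using c(2) by blast
qed

end

section \<open>Maxima of i.i.d. copies and the weak limit\<close>

lemma iid_law:
  assumes iid: "iid_copies R Y J M X" and i: "i \<ge> 1" and B: "B \<in> sets (vecs J)"
  shows "measure R (Y i -` B \<inter> space R) = prob {\<omega>\<in>space M. (\<lambda>k\<in>J. X k \<omega>) \<in> B}"
proof -
  have pR: "prob_space R" and ind: "prob_space.indep_vars R (\<lambda>_. vecs J) Y {1..}"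
    and d: "distr R (vecs J) (Y i) = distr M (vecs J) (\<lambda>\<omega>. \<lambda>k\<in>J. X k \<omega>)"
    using iid i unfolding iid_copies_def by auto
  have Y: "Y i \<in> measurable R (vecs J)"
    using ind i unfolding prob_space.indep_vars_def2[OF pR] by simp
  have X': "(\<lambda>\<omega>. \<lambda>k\<in>J. X k \<omega>) \<in> measurable M (vecs J)" by (rule measurable_restrict) simp
  have "measure R (Y i -` B \<inter> space R) = measure (distr R (vecs J) (Y i)) B"
    by (rule measure_distr[OF Y B, symmetric])
  also have "\<dots> = prob ((\<lambda>\<omega>. \<lambda>k\<in>J. X k \<omega>) -` B \<inter> space M)"
    unfolding d by (rule measure_distr[OF X' B])
  also have "(\<lambda>\<omega>. \<lambda>k\<in>J. X k \<omega>) -` B \<inter> space M = {\<omega>\<in>space M. (\<lambda>k\<in>J. X k \<omega>) \<in> B}" by auto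
  finally show ?thesis .
qed

text \<open>All maxima stay below their thresholds iff each of the \<open>n\<close> copies lies in
  the orthant scaled by \<open>b\<close>, and independence gives the power. As \<open>b > 0\<close>,
  the cut at 0 in \<open>threshold_ratio\<close> does not alter that orthant.\<close>

lemma max_iid_probability:
  assumes iid: "iid_copies R Y J M X" and J: "finite J" and n: "n \<ge> 1" and b: "b > 0"
    and F: "finite F" "F \<subseteq> J \<times> UNIV \<times> {0<..}"
  shows "measure R {\<omega>\<in>space R. \<forall>(k, j, c)\<in>F. (MAX i\<in>{1..n}. Y i \<omega> k $ j / b) \<le> c}
    = (1 - prob {\<omega>\<in>space M. b < threshold_ratio F (\<lambda>k. X k \<omega>)}) ^ n"
proof -
  have pR: "prob_space R" and ind: "prob_space.indep_vars R (\<lambda>_. vecs J) Y {1..}"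
    using iid unfolding iid_copies_def by auto
  interpret R: prob_space R by fact
  have Y: "Y i \<in> measurable R (vecs J)" if "i \<ge> 1" for i
    using ind that unfolding R.indep_vars_def2 by simp
  define B where "B = {x\<in>space (vecs J). \<forall>(k, j, c)\<in>F. x k $ j \<le> c * b}"
  have B: "B \<in> sets (vecs J)" unfolding B_def by (rule orthant_sets[OF F])
  have hom: "homogeneous_on N J (threshold_ratio F)" by (rule homogeneous_threshold_ratio[OF F J])
  note [measurable] = homogeneous_measurable[OF hom]
  have "{\<omega>\<in>space R. \<forall>(k, j, c)\<in>F. (MAX i\<in>{1..n}. Y i \<omega> k $ j / b) \<le> c} = (\<Inter>i\<in>{1..n}. Y i -` B \<inter> space R)"
  proof -
    have "(MAX i\<in>{1..n}. Y i \<omega> k $ j / b) \<le> c \<longleftrightarrow> (\<forall>i\<in>{1..n}. Y i \<omega> k $ j \<le> c * b)" for \<omega> k j c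
      using n b by (subst Max_le_iff) (auto simp: divide_le_eq)
    then show ?thesis using n measurable_space[OF Y] by (fastforce simp: B_def)
  qed
  also have "measure R \<dots> = (\<Prod>i\<in>{1..n}. measure R (Y i -` B \<inter> space R))"
    using ind n B unfolding R.indep_vars_def2
    by (intro R.indep_setsD[where I="{1..}" and F="\<lambda>i. {Y i -` A \<inter> space R | A. A \<in> sets (vecs J)}"]) auto
  also have "\<dots> = (\<Prod>i\<in>{1..n}. prob {\<omega>\<in>space M. (\<lambda>k\<in>J. X k \<omega>) \<in> B})"
    by (intro prod.cong refl iid_law[OF iid _ B]) auto
  also have "\<dots> = prob {\<omega>\<in>space M. (\<lambda>k\<in>J. X k \<omega>) \<in> B} ^ n" by simp
  also have "{\<omega>\<in>space M. (\<lambda>k\<in>J. X k \<omega>) \<in> B} = space M - {\<omega>\<in>space M. b < threshold_ratio F (\<lambda>k. X k \<omega>)}"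
  proof -
    have "(\<lambda>k\<in>J. X k \<omega>) \<in> B \<longleftrightarrow> threshold_ratio F (\<lambda>k. X k \<omega>) \<le> b" for \<omega>
    proof -
      have "(\<lambda>k\<in>J. X k \<omega>) \<in> B \<longleftrightarrow> (\<forall>(k, j, c)\<in>F. (\<lambda>k\<in>J. X k \<omega>) k $ j \<le> c * b)"
        by (simp add: B_def space_PiM)
      also have "\<dots> \<longleftrightarrow> (\<forall>(k, j, c)\<in>F. X k \<omega> $ j \<le> c * b)"
        using F(2) by (intro ball_cong refl) auto
      finally show ?thesis
        unfolding threshold_ratio_le_iff[OF F(1) less_imp_le[OF b] F(2)] .
    qed
    then show ?thesis by (simp add: set_eq_iff not_less) blast
  qed
  also have "prob \<dots> = 1 - prob {\<omega>\<in>space M. b < threshold_ratio F (\<lambda>k. X k \<omega>)}"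
    by (intro prob_compl borel_measurable_less borel_measurable_const homogeneous_measurable[OF hom])
  finally show ?thesis .
qed

text \<open>The constants come from the tail of the norm at time 0 alone, so one sequence serves all
  \<open>t\<close> and all choices of copies.\<close>

theorem maxima_weakly_converge:
  assumes poisson: "poisson_points P points (\<lambda>i \<omega>. (U i \<omega>, T i \<omega>, \<Xi> i \<omega>))"
  shows "\<exists>b::nat \<Rightarrow> real. (\<forall>n. b n > 0) \<and>
    (\<forall>(R::'e measure) Y. iid_copies R Y {0..int t} M X \<longrightarrow>
      weakly_converges (vecs_top {0..int t})
        (\<lambda>n. distr R (vecs {0..int t})
               (\<lambda>\<omega>. \<lambda>k\<in>{0..int t}. \<chi> j. MAX i\<in>{1..n}. Y i \<omega> k $ j / b n))
        (distr P (vecs {0..int t}) (\<lambda>\<omega>. \<lambda>k\<in>{0..int t}. max_stable_limit N \<alpha> U T \<Xi> k \<omega>))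
        sequentially)"
proof -
  let ?J = "{0..int t}" and ?Z = "max_stable_limit N \<alpha> U T \<Xi>"
  have anti: "tail y \<le> tail x" if "x \<le> y" for x y
    unfolding tail_def using that by (intro finite_measure_mono) auto
  have zero: "(tail \<longlongrightarrow> 0) at_top"
    unfolding tail_def[abs_def] by (rule tail_probability_tendsto_0) (unfold_locales, measurable)
  obtain b where b: "\<And>n. b n > 0" "filterlim b at_top sequentially" "(\<lambda>n. real n * tail (b n)) \<longlonglongrightarrow> 1"
    using normalizing_sequence[OF tail_pos anti zero tail_ratio] by blast
  interpret P: prob_space P using poisson unfolding poisson_points_def by blast
  have Z: "(\<lambda>\<omega>. \<lambda>k\<in>?J. ?Z k \<omega>) \<in> measurable P (vecs ?J)"
    by (rule measurable_restrict) (rule max_stable_limit_measurable[OF poisson])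
  have "weakly_converges (vecs_top ?J)
        (\<lambda>n. distr R (vecs ?J) (\<lambda>\<omega>. \<lambda>k\<in>?J. \<chi> j. MAX i\<in>{1..n}. Y i \<omega> k $ j / b n))
        (distr P (vecs ?J) (\<lambda>\<omega>. \<lambda>k\<in>?J. ?Z k \<omega>)) sequentially"
    if iid: "iid_copies R Y ?J M X" for R :: "'e measure" and Y
  proof -
    have pR: "prob_space R" and ind: "prob_space.indep_vars R (\<lambda>_. vecs ?J) Y {1..}"
      using iid unfolding iid_copies_def by auto
    interpret R: prob_space R by fact
    have Y: "Y i \<in> measurable R (vecs ?J)" if "i \<ge> 1" for i
      using ind that unfolding R.indep_vars_def2 by simp
    define m where "m n \<omega> = (\<lambda>k\<in>?J. \<chi> j. MAX i\<in>{1..n}. Y i \<omega> k $ j / b n)" for n \<omega>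
    have m_meas: "m n \<in> measurable R (vecs ?J)" if n: "n \<ge> 1" for n
      unfolding m_def[abs_def]
    proof (rule measurable_restrict, rule borel_measurable_vec_lambda)
      fix k j assume k: "k \<in> ?J"
      show "(\<lambda>\<omega>. MAX i\<in>{1..n}. Y i \<omega> k $ j / b n) \<in> borel_measurable R"
      proof (rule borel_measurable_Max)
        fix i assume "i \<in> {1..n}"
        then have [measurable]: "(\<lambda>\<omega>. Y i \<omega> k $ j) \<in> borel_measurable R"
          by (intro measurable_compose[OF Y component_measurable[OF k]]) simp
        show "(\<lambda>\<omega>. Y i \<omega> k $ j / b n) \<in> borel_measurable R" by measurable
      qed (use n in auto)
    qed
    have m_dist: "measure (distr R (vecs ?J) (m n)) {x\<in>space (vecs ?J). Q x} = measure R {\<omega>\<in>space R. Q (m n \<omega>)}"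
      if n: "n \<ge> 1" and Q: "{x\<in>space (vecs ?J). Q x} \<in> sets (vecs ?J)" for n and Q :: "(int \<Rightarrow> real^'d) \<Rightarrow> bool"
      using measurable_space[OF m_meas[OF n]]
      by (subst measure_distr[OF m_meas[OF n] Q]) (auto intro!: arg_cong[where f="measure R"])
    \<comment> \<open>For \<open>n = 0\<close> the maximum ranges over the empty set and has no
      meaningful value; hence the shift by one, undone at the end by
      \<open>LIMSEQ_imp_Suc\<close>.\<close>
    have "weakly_converges (vecs_top ?J) (\<lambda>n. distr R (vecs ?J) (m (Suc n)))
        (distr P (vecs ?J) (\<lambda>\<omega>. \<lambda>k\<in>?J. ?Z k \<omega>)) sequentially"
    proof (rule weakly_converges_orthants)
      fix F :: "(int \<times> 'd \<times> real) set"
      assume F: "finite F" "F \<subseteq> ?J \<times> UNIV \<times> {0<..}"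
      let ?p = "\<lambda>x. prob {\<omega>\<in>space M. x < threshold_ratio F (\<lambda>k. X k \<omega>)}"
      obtain c where c: "((\<lambda>x. ?p x / tail x) \<longlongrightarrow> c) at_top"
        "measure P {\<omega>\<in>space P. \<forall>(k, j, c)\<in>F. ?Z k \<omega> $ j \<le> c} = exp (- c)"
        using orthant_probability[OF poisson F] by blast
      \<comment> \<open>\<open>c\<close> is a limit relative to \<open>tail\<close>, and
        \<open>b\<close> makes \<open>n * tail (b n)\<close> tend to 1; the product removes the
        reference to \<open>tail\<close>.\<close>
      have "(\<lambda>n. (?p (b n) / tail (b n)) * (real n * tail (b n))) \<longlonglongrightarrow> c * 1"
        by (intro tendsto_mult filterlim_compose[OF c(1) b(2)] b(3))
      then have "(\<lambda>n. real n * ?p (b n)) \<longlonglongrightarrow> c"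
        using tail_pos by (simp add: less_imp_neq[symmetric] mult.commute)
      then have "(\<lambda>n. (1 - ?p (b n)) ^ n) \<longlonglongrightarrow> exp (- c)"
        by (intro power_one_minus_limit) (auto simp: measure_nonneg)
      from LIMSEQ_Suc[OF this]
      have "(\<lambda>n. (1 - ?p (b (Suc n))) ^ Suc n) \<longlonglongrightarrow> exp (- c)" .
      moreover have "measure (distr R (vecs ?J) (m (Suc n))) {x\<in>space (vecs ?J). \<forall>(k, j, c)\<in>F. x k $ j \<le> c}
          = (1 - ?p (b (Suc n))) ^ Suc n" for n
      proof -
        have "{\<omega>\<in>space R. \<forall>(k, j, c)\<in>F. m (Suc n) \<omega> k $ j \<le> c}
           = {\<omega>\<in>space R. \<forall>(k, j, c)\<in>F. (MAX i\<in>{1..Suc n}. Y i \<omega> k $ j / b (Suc n)) \<le> c}"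
          using F(2) by (intro Collect_cong conj_cong ball_cong refl) (auto simp: m_def)
        then show ?thesis
          using max_iid_probability[OF iid _ _ b(1) F, of "Suc n" "Suc n"] m_dist[OF _ orthant_sets[OF F, of "\<lambda>c. c"], of "Suc n"] by simp
      qed
      moreover have "measure (distr P (vecs ?J) (\<lambda>\<omega>. \<lambda>k\<in>?J. ?Z k \<omega>)) {x\<in>space (vecs ?J). \<forall>(k, j, c)\<in>F. x k $ j \<le> c}
          = exp (- c)"
      proof -
        have "measure (distr P (vecs ?J) (\<lambda>\<omega>. \<lambda>k\<in>?J. ?Z k \<omega>)) {x\<in>space (vecs ?J). \<forall>(k, j, c)\<in>F. x k $ j \<le> c}
          = measure P {\<omega>\<in>space P. \<forall>(k, j, c)\<in>F. (\<lambda>k\<in>?J. ?Z k \<omega>) k $ j \<le> c}"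
          using measurable_space[OF Z]
          by (subst measure_distr[OF Z orthant_sets[OF F, of "\<lambda>c. c"]]) (auto intro!: arg_cong[where f="measure P"])
        also have "{\<omega>\<in>space P. \<forall>(k, j, c)\<in>F. (\<lambda>k\<in>?J. ?Z k \<omega>) k $ j \<le> c} = {\<omega>\<in>space P. \<forall>(k, j, c)\<in>F. ?Z k \<omega> $ j \<le> c}"
          using F(2) by (intro Collect_cong conj_cong ball_cong refl) auto
        finally show ?thesis unfolding c(2) .
      qed
      ultimately show "(\<lambda>n. measure (distr R (vecs ?J) (m (Suc n))) {x\<in>space (vecs ?J). \<forall>(k, j, c)\<in>F. x k $ j \<le> c})
        \<longlonglongrightarrow> measure (distr P (vecs ?J) (\<lambda>\<omega>. \<lambda>k\<in>?J. ?Z k \<omega>)) {x\<in>space (vecs ?J). \<forall>(k, j, c)\<in>F. x k $ j \<le> c}"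
        by simp
    next
      fix k j and \<delta> :: real assume k: "k \<in> ?J" and \<delta>: "\<delta> > 0"
      have [measurable]: "(\<lambda>\<omega>. - X k \<omega> $ j) \<in> borel_measurable M"
        by (intro borel_measurable_uminus measurable_compose[OF X_measurable] borel_measurable_continuous_onI continuous_intros)
      have km [measurable]: "(\<lambda>x. x k $ j) \<in> borel_measurable (vecs ?J :: (int \<Rightarrow> real^'d) measure)"
        by (rule component_measurable[OF k])
      have t: "((\<lambda>x. prob {\<omega>\<in>space M. x < - X k \<omega> $ j}) \<longlongrightarrow> 0) at_top"
        by (rule tail_probability_tendsto_0[OF prob_space_axioms]) measurable
      have "filterlim (\<lambda>n. \<delta> * b (Suc n)) at_top sequentially"
        using \<delta> filterlim_compose[OF b(2) filterlim_Suc] by (intro filterlim_tendsto_pos_mult_at_top[OF tendsto_const]) auto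
      from filterlim_compose[OF t this]
      have null: "(\<lambda>n. prob {\<omega>\<in>space M. \<delta> * b (Suc n) < - X k \<omega> $ j}) \<longlonglongrightarrow> 0" .
      \<comment> \<open>The maximum is at least the first copy, so it is very negative only if that
        copy is. A single copy divided by \<open>b n\<close> tends to 0 in probability because
        \<open>b n\<close> tends to infinity.\<close>
      have le: "norm (measure (distr R (vecs ?J) (m (Suc n))) {x\<in>space (vecs ?J). x k $ j < - \<delta>})
          \<le> prob {\<omega>\<in>space M. \<delta> * b (Suc n) < - X k \<omega> $ j}" for n
      proof -
        let ?B = "{x\<in>space (vecs ?J :: (int \<Rightarrow> real^'d) measure). \<delta> * b (Suc n) < - x k $ j}"
        have B: "?B \<in> sets (vecs ?J)" by measurable
        have "norm (measure (distr R (vecs ?J) (m (Suc n))) {x\<in>space (vecs ?J). x k $ j < - \<delta>})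
            = measure (distr R (vecs ?J) (m (Suc n))) {x\<in>space (vecs ?J). x k $ j < - \<delta>}"
          by (simp only: real_norm_def abs_of_nonneg measure_nonneg)
        also have "\<dots> = measure R {\<omega>\<in>space R. m (Suc n) \<omega> k $ j < - \<delta>}"
          by (rule m_dist) measurable
        also have "\<dots> \<le> measure R (Y 1 -` ?B \<inter> space R)"
        proof (rule R.finite_measure_mono)
          show "Y 1 -` ?B \<inter> space R \<in> sets R" by (rule measurable_sets[OF Y B]) simp
          show "{\<omega>\<in>space R. m (Suc n) \<omega> k $ j < - \<delta>} \<subseteq> Y 1 -` ?B \<inter> space R"
          proof safe
            fix \<omega> assume \<omega>: "\<omega> \<in> space R" and "m (Suc n) \<omega> k $ j < - \<delta>"
            then have "(MAX i\<in>{1..Suc n}. Y i \<omega> k $ j / b (Suc n)) < - \<delta>" using k by (simp add: m_def)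
            moreover have "Y 1 \<omega> k $ j / b (Suc n) \<le> (MAX i\<in>{1..Suc n}. Y i \<omega> k $ j / b (Suc n))"
              by (intro Max_ge) auto
            ultimately have "Y 1 \<omega> k $ j / b (Suc n) < - \<delta>" by linarith
            then have "Y 1 \<omega> k $ j < - \<delta> * b (Suc n)" using b(1)[of "Suc n"] by (simp add: divide_less_eq)
            then show "\<omega> \<in> Y 1 -` ?B" using measurable_space[OF Y \<omega>, of 1] by simp
          qed
        qed
        also have "\<dots> = prob {\<omega>\<in>space M. (\<lambda>k\<in>?J. X k \<omega>) \<in> ?B}"
          by (rule iid_law[OF iid _ B]) simp
        also have "{\<omega>\<in>space M. (\<lambda>k\<in>?J. X k \<omega>) \<in> ?B} = {\<omega>\<in>space M. \<delta> * b (Suc n) < - X k \<omega> $ j}"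
          using k by (auto simp: space_PiM)
        finally show ?thesis .
      qed
      show "(\<lambda>n. measure (distr R (vecs ?J) (m (Suc n))) {x\<in>space (vecs ?J). x k $ j < - \<delta>}) \<longlonglongrightarrow> 0"
        by (rule Lim_null_comparison[OF always_eventually null]) (rule allI, rule le)
    next
      have "AE \<omega> in P. \<forall>k\<in>{0..t}. \<forall>j. 0 \<le> ?Z (int k) \<omega> $ j"
        using max_stable_limit_nonneg[OF poisson] by (simp add: AE_ball_countable AE_all_countable)
      then have "AE \<omega> in P. \<forall>k\<in>?J. \<forall>j. 0 \<le> (\<lambda>k\<in>?J. ?Z k \<omega>) k $ j"
      proof eventually_elim
        case (elim \<omega>)
        show ?case
        proof (intro ballI allI)
          fix k j assume "k \<in> ?J"
          then have "nat k \<in> {0..t}" "k = int (nat k)" by auto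
          then show "0 \<le> (\<lambda>k\<in>?J. ?Z k \<omega>) k $ j" using elim \<open>k \<in> ?J\<close> by (metis restrict_apply')
        qed
      qed
      moreover have "{x\<in>space (vecs ?J :: (int \<Rightarrow> real^'d) measure). \<forall>k\<in>?J. \<forall>j. 0 \<le> x k $ j} \<in> sets (vecs ?J)"
        by (intro sets.sets_Collect_finite_All sets.sets_Collect_countable_All borel_measurable_le component_measurable) auto
      ultimately show "AE x in distr P (vecs ?J) (\<lambda>\<omega>. \<lambda>k\<in>?J. ?Z k \<omega>). \<forall>k\<in>?J. \<forall>j. 0 \<le> x k $ j"
        by (subst AE_distr_iff[OF Z]) auto
    qed (auto intro!: R.prob_space_distr m_meas P.prob_space_distr Z)
    note shifted = this
    show ?thesis
      unfolding weakly_converges_def m_def[symmetric]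
    proof (intro allI impI)
      fix f :: "(int \<Rightarrow> real^'d) \<Rightarrow> real"
      assume f: "continuous_map (vecs_top ?J) euclidean f \<and> bounded (f ` topspace (vecs_top ?J))"
      show "(\<lambda>n. \<integral>x. f x \<partial>distr R (vecs ?J) (\<lambda>\<omega>. m n \<omega>)) \<longlonglongrightarrow> (\<integral>x. f x \<partial>distr P (vecs ?J) (\<lambda>\<omega>. \<lambda>k\<in>?J. ?Z k \<omega>))"
        by (rule LIMSEQ_imp_Suc)
           (rule shifted[unfolded weakly_converges_def, THEN spec[of _ f], THEN mp, OF f])
    qed
  qed
  with b(1) show ?thesis by (intro exI[of _ b]) blast
qed

end

theorem proposition3p5:
  fixes N :: "real^'d \<Rightarrow> real" and \<alpha> :: real
    and M :: "'a measure" and X :: "int \<Rightarrow> 'a \<Rightarrow> real^'d"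
    and Q :: "'b measure" and \<Theta> :: "int \<Rightarrow> 'b \<Rightarrow> real^'d"
    and P :: "'c measure" and U :: "nat \<Rightarrow> 'c \<Rightarrow> real" and T :: "nat \<Rightarrow> 'c \<Rightarrow> int"
    and \<Xi> :: "nat \<Rightarrow> 'c \<Rightarrow> int \<Rightarrow> real^'d"
    and Z :: "int \<Rightarrow> 'c \<Rightarrow> real^'d"
  assumes "is_norm N" and "\<alpha> > 0"
    and "prob_space M" and "\<And>t. X t \<in> borel_measurable M"
    and "stationary M X" and "regularly_varying N \<alpha> M X"
    and "prob_space Q" and "\<And>t. \<Theta> t \<in> borel_measurable Q"
    and "\<And>t \<omega> j. \<omega> \<in> space Q \<Longrightarrow> 0 \<le> \<Theta> t \<omega> $ j"
    and "spectral_tail_process N M X Q \<Theta>"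
    and "AE \<omega> in Q. (\<lambda>t. N (\<Theta> t \<omega>) powr \<alpha>) summable_on UNIV \<and>
                    0 < (\<Sum>\<^sub>\<infinity>t. N (\<Theta> t \<omega>) powr \<alpha>)"
    and "poisson_points P (intensity \<alpha> Q \<Theta>) (\<lambda>i \<omega>. (U i \<omega>, T i \<omega>, \<Xi> i \<omega>))"
    and "Z = max_stable_limit N \<alpha> U T \<Xi>"
  shows "\<forall>t::nat. \<exists>b::nat \<Rightarrow> real. (\<forall>n. b n > 0) \<and>
    (\<forall>(R::'e measure) Y. iid_copies R Y {0..int t} M X \<longrightarrow>
      weakly_converges (vecs_top {0..int t})
        (\<lambda>n. distr R (vecs {0..int t})
               (\<lambda>\<omega>. \<lambda>k\<in>{0..int t}. \<chi> j. MAX i\<in>{1..n}. Y i \<omega> k $ j / b n))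
        (distr P (vecs {0..int t}) (\<lambda>\<omega>. \<lambda>k\<in>{0..int t}. Z k \<omega>))
        sequentially)"
proof -
  interpret max_stable_series M N \<alpha> X Q \<Theta>
  proof (intro max_stable_series.intro spectral_series.intro regularly_varying_series.intro
      regularly_varying_series_axioms.intro spectral_series_axioms.intro max_stable_series_axioms.intro)
    show "AE \<omega> in Q. (\<lambda>t. N (\<Theta> t \<omega>) powr \<alpha>) summable_on UNIV"
      using assms(11) by eventually_elim simp
  qed (use assms in auto)
  show ?thesis
    unfolding assms(13) by (intro allI maxima_weakly_converge assms(12))
qed

end
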